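(* Let $n \in \mathbb{Z}_{\geq 0}$, $k \in \mathbb{Z}_{\geq 1}$ and $m_1, \ldots, m_k \in \mathbb{Z}_{\geq 2}$, and assume that $(n,k,m_1,\ldots,m_k)$ is neither of the form $(0,1,m_1)$ nor equal to $(0,2,2,2)$. Let \[ \widehat{G} = \langle e_1, \ldots, e_k, h_1, \ldots, h_{2n}, z \mid e_1^{m_1} = \cdots = e_k^{m_k} = z,\ [h_1, z] = \cdots = [h_{2n}, z] = 1 \rangle. \] Then $\widehat{G}$ admits countably infinitely many isolated left orders, none of which is an automorphic image of another.
   Context: Here $[g,h]=ghg^{-1}h^{-1}$. A left order on a group $\Gamma$ is a total order $<$ on $\Gamma$ such that $g_1<g_2$ implies $gg_1<gg_2$ for all $g,g_1,g_2\in\Gamma$. The set $LO(\Gamma)$ of left orders is identified with a subset of $\{\pm1\}^{\Gamma\setminus\{1\}}$ via $<\ \mapsto \lambda$, where $\lambda(g)=1$ iff $1<g$, and carries the subspace topology of the product topology; a left order is isolated if it is an isolated point of $LO(\Gamma)$. For an automorphism $\phi$ of $\Gamma$, the automorphic image $<_\phi$ of $<$ is defined by $g_1<_\phi g_2$ iff $\phi(g_1)<\phi(g_2)$. *)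

theory Defs
  imports "HOL-Algebra.Group" "HOL-Library.Countable_Set"
begin

text \<open>A word is a list of letters (g, b); b = False means g, b = True means g inverse.\<close>
type_synonym 'g word = "('g \<times> bool) list"

inductive pres_eq :: "'g word set \<Rightarrow> 'g word \<Rightarrow> 'g word \<Rightarrow> bool" for R where
  pe_refl: "pres_eq R w w"
| pe_sym: "pres_eq R u v \<Longrightarrow> pres_eq R v u"
| pe_trans: "pres_eq R u v \<Longrightarrow> pres_eq R v w \<Longrightarrow> pres_eq R u w"
| pe_cancel: "pres_eq R (u @ [(g, b), (g, \<not> b)] @ v) (u @ v)"
| pe_rel: "r \<in> R \<Longrightarrow> pres_eq R (u @ r @ v) (u @ v)"

definition pres_rel :: "'g set \<Rightarrow> 'g word set \<Rightarrow> ('g word \<times> 'g word) set" where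
  "pres_rel S R = {(u, v). u \<in> lists (S \<times> UNIV) \<and> v \<in> lists (S \<times> UNIV) \<and> pres_eq R u v}"

definition presented_group :: "'g set \<Rightarrow> 'g word set \<Rightarrow> ('g word set) monoid" where
  "presented_group S R =
     \<lparr> carrier = lists (S \<times> UNIV) // pres_rel S R,
       monoid.mult = (\<lambda>A B. \<Union>a\<in>A. \<Union>b\<in>B. pres_rel S R `` {a @ b}),
       one = pres_rel S R `` {[]} \<rparr>"

datatype gen = E nat | H nat | Z

text \<open>Generators e_1..e_k are E 0..E (k-1), h_1..h_{2n} are H 0..H (2n-1), and z is Z.\<close>
definition Ghat_gens :: "nat \<Rightarrow> nat \<Rightarrow> gen set" where
  "Ghat_gens n k = {E i | i. i < k} \<union> {H j | j. j < 2 * n} \<union> {Z}"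

definition Ghat_rels :: "nat \<Rightarrow> nat \<Rightarrow> (nat \<Rightarrow> nat) \<Rightarrow> gen word set" where
  "Ghat_rels n k m =
     {replicate (m i) (E i, False) @ [(Z, True)] | i. i < k}
   \<union> {[(H j, False), (Z, False), (H j, True), (Z, True)] | j. j < 2 * n}"

definition Ghat :: "nat \<Rightarrow> nat \<Rightarrow> (nat \<Rightarrow> nat) \<Rightarrow> (gen word set) monoid" where
  "Ghat n k m = presented_group (Ghat_gens n k) (Ghat_rels n k m)"

definition left_order :: "('a, 'b) monoid_scheme \<Rightarrow> ('a \<Rightarrow> 'a \<Rightarrow> bool) \<Rightarrow> bool" where
  "left_order G lt \<longleftrightarrow>
     (\<forall>x y. lt x y \<longrightarrow> x \<in> carrier G \<and> y \<in> carrier G)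
   \<and> (\<forall>x\<in>carrier G. \<not> lt x x)
   \<and> (\<forall>x\<in>carrier G. \<forall>y\<in>carrier G. \<forall>w\<in>carrier G. lt x y \<longrightarrow> lt y w \<longrightarrow> lt x w)
   \<and> (\<forall>x\<in>carrier G. \<forall>y\<in>carrier G. x \<noteq> y \<longrightarrow> lt x y \<or> lt y x)
   \<and> (\<forall>g\<in>carrier G. \<forall>x\<in>carrier G. \<forall>y\<in>carrier G. lt x y \<longrightarrow> lt (g \<otimes>\<^bsub>G\<^esub> x) (g \<otimes>\<^bsub>G\<^esub> y))"

text \<open>Isolated: isolated point of LO(G) in the subspace topology of the product topology on
  {+1,-1}^(G - {1}); the basic open sets are the cylinders fixing the sign on a finite set F,
  so this says the order is the only left order with its signs on some finite F.\<close>
definition isolated_left_order :: "('a, 'b) monoid_scheme \<Rightarrow> ('a \<Rightarrow> 'a \<Rightarrow> bool) \<Rightarrow> bool" where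
  "isolated_left_order G lt \<longleftrightarrow> left_order G lt \<and>
     (\<exists>F. finite F \<and> F \<subseteq> carrier G - {\<one>\<^bsub>G\<^esub>} \<and>
        (\<forall>lt'. left_order G lt' \<and> (\<forall>g\<in>F. lt \<one>\<^bsub>G\<^esub> g \<longleftrightarrow> lt' \<one>\<^bsub>G\<^esub> g) \<longrightarrow> lt' = lt))"

definition aut_image :: "('a, 'b) monoid_scheme \<Rightarrow> ('a \<Rightarrow> 'a \<Rightarrow> bool) \<Rightarrow> ('a \<Rightarrow> 'a) \<Rightarrow> ('a \<Rightarrow> 'a \<Rightarrow> bool)" where
  "aut_image G lt \<phi> = (\<lambda>x y. x \<in> carrier G \<and> y \<in> carrier G \<and> lt (\<phi> x) (\<phi> y))"

end

theory Submission
  imports Defs Complex_Main "HOL-Number_Theory.Cong" "HOL-Library.Product_Plus"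
begin

text \<open>
  A left order whose positive cone is a finitely generated semigroup is isolated.  If two groups carry
  such orders, with least positive elements \<open>cA\<close>, \<open>cB\<close> and a common cofinal central element \<open>z\<close>, then
  their amalgam over \<open>z\<close> carries the order whose cone is generated by the two cones and
  \<open>c = cA z\<^sup>-\<^sup>1 cB\<close>, and \<open>c\<close> is its least positive element; that this semigroup is a cone follows from
  an action on the line in which \<open>c\<close> moves the base point to the right.  If a normal subgroup of
  finite index has a cyclic quotient generated by the image of \<open>c\<close>, the restricted cone is again
  finitely generated.  Applied to amalgams of infinite cyclic groups, an index-two subgroup gives the
  factor generated by the \<open>h\<close>'s and \<open>z\<close>, and amalgamating the \<open>e\<close>'s gives one isolated order.

  For a homomorphism \<open>D\<close> to \<open>\<int>\<close> with \<open>D z = N\<close>, the map \<open>x \<mapsto> x z\<^bsup>t D x\<^esup>\<close> is injective with image of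
  index \<open>p = 1 + t N\<close>; pulling the order back along it yields the family.  Here
  \<open>D c / N = 1 - 2 n - \<Sum>(1 - 1 / m i)\<close> is the orbifold Euler characteristic, which is nonzero exactly
  because of the excluded cases, so \<open>p\<close> can be made prime to \<open>D c\<close>.  The least positive element of the
  pulled back order is \<open>c\<^sup>p\<close> up to a power of \<open>z\<close>.  Translation numbers lie in \<open>(1/N) \<int>\<close>, and comparing
  them with \<open>D\<close> shows that \<open>p\<close> is an invariant of the order up to automorphism.
\<close>

section \<open>Integer multiples and generated submonoids\<close>

text \<open>Groups are written additively without being commutative, and \<open>imul i x\<close> is
  the \<open>i\<close>-th power of \<open>x\<close>. Positivity is never derived from uniqueness of
  normal forms. A cone is here only a finitely generated, total submonoid that may meet its own
  negative, so amalgamation, passage to a subgroup and homomorphic images become identities inside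
  one ambient group that already contains all factors. The one property out of reach of such
  identities, that \<open>q\<close> and \<open>- q\<close> are both positive only for
  \<open>q = 0\<close>, comes at the end from the action on the line. The presented group therefore
  never has to be recognised as an amalgam: its relations serve to define the action and to check
  that \<open>z\<close> is central and a power of each \<open>e\<close>.

  The ambient group of the genus part is not the given one, which need not contain square roots of
  \<open>z\<close> whose products are the \<open>h\<close>'s; a wreath product supplies them. The
  action and \<open>D\<close> are the two coordinates of a single homomorphism, so the value
  \<open>D c\<close> can be computed along the construction. The scale \<open>N\<close> is twice the
  product of the \<open>m i\<close>, which makes \<open>N / m i\<close> and \<open>N / 2\<close>
  integers.\<close>

definition imul :: "int \<Rightarrow> 'a::group_add \<Rightarrow> 'a" where
  "imul i x = (if 0 \<le> i then ((+) x ^^ nat i) 0 else ((+) (- x) ^^ nat (- i)) 0)"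

lemma imul_0 [simp]: "imul 0 x = 0"
  by (simp add: imul_def)

lemma imul_succ: "imul (i + 1) x = x + imul i x"
proof (cases "0 \<le> i")
  case True
  then have "nat (i + 1) = Suc (nat i)" by simp
  with True show ?thesis by (simp add: imul_def)
next
  case False
  then have "nat (- i) = Suc (nat (- (i + 1)))" by simp
  with False show ?thesis by (auto simp: imul_def)
qed

lemma imul_1 [simp]: "imul 1 x = x"
  using imul_succ[of 0 x] by simp

lemma imul_add: "imul (i + j) x = imul i x + imul j x"
proof (induction i rule: int_induct[where k = 0])
  case base
  show ?case by simp
next
  case (step1 i)
  have "imul (i + 1 + j) x = x + imul (i + j) x"
    using imul_succ[of "i + j" x] by (simp add: ac_simps)
  with step1 show ?case by (simp add: imul_succ add.assoc)
next
  case (step2 i)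
  have "imul (i + j) x = x + imul (i - 1 + j) x"
    using imul_succ[of "i - 1 + j" x] by (simp add: ac_simps)
  moreover have "imul i x = x + imul (i - 1) x"
    using imul_succ[of "i - 1" x] by simp
  ultimately show ?case using step2 by (simp add: add.assoc)
qed

lemma imul_minus: "imul (- i) x = - imul i x"
  using imul_add[of "- i" i x] by (simp add: eq_neg_iff_add_eq_0)

lemma imul_succ': "imul (i + 1) x = imul i x + x"
  by (simp add: imul_add)

lemma imul_commute: "x + y = y + x \<Longrightarrow> imul i x + y = y + imul i x" for x y :: "'a::group_add"
proof (induction i rule: int_induct[where k = 0])
  case (step1 i)
  then show ?case by (metis add.assoc imul_succ')
next
  case (step2 i)
  have "imul i x = imul (i - 1) x + x"
    using imul_succ'[of "i - 1" x] by simp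
  then have "imul (i - 1) x + y + x = y + imul (i - 1) x + x"
    using step2 by (simp add: add.assoc)
  then show ?case by (simp only: add_right_cancel)
qed simp

lemma imul_commute2: "x + y = y + x \<Longrightarrow> imul i x + imul j y = imul j y + imul i x" for x y :: "'a::group_add"
  by (metis imul_commute)

lemma imul_plus: "x + y = y + x \<Longrightarrow> imul i (x + y) = imul i x + imul i y" for x y :: "'a::group_add"
proof (induction i rule: int_induct[where k = 0])
  case (step1 i)
  have "imul (i + 1) (x + y) = x + y + (imul i x + imul i y)"
    using step1 by (simp only: imul_succ)
  also have "\<dots> = x + (y + imul i x) + imul i y" by (simp only: add.assoc)
  also have "\<dots> = x + (imul i x + y) + imul i y" using imul_commute[of x y i] step1.prems by simp
  finally show ?case by (simp add: imul_succ add.assoc)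
next
  case (step2 i)
  have e: "imul i u = u + imul (i - 1) u" for u :: 'a
    using imul_succ[of "i - 1" u] by simp
  have "x + y + imul (i - 1) (x + y) = x + imul (i - 1) x + (y + imul (i - 1) y)"
    using step2 by (simp flip: e)
  also have "\<dots> = x + (imul (i - 1) x + y) + imul (i - 1) y" by (simp add: add.assoc)
  also have "\<dots> = x + (y + imul (i - 1) x) + imul (i - 1) y"
    using imul_commute[of x y] step2.prems by simp
  finally show ?case by (simp add: add.assoc)
qed simp

lemma imul_mult: "imul (i * j) x = imul i (imul j x)"
proof (induction i rule: int_induct[where k = 0])
  case (step1 i)
  have "imul ((i + 1) * j) x = imul (i * j) x + imul j x"
    by (simp add: distrib_right imul_add)
  with step1 show ?case by (simp add: imul_succ')
next
  case (step2 i)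
  have "imul j x + imul ((i - 1) * j) x = imul j x + imul (i - 1) (imul j x)"
  proof -
    have "imul j x + imul ((i - 1) * j) x = imul (i * j) x"
      by (simp add: left_diff_distrib flip: imul_add)
    then show ?thesis using step2 imul_succ[of "i - 1" "imul j x"] by simp
  qed
  then show ?case by simp
qed simp

lemma imul_zero [simp]: "imul i 0 = 0"
  by (metis imul_0 imul_mult mult_zero_right)

lemma imul_conj: "imul i (g + x + - g) = g + imul i x + - g"
proof (induction i rule: int_induct[where k = 0])
  case (step1 i)
  then show ?case by (simp add: imul_succ add.assoc del: add_uminus_conv_diff)
next
  case (step2 i)
  have e: "imul i u = u + imul (i - 1) u" for u :: 'a
    using imul_succ[of "i - 1" u] by simp
  have "g + x + - g + imul (i - 1) (g + x + - g) = g + x + - g + (g + imul (i - 1) x + - g)"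
    using step2 e[of x] e[of "g + x + - g"] by (simp add: add.assoc del: add_uminus_conv_diff)
  then show ?case by (simp only: add_left_cancel)
qed simp

text \<open>The groups below are subsets of an ambient type, so additivity of \<open>f\<close> is
  only available on \<open>X\<close>; membership and equation are proved together because each
  induction step needs the former for the latter.\<close>

lemma imul_hom:
  assumes "\<And>x y. x \<in> X \<Longrightarrow> y \<in> X \<Longrightarrow> f (x + y) = f x + f y"
    and "\<And>x y. x \<in> X \<Longrightarrow> y \<in> X \<Longrightarrow> x + y \<in> X" and "\<And>x. x \<in> X \<Longrightarrow> - x \<in> X" and "0 \<in> X" and x: "x \<in> X"
  shows "imul i x \<in> X \<and> f (imul i x) = imul i (f x)"
proof (induction i rule: int_induct[where k = 0])
  case base
  have "f (0 + 0) = f 0 + f 0" using assms by blast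
  then have "f 0 = 0" using add_left_cancel[of "f 0" "f 0" 0] by simp
  then show ?case using assms by simp
next
  case (step1 i)
  then show ?case using assms by (simp add: imul_succ)
next
  case (step2 i)
  have e: "imul (i - 1) u = - u + imul i u" for u :: "'c::group_add"
    using imul_succ[of "i - 1" u] by simp
  have e': "imul (i - 1) x = - x + imul i x" 
    using imul_succ[of "i - 1" x] by simp
  have m: "imul (i - 1) x \<in> X" using step2 assms e' by simp
  have "f (imul i x) = f (x + imul (i - 1) x)" using e' by simp
  also have "\<dots> = f x + f (imul (i - 1) x)" using assms m by simp
  finally show ?case using m step2 imul_succ[of "i - 1" "f x"] by simp
qed

lemma imul_int: "imul i (u::int) = i * u"
proof (induction i rule: int_induct[where k = 0])
  case (step2 i)
  then show ?case using imul_succ[of "i - 1" u] by (simp add: algebra_simps)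
qed (simp_all add: imul_succ algebra_simps)

lemma imul_prod: "imul i p = (imul i (fst p), imul i (snd p))"
  using imul_hom[of UNIV fst p i] imul_hom[of UNIV snd p i] by (simp add: prod_eq_iff)

inductive_set mgen :: "'a::monoid_add set \<Rightarrow> 'a set" for S where
  mgen_zero: "0 \<in> mgen S"
| mgen_step: "s \<in> S \<Longrightarrow> x \<in> mgen S \<Longrightarrow> s + x \<in> mgen S"

lemma mgen_incl: "s \<in> S \<Longrightarrow> s \<in> mgen S"
  using mgen_step[OF _ mgen_zero] by fastforce

lemma mgen_add: "x \<in> mgen S \<Longrightarrow> y \<in> mgen S \<Longrightarrow> x + y \<in> mgen S"
  by (induction rule: mgen.induct) (auto simp: add.assoc intro: mgen.intros)

lemma mgen_least:
  assumes "\<And>s. s \<in> S \<Longrightarrow> s \<in> M" "0 \<in> M" "\<And>x y. x \<in> M \<Longrightarrow> y \<in> M \<Longrightarrow> x + y \<in> M"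
  shows "mgen S \<subseteq> M"
proof
  fix x assume "x \<in> mgen S"
  then show "x \<in> M" by (induction rule: mgen.induct) (auto intro: assms)
qed

lemma mgen_mono: "S \<subseteq> T \<Longrightarrow> mgen S \<subseteq> mgen T"
  by (rule mgen_least) (auto intro: mgen_incl mgen_zero mgen_add)

lemma mgen_neg:
  fixes S :: "'a::group_add set"
  assumes "\<And>s. s \<in> S \<Longrightarrow> - s \<in> S" and "x \<in> mgen S"
  shows "- x \<in> mgen S"
  using assms(2)
proof (induction rule: mgen.induct)
  case (mgen_step s x)
  then show ?case using mgen_add[OF _ mgen_incl[OF assms(1)]] by (simp only: minus_add)
qed (simp add: mgen_zero)

lemma mgen_imul: "x \<in> mgen S \<Longrightarrow> imul (int n) x \<in> mgen S"
  by (induction n) (auto simp: imul_succ add.commute[of 1] mgen_zero mgen_add)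

lemma mgen_image:
  assumes "\<And>x y. x \<in> X \<Longrightarrow> y \<in> X \<Longrightarrow> f (x + y) = f x + f y" "f 0 = 0" "mgen S \<subseteq> X"
  shows "f ` mgen S = mgen (f ` S)"
proof (intro equalityI subsetI)
  fix y assume "y \<in> f ` mgen S"
  then obtain x where x: "x \<in> mgen S" "y = f x" by blast
  have "f x \<in> mgen (f ` S)" using x(1)
  proof (induction rule: mgen.induct)
    case (mgen_step s x)
    then have "f (s + x) = f s + f x" using assms mgen_incl[of s S] by blast
    then show ?case using mgen_step by (simp add: mgen.mgen_step)
  qed (simp add: assms mgen_zero)
  then show "y \<in> mgen (f ` S)" using x by simp
next
  fix y assume "y \<in> mgen (f ` S)"
  then show "y \<in> f ` mgen S"
  proof (induction rule: mgen.induct)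
    case mgen_zero
    show ?case using assms(2) mgen.mgen_zero by force
  next
    case (mgen_step s y)
    then obtain s' x where "s' \<in> S" "s = f s'" "x \<in> mgen S" "y = f x" by auto
    moreover then have "f (s' + x) = s + y" using assms mgen_incl[of s' S] by auto
    ultimately show ?case using mgen.mgen_step by (metis imageI)
  qed
qed

section \<open>Discrete positive cones\<close>

text \<open>All powers of \<open>y\<close> stay between \<open>- C z\<close> and \<open>C z\<close>.
  For central cofinal \<open>z\<close> this expresses that the translation number of
  \<open>y\<close> relative to \<open>z\<close> is 0, without defining a real-valued translation
  number.\<close>

definition power_bounded :: "'a::group_add \<Rightarrow> 'a set \<Rightarrow> 'a \<Rightarrow> bool" where
  "power_bounded z Q y \<longleftrightarrow>
     (\<exists>C. \<forall>n::nat. imul n y + imul (int C) z \<in> Q \<and> - imul n y + imul (int C) z \<in> Q)"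

text \<open>For a genuine order \<open>least_right\<close> follows from \<open>least_left\<close>
  through antisymmetry. As antisymmetry is not among the assumptions, both are carried along. The
  assumption \<open>two_c\<close> says that \<open>c + c\<close> is at most \<open>z\<close>; it
  supplies the compensating terms in the amalgam.\<close>

locale precone =
  fixes z :: "'a::group_add" and X Q :: "'a set" and c :: 'a
  assumes zero_X: "0 \<in> X" and add_X: "x \<in> X \<Longrightarrow> y \<in> X \<Longrightarrow> x + y \<in> X"
    and neg_X: "x \<in> X \<Longrightarrow> - x \<in> X"
    and central: "x \<in> X \<Longrightarrow> x + z = z + x"
    and fin_gen: "\<exists>S. finite S \<and> Q = mgen S"
    and Q_X: "Q \<subseteq> X"
    and z_Q: "z \<in> Q" and c_Q: "c \<in> Q"
    and total: "x \<in> X \<Longrightarrow> x \<in> Q \<or> - x \<in> Q"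
    and least_left: "q \<in> Q \<Longrightarrow> q \<noteq> 0 \<Longrightarrow> - c + q \<in> Q"
    and least_right: "q \<in> Q \<Longrightarrow> q \<noteq> 0 \<Longrightarrow> q + - c \<in> Q"
    and two_c: "- c + (- c + z) \<in> Q"
    and cofinal: "x \<in> X \<Longrightarrow> \<exists>i::nat. x + imul i z \<in> Q"
begin

lemma zero_Q: "0 \<in> Q" and add_Q: "x \<in> Q \<Longrightarrow> y \<in> Q \<Longrightarrow> x + y \<in> Q"
  using fin_gen by (auto intro: mgen_zero mgen_add)

lemma imul_Q: "x \<in> Q \<Longrightarrow> imul (int n) x \<in> Q"
  using fin_gen by (auto intro: mgen_imul)

lemma imul_Q': "x \<in> Q \<Longrightarrow> 0 \<le> i \<Longrightarrow> imul i x \<in> Q"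
  using imul_Q[of x "nat i"] by simp

lemma z_X: "z \<in> X" and c_X: "c \<in> X"
  using z_Q c_Q Q_X by auto

lemma imul_X: "x \<in> X \<Longrightarrow> imul i x \<in> X"
  using imul_hom[of X "\<lambda>x. x" x i] zero_X add_X neg_X by blast

lemma imul_z_commute: "x \<in> X \<Longrightarrow> x + imul i z = imul i z + x"
  using imul_commute[of z x i] central[of x] by simp

lemma z_minus_c: "- c + z \<in> Q"
proof -
  have "- c + z = c + (- c + (- c + z))" by (simp add: add.assoc)
  then show ?thesis using add_Q c_Q two_c by metis
qed

definition unit_interval :: "'a set" where
  "unit_interval = {a. a \<in> Q \<and> a \<noteq> 0 \<and> - a + z \<in> Q \<and> - a + z \<noteq> 0}"

lemma unit_interval_X: "a \<in> unit_interval \<Longrightarrow> a \<in> X"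
  using Q_X by (auto simp: unit_interval_def)

lemma unit_interval_flip: "a \<in> unit_interval \<Longrightarrow> - a + z \<in> unit_interval"
  using central[of "- a"] neg_X[of a] unit_interval_X[of a]
  by (auto simp: unit_interval_def minus_add add.assoc)

text \<open>Division by \<open>z\<close> with remainder: \<open>x\<close> is shifted by the smallest
  multiple of \<open>z\<close> that makes it positive.\<close>

lemma floor_decomposition:
  assumes x: "x \<in> X"
  obtains i a where "x = imul i z + a" "a \<in> insert 0 unit_interval"
proof -
  obtain j k :: nat where j: "x + imul j z \<in> Q" and k: "- x + imul k z \<in> Q"
    using cofinal x neg_X by metis
  \<comment> \<open>The exponent is offset by \<open>k\<close> so that the search runs over the
    naturals. If the minimum is at \<open>0\<close>, the bound for \<open>- x\<close> replaces the
    argument by minimality.\<close>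
  define P where "P i \<longleftrightarrow> x + imul (int i - int k) z \<in> Q" for i :: nat
  have "P (j + k)" using j by (simp add: P_def)
  then have ex: "\<exists>i. P i" by blast
  define i where "i = (LEAST i. P i)"
  have Pi: "P i" unfolding i_def using ex by (rule LeastI_ex)
  define a where "a = x + imul (int i - int k) z"
  have aQ: "a \<in> Q" using Pi by (simp add: a_def P_def)
  have com: "imul u z + - x = - x + imul u z" for u
    using imul_z_commute[of "- x" u] x neg_X by simp
  have "- a + z = - x + imul (int k - int i + 1) z"
  proof -
    have "- a = imul (int k - int i) z + - x"
      by (simp add: a_def minus_add flip: imul_minus)
    then show ?thesis using com by (simp add: imul_succ' add.assoc)
  qed
  moreover have "- x + imul (int k - int i + 1) z \<in> Q"
  proof (cases i)
    case 0
    have "- x + imul (int k + 1) z = (- x + imul k z) + z" by (simp add: imul_succ' add.assoc)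
    then show ?thesis using 0 add_Q[OF k z_Q] by simp
  next
    case (Suc l)
    then have "\<not> P l" using not_less_Least[of l P] by (simp add: i_def)
    then have "x + imul (int l - int k) z \<notin> Q" by (simp add: P_def)
    then have "- (x + imul (int l - int k) z) \<in> Q"
      using total[of "x + imul (int l - int k) z"] x z_X add_X imul_X by blast
    moreover have "- (x + imul (int l - int k) z) = - x + imul (int k - int i + 1) z"
    proof -
      have "int k - int i + 1 = - (int l - int k)" using Suc by simp
      then show ?thesis using com[of "- (int l - int k)"] by (simp only: minus_add imul_minus)
    qed
    ultimately show ?thesis by simp
  qed
  ultimately have zaQ: "- a + z \<in> Q" by simp
  have xa: "x = imul (int k - int i) z + a"
    using com[of "int k - int i"] imul_z_commute[OF x] imul_add[of "int k - int i" "int i - int k" z]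
    by (simp add: a_def flip: add.assoc)
  show thesis
  \<comment> \<open>A remainder equal to \<open>z\<close> is absorbed into the multiple.\<close>
  proof (cases "- a + z = 0")
    case True
    then have "a + (- a + z) = a" by simp
    then have "a = z" by simp
    then have "x = imul (int k - int i + 1) z + 0" using xa by (simp add: imul_succ')
    then show thesis using that by blast
  next
    case False
    then show thesis using that[OF xa] aQ zaQ by (auto simp: unit_interval_def)
  qed
qed

text \<open>\<open>Q\<close> is not invariant under conjugation, but \<open>d\<close> and
  \<open>e\<close> with \<open>g + d z\<close> and \<open>- g + e z\<close> positive let
  \<open>g\<close> and \<open>- g\<close> be inserted on the two sides. The bound \<open>C\<close>
  grows to \<open>C + d + e\<close>, independently of the power.\<close>

lemma power_bounded_conj:
  assumes g: "g \<in> X" and y: "y \<in> X" "power_bounded z Q y"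
  shows "power_bounded z Q (g + y + - g)"
proof -
  obtain C where C: "\<And>n::nat. imul n y + imul (int C) z \<in> Q" "\<And>n::nat. - imul n y + imul (int C) z \<in> Q"
    using y(2) by (auto simp: power_bounded_def)
  obtain d e :: nat where d: "g + imul d z \<in> Q" and e: "- g + imul e z \<in> Q"
    using cofinal g neg_X by metis
  have zg: "imul i z + - g = - g + imul i z" for i
    using imul_z_commute neg_X g by metis
  have key: "g + u + - g + imul (int (C + d + e)) z \<in> Q"
    if "u + imul (int C) z \<in> Q" "u \<in> X" for u
  proof -
    have "imul (int (C + d + e)) z = imul d z + imul C z + imul e z"
      by (simp add: add.commute flip: imul_add)
    then have "g + u + - g + imul (int (C + d + e)) z = g + u + (- g + (imul d z + imul C z)) + imul e z"
      by (simp only: add.assoc)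
    also have "- g + (imul d z + imul C z) = imul d z + imul C z + - g"
      using zg[of "int d + int C"] by (simp only: imul_add)
    also have "g + u + (imul d z + imul C z + - g) + imul e z
        = g + (u + (imul d z + (imul C z + (- g + imul e z))))"
      by (simp only: add.assoc)
    also have "\<dots> = (g + imul d z) + (u + imul C z) + (- g + imul e z)"
      using imul_z_commute[OF that(2), of d] by (metis add.assoc)
    finally show ?thesis using d e that add_Q by metis
  qed
  have "imul n (g + y + - g) + imul (int (C + d + e)) z \<in> Q
      \<and> - imul n (g + y + - g) + imul (int (C + d + e)) z \<in> Q" for n :: nat
  proof -
    have "- (g + imul n y + - g) = g + - imul n y + - g"
      by (simp add: minus_add add.assoc del: add_uminus_conv_diff)
    then show ?thesis
      using key[OF C(1)[of n]] key[OF C(2)[of n]] imul_X[OF y(1)] neg_X by (simp only: imul_conj)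
  qed
  then show ?thesis unfolding power_bounded_def by blast
qed

lemma translation_conj:
  assumes g: "g \<in> X" and x: "x \<in> X" and b: "\<exists>j. power_bounded z Q (imul N (g + x + - g) + imul j z)"
  shows "\<exists>j. power_bounded z Q (imul N x + imul j z)"
proof -
  obtain j where j: "power_bounded z Q (imul N (g + x + - g) + imul j z)" using b by blast
  have "imul N (g + x + - g) + imul j z \<in> X" using g x by (intro add_X imul_X neg_X z_X)
  then have "power_bounded z Q (- g + (imul N (g + x + - g) + imul j z) + - (- g))"
    using power_bounded_conj[OF neg_X[OF g]] j by blast
  moreover have "- g + (imul N (g + x + - g) + imul j z) + - (- g) = imul N x + imul j z"
  proof -
    have "- g + (g + imul N x + - g + imul j z) + g = imul N x + (- g + (imul j z + g))"
      by (simp only: add.assoc minus_add_cancel)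
    also have "imul j z + g = g + imul j z" using imul_z_commute[OF g] by simp
    finally show ?thesis by (simp only: imul_conj minus_minus minus_add_cancel)
  qed
  ultimately show ?thesis by auto
qed

end

text \<open>The added assumption says that all translation numbers lie in
  \<open>(1/N) \<int>\<close>: up to a multiple of \<open>z\<close>, the \<open>N\<close>-th power
  of each element has translation number 0.\<close>

locale cone = precone +
  fixes N :: int
  assumes translation: "x \<in> X \<Longrightarrow> \<exists>j. power_bounded z Q (imul N x + imul j z)"

section \<open>Amalgams over a central element\<close>

declare add_uminus_conv_diff [simp del]

text \<open>Rewrite rules that carry \<open>z\<close> and \<open>- z\<close> to the left past
  \<open>a\<close> and \<open>- a\<close>. Together with associativity and \<open>minus_add\<close>
  they reduce the identities between words below to simplification.\<close>

lemma central_left: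
  fixes a z :: "'a::group_add"
  assumes "a + z = z + a"
  shows "a + z = z + a" "a + (z + y) = z + (a + y)" "- a + z = z + - a" "- a + (z + y) = z + (- a + y)"
    "a + - z = - z + a" "a + (- z + y) = - z + (a + y)"
    "- a + - z = - z + - a" "- a + (- z + y) = - z + (- a + y)"
proof -
  show 1: "a + z = z + a" by fact
  then show 2: "a + (z + y) = z + (a + y)" by (metis add.assoc)
  have "a + (z + - a) = z + (a + - a)" using 1 by (metis add.assoc)
  then have "a + (- a + z) = a + (z + - a)" by simp
  then show 3: "- a + z = z + - a" by (simp only: add_left_cancel)
  then show 4: "- a + (z + y) = z + (- a + y)" by (metis add.assoc)
  have "z + (a + - z) = a + (z + - z)" using 1 by (metis add.assoc)
  then have "z + (a + - z) = z + (- z + a)" by simp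
  then show 5: "a + - z = - z + a" by (simp only: add_left_cancel)
  then show "a + (- z + y) = - z + (a + y)" by (metis add.assoc)
  have "- (z + a) = - (a + z)" using 1 by simp
  then show 6: "- a + - z = - z + - a" by (simp only: minus_add)
  then show "- a + (- z + y) = - z + (- a + y)" by (metis add.assoc)
qed

locale amalgam = A: cone z A QA cA N + B: cone z B QB cB N
  for z :: "'a::group_add" and A QA cA B QB cB N
begin

section \<open>The amalgamated cone and alternating words\<close>

definition X where "X = mgen (A \<union> B)"
definition c where "c = cA + (- z + cB)"
definition Q where "Q = mgen (QA \<union> QB \<union> {c})"

abbreviation IA where "IA \<equiv> A.unit_interval"
abbreviation IB where "IB \<equiv> B.unit_interval"
abbreviation "ps_ok ps \<equiv> set ps \<subseteq> IA \<times> IB"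

text \<open>The sign on the second letter is chosen so that words starting with a letter of
  \<open>A\<close> are positive and words starting with the negative of a letter of \<open>B\<close>
  are negative: the first letter decides.\<close>

definition alt :: "('a \<times> 'a) list \<Rightarrow> 'a" where
  "alt ps = sum_list (map (\<lambda>(a, b). a + - b) ps)"

lemma alt_simps [simp]: "alt [] = 0" "alt ((a, b) # ps) = a + (- b + alt ps)" "alt (ps @ qs) = alt ps + alt qs"
  by (simp_all add: alt_def add.assoc)

lemma A_X: "a \<in> A \<Longrightarrow> a \<in> X" and B_X: "b \<in> B \<Longrightarrow> b \<in> X" and zero_X: "0 \<in> X"
  and add_X: "x \<in> X \<Longrightarrow> y \<in> X \<Longrightarrow> x + y \<in> X"
  by (auto simp: X_def intro: mgen_incl mgen_zero mgen_add)

lemma neg_X: "x \<in> X \<Longrightarrow> - x \<in> X"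
  unfolding X_def by (rule mgen_neg) (auto intro: A.neg_X B.neg_X)

lemma z_X: "z \<in> X" using A_X A.z_X by blast

lemma imul_X: "x \<in> X \<Longrightarrow> imul i x \<in> X"
  using imul_hom[of X "\<lambda>x. x" x i] zero_X add_X neg_X by blast

lemma central: "x \<in> X \<Longrightarrow> x + z = z + x"
  unfolding X_def
proof (induction rule: mgen.induct)
  case (mgen_step s x)
  have "s + z = z + s" using mgen_step A.central B.central by blast
  then show ?case using mgen_step by (metis add.assoc)
qed simp

lemma QA_Q: "a \<in> QA \<Longrightarrow> a \<in> Q" and QB_Q: "b \<in> QB \<Longrightarrow> b \<in> Q" and c_Q: "c \<in> Q" and zero_Q: "0 \<in> Q"
  and add_Q: "x \<in> Q \<Longrightarrow> y \<in> Q \<Longrightarrow> x + y \<in> Q"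
  by (auto simp: Q_def intro: mgen_incl mgen_zero mgen_add)

lemma z_Q: "z \<in> Q" using QA_Q A.z_Q by blast

lemma imul_z_Q: "0 \<le> i \<Longrightarrow> imul i z \<in> Q"
  using QA_Q A.imul_Q' A.z_Q by blast

lemma IA_X: "a \<in> IA \<Longrightarrow> a \<in> X" and IB_X: "b \<in> IB \<Longrightarrow> b \<in> X" and cA_X: "cA \<in> X" and cB_X: "cB \<in> X"
  using A_X B_X A.unit_interval_X B.unit_interval_X A.c_X B.c_X by auto

lemma c_X: "c \<in> X" unfolding c_def by (intro add_X neg_X cA_X cB_X z_X)

lemma Q_X: "Q \<subseteq> X"
  unfolding Q_def using A_X B_X A.Q_X B.Q_X c_X by (intro mgen_least) (auto intro: add_X zero_X)

lemma alt_X: "ps_ok ps \<Longrightarrow> alt ps \<in> X"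
proof (induction ps)
  case (Cons p ps)
  then show ?case by (cases p) (auto intro!: add_X neg_X dest: IA_X IB_X)
qed (simp add: zero_X)

lemmas central_rules = central_left[OF central]
lemmas word_simps = add.assoc minus_add

text \<open>Since \<open>a\<close> is at least \<open>cA\<close> and \<open>- b + z\<close> at least
  \<open>cB\<close>, the middle term of \<open>a - b = (a - cA) + c + (- cB + (- b + z))\<close> has
  to be \<open>cA - z + cB\<close>. This is the origin of \<open>c\<close>.\<close>

lemma pair_Q:
  assumes a: "a \<in> IA" and b: "b \<in> IB"
  shows "a + - b \<in> Q"
proof -
  have 1: "a + - cA \<in> QA" using a A.least_right by (simp add: A.unit_interval_def)
  have 2: "- cB + (- b + z) \<in> QB" using b B.least_left by (simp add: B.unit_interval_def)
  have "a + - b = (a + - cA) + (c + (- cB + (- b + z)))"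
    using central_rules[OF neg_X[OF IB_X[OF b]]] central_rules[OF cA_X] central_rules[OF cB_X]
    by (simp add: c_def word_simps)
  then show ?thesis using 1 2 QA_Q QB_Q c_Q add_Q by metis
qed

lemma alt_Q: "ps_ok ps \<Longrightarrow> alt ps \<in> Q"
proof (induction ps)
  case (Cons p ps)
  obtain a b where p: "p = (a, b)" by (cases p)
  then have "a + - b \<in> Q" "alt ps \<in> Q" using Cons pair_Q by auto
  then have "(a + - b) + alt ps \<in> Q" by (rule add_Q)
  then show ?case using p by (simp add: add.assoc)
qed (simp add: zero_Q)

text \<open>Moving one \<open>z\<close> from the second letter to the first turns the inverse of an alternating
  pair starting in \<open>B\<close> into an alternating pair starting in \<open>A\<close>.\<close>

lemma pair_flip:
  assumes "a \<in> IA" "b \<in> IB"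
  shows "- b + a = - alt [(- a + z, - b + z)]"
  using central_rules[OF IA_X[OF assms(1)]] central_rules[OF IB_X[OF assms(2)]]
  by (simp add: word_simps)

lemma ps_ok_flip: "a \<in> IA \<Longrightarrow> b \<in> IB \<Longrightarrow> ps_ok [(- a + z, - b + z)]"
  using A.unit_interval_flip B.unit_interval_flip by auto

text \<open>The letters are regrouped with an offset of one: \<open>- b\<close> is paired with the
  first letter of \<open>A\<close>, and so on. Each new pair is the negative of an alternating pair,
  and one letter of \<open>B\<close> remains unpaired at the right end.\<close>

lemma swap_form:
  assumes "b \<in> IB" "ps_ok ps"
  shows "\<exists>ps' b'. ps_ok ps' \<and> b' \<in> IB \<and> - b + alt ps = - alt ps' + - b'"
  using assms
proof (induction ps arbitrary: b)
  case Nil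
  then show ?case by (intro exI[of _ "[]"] exI[of _ b]) simp
next
  case (Cons p ps)
  obtain a b1 where p: "p = (a, b1)" by (cases p)
  with Cons have ab: "a \<in> IA" "b1 \<in> IB" "b \<in> IB" by auto
  obtain ps' b' where *: "ps_ok ps'" "b' \<in> IB" "- b1 + alt ps = - alt ps' + - b'"
    using Cons ab by (metis insert_subset list.simps(15))
  have "- b + alt (p # ps) = (- b + a) + (- b1 + alt ps)"
    by (simp add: p add.assoc)
  also have "\<dots> = - alt (ps' @ [(- a + z, - b + z)]) + - b'"
    using * pair_flip[OF ab(1,3)] by (simp only: alt_simps(3) minus_add add.assoc)
  finally show ?case using * ps_ok_flip[OF ab(1,3)]
    by (intro exI[of _ "ps' @ [(- a + z, - b + z)]"] exI[of _ b']) auto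
qed

lemma neg_form:
  assumes b: "b \<in> IB" and ps: "ps_ok ps" and a: "a \<in> insert 0 IA"
  shows "- (- b + alt ps + a) \<in> Q"
proof -
  obtain ps' b' where *: "ps_ok ps'" "b' \<in> IB" "- b + alt ps = - alt ps' + - b'"
    using swap_form b ps by blast
  have "- (- b' + a) \<in> Q"
  proof (cases "a = 0")
    case True
    then show ?thesis using * QB_Q by (simp add: B.unit_interval_def)
  next
    case False
    then have "a \<in> IA" using a by simp
    then show ?thesis using pair_flip alt_Q ps_ok_flip *(2) by (metis minus_minus)
  qed
  moreover have "- (- b + alt ps + a) = - (- b' + a) + alt ps'"
    by (simp add: *(3) word_simps)
  ultimately show ?thesis using alt_Q[OF *(1)] add_Q by metis
qed

text \<open>Induction on the number of factors. A new letter of \<open>B\<close> is merged into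
  \<open>b\<close>. A new letter of \<open>A\<close> is merged with the first letter if that one
  lies in \<open>A\<close>, and otherwise becomes the first letter. The floor decomposition sends
  the carry into the multiple of \<open>z\<close>; if nothing remains of a leading letter of
  \<open>A\<close>, the next letter takes the place of \<open>b\<close>.\<close>

lemma normal_form:
  assumes "x \<in> X"
  obtains i b ps a where "b \<in> insert 0 IB" "ps_ok ps" "a \<in> insert 0 IA"
    "x = imul i z + (- b + (alt ps + a))"
proof -
  have zA: "a + imul i z = imul i z + a" if "a \<in> X" for a i
    using imul_commute[of z a i] central[OF that] by simp
  have "\<exists>i b ps a. b \<in> insert 0 IB \<and> ps_ok ps \<and> a \<in> insert 0 IA \<and>
    x = imul i z + (- b + (alt ps + a))"
    using assms unfolding X_def
  proof (induction rule: mgen.induct)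
    case mgen_zero
    show ?case by (intro exI[of _ 0] exI[of _ "[]"]) simp
  next
    case (mgen_step s x)
    then obtain i b ps a where x: "b \<in> insert 0 IB" "ps_ok ps" "a \<in> insert 0 IA"
      "x = imul i z + (- b + (alt ps + a))" by blast
    from mgen_step(1) show ?case
    proof
      assume s: "s \<in> B"
      have bB: "b \<in> B" using x(1) B.unit_interval_X B.zero_X by blast
      obtain j b' where b': "- (s + - b) = imul j z + b'" "b' \<in> insert 0 IB"
        using B.floor_decomposition[OF B.neg_X[OF B.add_X[OF s B.neg_X[OF bB]]]] by blast
      have "b' \<in> B" using b'(2) B.unit_interval_X B.zero_X by blast
      then have b'X: "- b' \<in> X" using B_X neg_X by blast
      have "s + - b = - (imul j z + b')" using b'(1) by (metis minus_minus)
      also have "\<dots> = imul (- j) z + - b'" using zA[OF b'X, of "- j"] by (simp add: minus_add imul_minus)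
      finally have sb: "s + - b = imul (- j) z + - b'" .
      have "s + x = imul i z + ((s + - b) + (alt ps + a))"
        using zA[OF B_X[OF s], of i] x(4) by (metis add.assoc)
      also have "\<dots> = imul (i + - j) z + (- b' + (alt ps + a))"
        using sb imul_add[of i "- j" z] by (simp add: add.assoc)
      finally show ?case using x(2,3) b'(2) by blast
    next
      assume s: "s \<in> A"
      show ?case
      proof (cases "b = 0 \<and> ps \<noteq> []")
        case True
        then obtain a1 b1 ps' where ps: "ps = (a1, b1) # ps'" by (cases ps) auto
        with x(2) have ab: "a1 \<in> IA" "b1 \<in> IB" "ps_ok ps'" by auto
        obtain j a' where a': "s + a1 = imul j z + a'" "a' \<in> insert 0 IA"
          using A.floor_decomposition[OF A.add_X[OF s A.unit_interval_X[OF ab(1)]]] by blast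
        have "s + x = imul i z + ((s + a1) + (- b1 + (alt ps' + a)))"
          using zA[OF A_X[OF s], of i] x(4) True ps by (simp add: flip: add.assoc)
        also have "\<dots> = imul (i + j) z + (a' + (- b1 + (alt ps' + a)))"
          using a'(1) by (simp add: imul_add add.assoc)
        finally have *: "s + x = imul (i + j) z + (a' + (- b1 + (alt ps' + a)))" .
        show ?thesis
        proof (cases "a' = 0")
          case True
          then show ?thesis using * ab x(3) by auto
        next
          case False
          then have "ps_ok ((a', b1) # ps')" using ab a'(2) by auto
          moreover have "s + x = imul (i + j) z + (- 0 + (alt ((a', b1) # ps') + a))"
            using * by (simp add: add.assoc)
          ultimately show ?thesis using x(3) by blast
        qed
      next
        case False
        show ?thesis
        proof (cases "b = 0")
          case True
          with False have ps: "ps = []" by simp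
          have aA: "a \<in> A" using x(3) A.unit_interval_X A.zero_X by blast
          obtain j a' where a': "s + a = imul j z + a'" "a' \<in> insert 0 IA"
            using A.floor_decomposition[OF A.add_X[OF s aA]] by blast
          have "s + x = imul i z + (s + a)"
            using zA[OF A_X[OF s], of i] x(4) True ps by (simp add: flip: add.assoc)
          then have "s + x = imul (i + j) z + (- 0 + (alt [] + a'))"
            using a'(1) by (simp add: imul_add add.assoc)
          moreover have "ps_ok []" by simp
          ultimately show ?thesis using a'(2) by blast
        next
          case False
          then have b: "b \<in> IB" using x(1) by simp
          obtain j a' where a': "s = imul j z + a'" "a' \<in> insert 0 IA"
            using A.floor_decomposition[OF s] by blast
          have "a' \<in> A" using a'(2) A.unit_interval_X A.zero_X by blast
          then have "s + x = imul j z + (imul i z + a' + (- b + (alt ps + a)))"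
            using zA[OF A_X, of a' i] x(4) a'(1) by (metis add.assoc)
          then have *: "s + x = imul (j + i) z + (a' + (- b + (alt ps + a)))"
            by (simp only: imul_add add.assoc)
          show ?thesis
          proof (cases "a' = 0")
            case True
            then show ?thesis using * x by auto
          next
            case False
            then have "ps_ok ((a', b) # ps)" using x(2) b a'(2) by auto
            moreover have "s + x = imul (j + i) z + (- 0 + (alt ((a', b) # ps) + a))"
              using * by (simp add: add.assoc)
            ultimately show ?thesis using x(3) by blast
          qed
        qed
      qed
    qed
  qed
  then show thesis using that by blast
qed

text \<open>A word with \<open>b = 0\<close> lies between \<open>0\<close> and \<open>z\<close>, a
  word starting with \<open>- b\<close> between \<open>- z\<close> and \<open>0\<close>. Hence the
  sign changes between \<open>i = - 1\<close> and \<open>i = 0\<close> in the first case, and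
  between \<open>i = 0\<close> and \<open>i = 1\<close> in the second.\<close>

lemma total:
  assumes "x \<in> X"
  shows "x \<in> Q \<or> - x \<in> Q"
proof -
  obtain i b ps a where x: "b \<in> insert 0 IB" "ps_ok ps" "a \<in> insert 0 IA"
    "x = imul i z + (- b + (alt ps + a))"
    using normal_form[OF assms] .
  have aQ: "a \<in> Q" using x(3) zero_Q QA_Q by (auto simp: A.unit_interval_def)
  have aps: "alt ps + a \<in> Q" using alt_Q[OF x(2)] aQ add_Q by blast
  consider "b = 0" "i \<ge> 0" | "b = 0" "i < 0" | "b \<in> IB" "i > 0" | "b \<in> IB" "i \<le> 0"
    using x(1) by force
  then show ?thesis
  proof cases
    case 1
    then show ?thesis using x(4) aps imul_z_Q add_Q by simp
  next
    case 2
    have "- (alt ps + a) + z \<in> Q"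
    proof (cases ps)
      case Nil
      then show ?thesis using x(3) QA_Q z_Q by (auto simp: A.unit_interval_def)
    next
      case (Cons p qs)
      obtain a1 b1 where p: "p = (a1, b1)" by (cases p)
      then have ab: "a1 \<in> IA" "b1 \<in> IB" "ps_ok qs" using Cons x(2) by auto
      have "- (alt ps + a) + z = - (- b1 + alt qs + a) + (- a1 + z)"
        by (simp add: Cons p word_simps)
      then show ?thesis using neg_form[OF ab(2,3) x(3)] ab(1) QA_Q add_Q by (simp add: A.unit_interval_def)
    qed
    moreover have "- x = - (alt ps + a) + z + imul (- i - 1) z"
    proof -
      have "- x = - (alt ps + a) + imul (- i) z"
        using x(4) 2 by (simp only: minus_add minus_zero add_0 imul_minus)
      then show ?thesis using imul_add[of 1 "- i - 1" z] by (simp add: add.assoc)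
    qed
    moreover have "imul (- i - 1) z \<in> Q" using 2 by (intro imul_z_Q) simp
    ultimately show ?thesis using add_Q by metis
  next
    case 3
    have "x = imul (i - 1) z + ((- b + z) + (alt ps + a))"
      using x(4) imul_add[of "i - 1" 1 z] central_rules[OF IB_X[OF 3(1)]] by (simp add: add.assoc)
    moreover have "- b + z \<in> Q" using 3 QB_Q by (simp add: B.unit_interval_def)
    ultimately show ?thesis using 3 aps imul_z_Q[of "i - 1"] add_Q by simp
  next
    case 4
    have "- x = - (- b + alt ps + a) + imul (- i) z"
      using x(4) by (simp add: minus_add imul_minus add.assoc)
    then show ?thesis using neg_form[OF 4(1) x(2,3)] imul_z_Q[of "- i"] 4 add_Q by simp
  qed
qed

text \<open>This element is the negative of \<open>- cA + c + cA\<close>: although \<open>c\<close>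
  is positive, one of its conjugates is negative.\<close>

lemma c_conj_Q: "- cA + (- cB + z) \<in> Q"
proof -
  have "- cA + (- cB + z) = (- cA + (- cA + z)) + (c + (- cB + (- cB + z)))"
    using central_rules[OF cA_X] central_rules[OF cB_X]
    by (simp add: c_def word_simps)
  then show ?thesis using A.two_c B.two_c QA_Q QB_Q c_Q add_Q by metis
qed

text \<open>Conjugation by \<open>cA\<close> turns the multiples of \<open>- c\<close> into
  multiples of the positive element from \<open>c_conj_Q\<close>, so \<open>- j c + z\<close> is the
  sum of \<open>cA\<close>, \<open>j\<close> copies of that element, and \<open>- cA + z\<close>. In
  particular \<open>c\<close> has translation number 0.\<close>

lemma imul_c_below_z: "- imul (int j) c + z \<in> Q"
proof -
  have step: "- c + cA = cA + (- cA + (- cB + z))"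
    using central_rules[OF cA_X] central_rules[OF cB_X]
    by (simp add: c_def word_simps)
  have "- imul (int j) c = cA + (imul (int j) (- cA + (- cB + z)) + - cA)"
  proof (induction j)
    case (Suc j)
    have "- imul (int (Suc j)) c = - c + - imul (int j) c"
      using imul_succ'[of "int j" c] by (simp add: minus_add add.commute)
    also have "\<dots> = (- c + cA) + (imul (int j) (- cA + (- cB + z)) + - cA)"
      using Suc by (simp only: add.assoc)
    also have "\<dots> = cA + ((- cA + (- cB + z)) + imul (int j) (- cA + (- cB + z)) + - cA)"
      by (simp only: step add.assoc)
    finally show ?case
      using imul_succ[of "int j" "- cA + (- cB + z)"] by (simp add: add.commute[of 1])
  qed simp
  then have "- imul (int j) c + z = cA + (imul (int j) (- cA + (- cB + z)) + (- cA + z))"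
    by (simp only: add.assoc)
  moreover have "imul (int j) (- cA + (- cB + z)) \<in> Q"
    using mgen_imul c_conj_Q by (simp add: Q_def)
  ultimately show ?thesis using QA_Q[OF A.c_Q] QA_Q[OF A.z_minus_c] add_Q by metis
qed

text \<open>On one side the least element of the other factor can be split off directly. On the
  other side a copy of \<open>c\<close> is inserted and compensated by \<open>- cB - cB + z\<close>
  or \<open>- cA - cA + z\<close>; this is a use of \<open>two_c\<close>.\<close>

lemma gen_least:
  assumes "s \<in> QA \<union> QB \<union> {c}" "s \<noteq> 0"
  shows "- c + s \<in> Q \<and> s + - c \<in> Q"
proof -
  consider "s \<in> QA" | "s \<in> QB" | "s = c" using assms by blast
  then show ?thesis
  proof cases
    case 1
    have sX: "s \<in> X" using 1 A.Q_X A_X by blast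
    note rules = central_rules[OF cA_X] central_rules[OF cB_X] central_rules[OF sX]
    have "- c + s = (- cB + z) + (- cA + s)"
      using rules by (simp add: c_def word_simps)
    moreover have "s + - c = (s + - cA) + (c + ((- cB + (- cB + z)) + (- cA + z)))"
      using rules by (simp add: c_def word_simps)
    moreover have "- cB + z \<in> Q" "- cA + s \<in> Q" "s + - cA \<in> Q" "- cB + (- cB + z) \<in> Q" "- cA + z \<in> Q"
      using 1 assms(2) A.least_left A.least_right A.z_minus_c B.z_minus_c B.two_c QA_Q QB_Q by auto
    ultimately show ?thesis using add_Q c_Q by metis
  next
    case 2
    have sX: "s \<in> X" using 2 B.Q_X B_X by blast
    note rules = central_rules[OF cA_X] central_rules[OF cB_X] central_rules[OF sX]
    have "s + - c = (s + - cB) + (- cA + z)"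
      using rules by (simp add: c_def word_simps)
    moreover have "- c + s = (- cB + z) + ((- cA + (- cA + z)) + (c + (- cB + s)))"
      using rules by (simp add: c_def word_simps)
    moreover have "- cB + z \<in> Q" "- cB + s \<in> Q" "s + - cB \<in> Q" "- cA + (- cA + z) \<in> Q" "- cA + z \<in> Q"
      using 2 assms(2) B.least_left B.least_right A.z_minus_c B.z_minus_c A.two_c QA_Q QB_Q by auto
    ultimately show ?thesis using add_Q c_Q by metis
  next
    case 3
    then show ?thesis using zero_Q by simp
  qed
qed

text \<open>Minimality passes from the generators to sums because the left version concerns only the
  first summand and the right version only the last.\<close>

lemma least:
  assumes "q \<in> Q"
  shows "q \<noteq> 0 \<longrightarrow> - c + q \<in> Q \<and> q + - c \<in> Q"
  using assms unfolding Q_def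
proof (induction rule: mgen.induct)
  case (mgen_step s q)
  have qQ: "q \<in> Q" using mgen_step by (simp add: Q_def)
  have sQ: "s \<in> Q" using mgen_incl[OF mgen_step(1)] by (simp add: Q_def)
  show ?case
  proof (cases "s = 0 \<or> q = 0")
    case True
    then show ?thesis using mgen_step.IH mgen_step.hyps(1) gen_least[of s] by (auto simp: Q_def)
  next
    case False
    then have "- c + s \<in> Q" "q + - c \<in> Q" using gen_least mgen_step by (auto simp: Q_def)
    then have "(- c + s) + q \<in> Q" "s + (q + - c) \<in> Q" using qQ sQ add_Q by auto
    then show ?thesis by (simp add: add.assoc Q_def)
  qed
qed simp

section \<open>Conjugacy and translation numbers in the amalgam\<close>

text \<open>Cyclic reduction, by induction on the number of pairs. If both outer letters are
  present, rotating \<open>a\<close> to the front gives a purely alternating word. If only one is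
  present, a conjugation makes it meet a letter of its own factor at the other end, and one pair
  disappears.\<close>

lemma conjugate_form:
  assumes "x \<in> X"
  shows "\<exists>g\<in>X. g + x + - g \<in> A \<union> B \<or> (\<exists>i ps. ps_ok ps \<and> g + x + - g = imul i z + alt ps)"
proof -
  have zc: "y + imul j z = imul j z + y" if "y \<in> X" for j y
    using imul_commute[of z y j] central[OF that] by simp
  define T where "T x \<longleftrightarrow> (\<exists>g\<in>X. g + x + - g \<in> A \<union> B \<or> (\<exists>i ps. ps_ok ps \<and> g + x + - g = imul i z + alt ps))" for x
  have TI: "T x" if g: "g \<in> X" and Tg: "T (g + x + - g)" for g x
  proof -
    obtain h where h: "h \<in> X" "h + (g + x + - g) + - h \<in> A \<union> B \<or> (\<exists>i ps. ps_ok ps \<and> h + (g + x + - g) + - h = imul i z + alt ps)"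
      using Tg by (auto simp: T_def)
    moreover have "h + (g + x + - g) + - h = (h + g) + x + - (h + g)" by (simp only: word_simps)
    ultimately show ?thesis using g add_X unfolding T_def by metis
  qed
  have T0: "T x" if "x \<in> A \<union> B \<or> (\<exists>i ps. ps_ok ps \<and> x = imul i z + alt ps)" for x
    unfolding T_def using that zero_X by (intro bexI[of _ 0]) auto
  have main: "T (imul i z + (- b + (alt ps + a)))"
    if "b \<in> insert 0 IB" "ps_ok ps" "a \<in> insert 0 IA" for i b ps a
    using that
  proof (induction "length ps" arbitrary: i b ps a rule: less_induct)
    case less
    let ?x = "imul i z + (- b + (alt ps + a))"
    have bB: "b \<in> B" and aA: "a \<in> A"
      using less.prems A.unit_interval_X B.unit_interval_X A.zero_X B.zero_X by auto
    have conj: "g + ?x + - g = imul i z + (g + (- b + (alt ps + (a + - g))))" if "g \<in> X" for g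
      using zc[OF that, of i] by (simp add: add.assoc)
        (metis add.assoc)
    consider "b = 0" "a = 0" | "b \<in> IB" "a \<in> IA" | "b \<in> IB" "a = 0" | "b = 0" "a \<in> IA"
      using less.prems by blast
    then show ?case
    proof cases
      case 1
      then show ?thesis using less.prems by (intro T0) auto
    next
      case 2
      have "a + ?x + - a = imul i z + alt ((a, b) # ps)"
        using conj[OF IA_X[OF 2(2)]] by (simp add: add.assoc)
      moreover have "ps_ok ((a, b) # ps)" using 2 less.prems by auto
      ultimately have "T (a + ?x + - a)" by (intro T0) blast
      then show ?thesis using TI IA_X 2 by blast
    next
      case 3
      show ?thesis
      proof (cases ps rule: rev_cases)
        case Nil
        then have "?x = imul i z + - b" using 3 by simp
        then have "?x \<in> B" using bB by (metis B.add_X B.imul_X B.neg_X B.z_X)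
        then show ?thesis using T0 by blast
      next
        case (snoc ps' p)
        obtain a1 b1 where p: "p = (a1, b1)" by (cases p)
        then have ab: "a1 \<in> IA" "b1 \<in> IB" "ps_ok ps'" using snoc less.prems by auto
        have b1: "b1 \<in> B" "b1 \<in> X" using ab B.unit_interval_X B_X by auto
        obtain j b' where b': "b + b1 = imul j z + b'" "b' \<in> insert 0 IB"
          using B.floor_decomposition[OF B.add_X[OF bB b1(1)]] by blast
        have b'X: "- b' \<in> X" using b'(2) IB_X zero_X neg_X by blast
        have "- b1 + - b = - (imul j z + b')" using b'(1) by (metis minus_add)
        also have "\<dots> = imul (- j) z + - b'" using zc[OF b'X, of "- j"] by (simp only: minus_add imul_minus)
        finally have bb: "- b1 + - b = imul (- j) z + - b'" .
        have "- b1 + ?x + - (- b1) = imul i z + ((- b1 + - b) + (alt ps' + a1))"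
          using conj[OF neg_X[OF b1(2)]] 3 snoc p by (simp add: add.assoc)
        also have "\<dots> = imul (i + - j) z + (- b' + (alt ps' + a1))"
          by (simp only: bb imul_add add.assoc)
        finally have "T (- b1 + ?x + - (- b1))"
          using less.hyps[of ps' b' a1 "i + - j"] snoc ab b'(2) by simp
        then show ?thesis using TI neg_X b1 by blast
      qed
    next
      case 4
      show ?thesis
      proof (cases ps)
        case Nil
        then have "?x = imul i z + a" using 4 by simp
        then have "?x \<in> A" using aA by (metis A.add_X A.imul_X A.z_X)
        then show ?thesis using T0 by blast
      next
        case (Cons p ps')
        obtain a1 b1 where p: "p = (a1, b1)" by (cases p)
        then have ab: "a1 \<in> IA" "b1 \<in> IB" "ps_ok ps'" using Cons less.prems by auto
        have a1: "a1 \<in> A" "a1 \<in> X" using ab A.unit_interval_X A_X by auto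
        obtain j a' where a': "a + a1 = imul j z + a'" "a' \<in> insert 0 IA"
          using A.floor_decomposition[OF A.add_X[OF aA a1(1)]] by blast
        have apsX: "- b1 + alt ps' \<in> X" using ab IB_X alt_X by (intro add_X neg_X) auto
        have "- a1 + ?x + - (- a1) = imul i z + ((- b1 + alt ps') + (a + a1))"
          using conj[OF neg_X[OF a1(2)]] 4 Cons p by (simp add: add.assoc)
        also have "\<dots> = imul i z + ((- b1 + alt ps') + imul j z + a')"
          by (simp only: a'(1) add.assoc)
        also have "\<dots> = imul (i + j) z + (- b1 + (alt ps' + a'))"
          by (simp only: zc[OF apsX] imul_add) (simp only: add.assoc)
        finally have "T (- a1 + ?x + - (- a1))"
          using less.hyps[of ps' b1 a' "i + j"] Cons ab a'(2) by simp
        then show ?thesis using TI neg_X a1 by blast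
      qed
    qed
  qed
  obtain i b ps a where "b \<in> insert 0 IB" "ps_ok ps" "a \<in> insert 0 IA"
    "x = imul i z + (- b + (alt ps + a))"
    using normal_form[OF assms] .
  then have "T x" using main by blast
  then show ?thesis by (simp add: T_def)
qed

lemma alt_below_z:
  assumes "ps_ok ps"
  shows "- alt ps + z \<in> Q"
proof (cases ps)
  case Nil
  then show ?thesis using z_Q by simp
next
  case (Cons p qs)
  obtain a1 b1 where p: "p = (a1, b1)" by (cases p)
  then have ab: "a1 \<in> IA" "b1 \<in> IB" "ps_ok qs" using Cons assms by auto
  have "- alt ps + z = - (- b1 + alt qs + 0) + (- a1 + z)"
    by (simp add: Cons p word_simps)
  then show ?thesis using neg_form[OF ab(2,3), of 0] ab(1) QA_Q add_Q by (simp add: A.unit_interval_def)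
qed

lemma alt_imul: "ps_ok ps \<Longrightarrow> \<exists>qs. ps_ok qs \<and> imul (int n) (alt ps) = alt qs"
proof (induction n)
  case 0
  show ?case by (intro exI[of _ "[]"]) simp
next
  case (Suc n)
  then obtain qs where "ps_ok qs" "imul (int n) (alt ps) = alt qs" by blast
  then show ?case using Suc.prems imul_succ[of "int n" "alt ps"]
    by (intro exI[of _ "ps @ qs"]) (auto simp: add.commute[of 1])
qed

text \<open>Alternating words are closed under addition and all lie between \<open>0\<close> and
  \<open>z\<close>, so the single bound \<open>1\<close> serves every power.\<close>

lemma alt_power_bounded:
  assumes "ps_ok ps"
  shows "power_bounded z Q (alt ps)"
  unfolding power_bounded_def
proof (intro exI[of _ 1] allI)
  fix n :: nat
  obtain qs where "ps_ok qs" "imul (int n) (alt ps) = alt qs" using alt_imul[OF assms] by blast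
  then show "imul n (alt ps) + imul (int 1) z \<in> Q \<and> - imul n (alt ps) + imul (int 1) z \<in> Q"
    using alt_Q alt_below_z z_Q add_Q by simp
qed

lemma power_bounded_mono: "Q1 \<subseteq> Q2 \<Longrightarrow> power_bounded z Q1 y \<Longrightarrow> power_bounded z Q2 y"
  unfolding power_bounded_def by blast

lemma cofinal: "x \<in> X \<Longrightarrow> \<exists>i::nat. x + imul i z \<in> Q"
  unfolding X_def
proof (induction rule: mgen.induct)
  case mgen_zero
  show ?case using zero_Q by (intro exI[of _ 0]) simp
next
  case (mgen_step s x)
  obtain i j :: nat where i: "s + imul i z \<in> Q" and j: "x + imul j z \<in> Q"
    using mgen_step A.cofinal[of s] B.cofinal[of s] QA_Q QB_Q by blast
  have x: "x \<in> X" using mgen_step by (simp add: X_def)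
  have "(s + imul i z) + (x + imul j z) = s + x + imul (int (i + j)) z"
    using imul_commute[of z x i] central[OF x] by (simp add: imul_add) (metis add.assoc)
  then show ?case using i j add_Q by metis
qed

theorem cone: "cone z X Q c N"
proof -
  have base: "\<exists>j. power_bounded z Q (imul N x + imul j z)"
    if "x \<in> A \<union> B \<or> (\<exists>i ps. ps_ok ps \<and> x = imul i z + alt ps)" for x
  proof -
    have "QA \<subseteq> Q" "QB \<subseteq> Q" using QA_Q QB_Q by auto
    then have AB: "x \<in> A \<union> B \<Longrightarrow> ?thesis"
      using A.translation B.translation power_bounded_mono by blast
    have "?thesis" if ips: "ps_ok ps" "x = imul i z + alt ps" for i ps
    proof -
      have y: "alt ps + z = z + alt ps" using alt_X central ips by blast
      have com: "imul i z + alt ps = alt ps + imul i z" using imul_commute[OF y[symmetric]] .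
      have "imul N x = imul (N * i) z + imul N (alt ps)"
        using imul_plus[OF com] ips by (simp add: imul_mult)
      moreover have "imul (N * i) z + imul N (alt ps) = imul N (alt ps) + imul (N * i) z"
        using imul_commute2[OF y[symmetric]] .
      ultimately have "imul N x + imul (- (N * i)) z = imul N (alt ps)"
        by (simp add: imul_minus add.assoc)
      moreover have "power_bounded z Q (imul N (alt ps))"
      proof -
        have "\<exists>qs. ps_ok qs \<and> (imul N (alt ps) = alt qs \<or> imul N (alt ps) = - alt qs)"
          using alt_imul[OF ips(1), of "nat N"] alt_imul[OF ips(1), of "nat (- N)"]
          by (cases "N \<ge> 0") (auto simp: imul_minus, metis minus_minus)
        then obtain qs where qs: "ps_ok qs" "imul N (alt ps) = alt qs \<or> imul N (alt ps) = - alt qs"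
          by blast
        have n: "imul n (- y) = - imul n y" for n and y :: 'a
          using imul_mult[of n "- 1" y] imul_minus[of 1 y] imul_minus[of n y] by simp
        have "power_bounded z Q (- y)" if "power_bounded z Q y" for y
          using that unfolding power_bounded_def n minus_minus by blast
        then show ?thesis using qs(2) alt_power_bounded[OF qs(1)] by auto
      qed
      ultimately show ?thesis by metis
    qed
    then show ?thesis using that AB by blast
  qed
  have fg: "\<exists>S. finite S \<and> Q = mgen S"
  proof -
    obtain SA SB where S: "finite SA" "QA = mgen SA" "finite SB" "QB = mgen SB"
      using A.fin_gen B.fin_gen by blast
    have "Q = mgen (SA \<union> SB \<union> {c})"
    proof
      have "mgen SA \<subseteq> mgen (SA \<union> SB \<union> {c})" "mgen SB \<subseteq> mgen (SA \<union> SB \<union> {c})"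
        by (intro mgen_mono; blast)+
      then show "Q \<subseteq> mgen (SA \<union> SB \<union> {c})"
        unfolding Q_def using S by (intro mgen_least) (auto intro: mgen_zero mgen_add mgen_incl)
      show "mgen (SA \<union> SB \<union> {c}) \<subseteq> Q"
        unfolding Q_def using S by (intro mgen_mono) (auto intro: mgen_incl)
    qed
    then show ?thesis using S(1,3) by (intro exI[of _ "SA \<union> SB \<union> {c}"]) simp
  qed
  have two: "- c + (- c + z) \<in> Q"
    using imul_c_below_z[of 2] imul_add[of 1 1 c] by (simp add: minus_add add.assoc)
  interpret pre: precone z X Q c
    by unfold_locales
      (assumption | rule zero_X add_X neg_X central fg Q_X z_Q c_Q total two cofinal | simp add: least)+
  show ?thesis
  proof
    fix x assume x: "x \<in> X"
    obtain g where g: "g \<in> X" "g + x + - g \<in> A \<union> B \<or> (\<exists>i ps. ps_ok ps \<and> g + x + - g = imul i z + alt ps)"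
      using conjugate_form[OF x] by blast
    show "\<exists>j. power_bounded z Q (imul N x + imul j z)"
      using pre.translation_conj[OF g(1) x base[OF g(2)]] .
  qed
qed

section \<open>The center of the amalgam\<close>

context
  assumes antisym: "\<And>q. q \<in> Q \<Longrightarrow> - q \<in> Q \<Longrightarrow> q = 0" and c_nonzero: "c \<noteq> 0"
begin

text \<open>If \<open>cB\<close> were \<open>0\<close>, then \<open>- c\<close> would be positive;
  if it were \<open>z\<close>, then \<open>two_c\<close> would make \<open>- cB\<close> positive.
  With its counterpart for \<open>cA\<close> this provides a letter in each factor to test
  commutation against.\<close>

lemma cB_IB: "cB \<in> IB"
proof -
  have "cB \<noteq> 0"
  proof
    assume "cB = 0"
    then have "- c = - cA + z" using central_rules[OF cA_X] unfolding c_def by (simp add: minus_add)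
    then show False using antisym[OF c_Q] QA_Q[OF A.z_minus_c] c_nonzero by simp
  qed
  moreover have "- cB + z \<noteq> 0"
  proof
    assume "- cB + z = 0"
    then have "- cB \<in> Q" using QB_Q[OF B.two_c] by simp
    then show False using antisym QB_Q[OF B.c_Q] \<open>cB \<noteq> 0\<close> by blast
  qed
  ultimately show ?thesis using B.c_Q B.z_minus_c by (simp add: B.unit_interval_def)
qed

lemma cA_IA: "cA \<in> IA"
proof -
  have "cA \<noteq> 0"
  proof
    assume "cA = 0"
    then have "- c = - cB + z" unfolding c_def by (simp add: minus_add)
    then show False using antisym[OF c_Q] QB_Q[OF B.z_minus_c] c_nonzero by simp
  qed
  moreover have "- cA + z \<noteq> 0"
  proof
    assume "- cA + z = 0"
    then have "- cA \<in> Q" using QA_Q[OF A.two_c] by simp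
    then show False using antisym QA_Q[OF A.c_Q] \<open>cA \<noteq> 0\<close> by blast
  qed
  ultimately show ?thesis using A.c_Q A.z_minus_c by (simp add: A.unit_interval_def)
qed

text \<open>\<open>a - b\<close> is positive and \<open>- b + a\<close> negative, so equality would
  make both \<open>0\<close>. The factorisation of \<open>a - b\<close> through \<open>c\<close>
  then exhibits \<open>- c\<close> as a sum of positive elements.\<close>

lemma pair_not_commute:
  assumes a: "a \<in> IA" and b: "b \<in> IB"
  shows "a + - b \<noteq> - b + a"
proof
  assume eq: "a + - b = - b + a"
  have "- (- b + alt [] + a) \<in> Q" using neg_form[OF b, of "[]" a] a by simp
  then have "a + - b = 0" using antisym[OF pair_Q[OF a b]] eq by simp
  moreover have "a + - b = (a + - cA) + (c + (- cB + (- b + z)))"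
    using central_rules[OF neg_X[OF IB_X[OF b]]] central_rules[OF cA_X] central_rules[OF cB_X]
    by (simp add: c_def word_simps)
  ultimately have "- (a + - cA) = c + (- cB + (- b + z))" by (intro minus_unique) simp
  then have "c + (- cB + (- b + z)) + (a + - cA) = 0" by (metis left_minus)
  then have "c + ((- cB + (- b + z)) + (a + - cA)) = 0" by (simp only: add.assoc)
  then have "- c = (- cB + (- b + z)) + (a + - cA)" by (rule minus_unique)
  moreover have "a + - cA \<in> Q" using a A.least_right QA_Q by (simp add: A.unit_interval_def)
  moreover have "- cB + (- b + z) \<in> Q" using b B.least_left QB_Q by (simp add: B.unit_interval_def)
  ultimately show False using antisym[OF c_Q] c_nonzero add_Q by metis
qed

text \<open>A central element equals all its conjugates, so it is already cyclically
  reduced.\<close>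

theorem center_multiple:
  assumes x: "x \<in> X" and com: "\<And>y. y \<in> X \<Longrightarrow> x + y = y + x"
  shows "\<exists>i. x = imul i z"
proof -
  have zc: "imul i z + y = y + imul i z" if "y \<in> X" for i y
    using imul_commute[of z y i] central[OF that] by simp
  have sub: "u + y = y + u" if "x = imul i z + u" "y \<in> X" for u i y
  proof -
    have "imul i z + (u + y) = imul i z + (y + u)"
      using com[OF that(2)] zc[OF that(2), of i] that(1) by (metis add.assoc)
    then show ?thesis by (simp only: add_left_cancel)
  qed
  obtain g where g: "g \<in> X" "g + x + - g \<in> A \<union> B \<or> (\<exists>i ps. ps_ok ps \<and> g + x + - g = imul i z + alt ps)"
    using conjugate_form[OF x] by blast
  have "g + x + - g = x" using com[OF g(1)] by (metis add.assoc add_0_right right_minus)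
  then consider "x \<in> A" | "x \<in> B" | i ps where "ps_ok ps" "x = imul i z + alt ps" using g(2) by auto
  then show ?thesis
  proof cases
    case 1
    obtain i a where a: "x = imul i z + a" "a \<in> insert 0 IA" using A.floor_decomposition[OF 1] .
    have "a + - cB = - cB + a" using sub[OF a(1) neg_X[OF cB_X]] .
    then have "a \<notin> IA" using pair_not_commute[OF _ cB_IB] by blast
    then show ?thesis using a by auto
  next
    case 2
    obtain i b where b: "x = imul i z + b" "b \<in> insert 0 IB" using B.floor_decomposition[OF 2] .
    have "b + cA = cA + b" using sub[OF b(1) cA_X] .
    then have "cA + - b = - b + cA" using central_left(3)[of b cA] by simp
    then have "b \<notin> IB" using pair_not_commute[OF cA_IA] by blast
    then show ?thesis using b by auto
  next
    case 3
    show ?thesis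
    proof (cases ps rule: rev_cases)
      case Nil
      then show ?thesis using 3 by auto
    next
      case (snoc ps' p)
      obtain a b where p: "p = (a, b)" by (cases p)
      then have ab: "a \<in> IA" "b \<in> IB" "ps_ok ps'" using snoc 3 by auto
      \<comment> \<open>Commuting with the last letter rotates the word into one that starts with
        \<open>- b\<close>, hence into a negative one.\<close>
      have "alt ps + - b = - b + alt ps" using sub[OF 3(2) neg_X[OF IB_X[OF ab(2)]]] .
      then have "alt ps + - b = (- b + alt ps' + a) + - b" using snoc p by (simp add: add.assoc)
      then have "alt ps = - b + alt ps' + a" by (simp only: add_right_cancel)
      then have "- alt ps \<in> Q" using neg_form[OF ab(2,3)] ab(1) by simp
      then have "alt ps = 0" using antisym alt_Q 3 by blast
      then show ?thesis using 3 by auto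
    qed
  qed
qed

end

end

section \<open>Cyclic quotients\<close>

lemma mgen_single: "mgen {e} = {imul (int n) e | n. True}"
proof (intro equalityI subsetI)
  fix x assume "x \<in> mgen {e}"
  then show "x \<in> {imul (int n) e | n. True}"
  proof (induction rule: mgen.induct)
    case mgen_zero
    show ?case by (intro CollectI exI[of _ 0]) simp
  next
    case (mgen_step s x)
    then obtain n where "s = e" "x = imul (int n) e" by auto
    then show ?case using imul_succ[of "int n" e]
      by (intro CollectI exI[of _ "Suc n"]) (simp add: add.commute[of 1])
  qed
next
  fix x assume "x \<in> {imul (int n) e | n. True}"
  then show "x \<in> mgen {e}" using mgen_imul[OF mgen_incl[of e "{e}"]] by auto
qed

text \<open>The building block. The order of \<open>e\<close> is arbitrary, as a cone may meet its
  negative. The bound on \<open>m\<close> gives \<open>two_c\<close>, and since \<open>m\<close>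
  divides \<open>N\<close>, the \<open>N\<close>-th power of each element is itself a multiple of
  \<open>z\<close>.\<close>

lemma cyclic_cone:
  fixes e :: "'a::group_add"
  assumes m: "m \<ge> 2" and dvd: "int m dvd N"
  shows "cone (imul (int m) e) (range (\<lambda>i. imul i e)) (mgen {e}) e N"
proof -
  let ?z = "imul (int m) e" and ?X = "range (\<lambda>i. imul i e)"
  have Q: "imul i e \<in> mgen {e}" if "i \<ge> 0" for i
    using that mgen_imul[OF mgen_incl[of e "{e}"], of "nat i"] by simp
  have pow: "q \<in> mgen {e} \<Longrightarrow> \<exists>n::nat. q = imul n e" for q by (auto simp: mgen_single)
  have 1: "- e + imul i e = imul (i - 1) e" "imul i e + - e = imul (i - 1) e" for i
  proof -
    have "imul i e = e + imul (i - 1) e" using imul_succ[of "i - 1" e] by simp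
    then show "- e + imul i e = imul (i - 1) e" by simp
    have "imul i e = imul (i - 1) e + e" using imul_succ'[of "i - 1" e] by simp
    then show "imul i e + - e = imul (i - 1) e" by (simp add: add.assoc)
  qed
  show ?thesis
  proof
    show "0 \<in> ?X" by (rule range_eqI[of _ _ 0]) simp
    show "x \<in> ?X \<Longrightarrow> y \<in> ?X \<Longrightarrow> x + y \<in> ?X" for x y by (auto simp flip: imul_add)
    show "x \<in> ?X \<Longrightarrow> - x \<in> ?X" for x by (auto simp flip: imul_minus)
    show "x \<in> ?X \<Longrightarrow> x + ?z = ?z + x" for x by (auto simp: add.commute simp flip: imul_add)
    show "\<exists>S. finite S \<and> mgen {e} = mgen S" by (intro exI[of _ "{e}"]) simp
    show "mgen {e} \<subseteq> ?X" by (auto simp: mgen_single)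
    show "?z \<in> mgen {e}" by (rule Q) simp
    show "e \<in> mgen {e}" by (rule mgen_incl) simp
    show "x \<in> mgen {e} \<or> - x \<in> mgen {e}" if x: "x \<in> ?X" for x
    proof -
      obtain i where i: "x = imul i e" using x by blast
      then have "- x = imul (- i) e" by (simp add: imul_minus)
      then show ?thesis using Q[of i] Q[of "- i"] i by (cases "i \<ge> 0") auto
    qed
    show "- e + q \<in> mgen {e}" "q + - e \<in> mgen {e}" if q: "q \<in> mgen {e}" "q \<noteq> 0" for q
    proof -
      obtain n :: nat where n: "q = imul n e" using pow q by blast
      then have "n \<noteq> 0" using q(2) by (intro notI) simp
      then have "imul (int n - 1) e \<in> mgen {e}" by (intro Q) simp
      then show "- e + q \<in> mgen {e}" "q + - e \<in> mgen {e}" by (simp_all add: n 1)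
    qed
    show "- e + (- e + ?z) \<in> mgen {e}" using m by (simp add: 1 Q)
    show "\<exists>i::nat. x + imul i ?z \<in> mgen {e}" if x: "x \<in> ?X" for x
    proof -
      obtain i where i: "x = imul i e" using x by blast
      have "i + int (nat \<bar>i\<bar>) * int m \<ge> 0"
      proof -
        have "\<bar>i\<bar> * 1 \<le> \<bar>i\<bar> * int m" using m by (intro mult_left_mono) auto
        then show ?thesis by (simp only: nat_0_le abs_ge_zero)
      qed
      then have "imul (i + int (nat \<bar>i\<bar>) * int m) e \<in> mgen {e}" by (rule Q)
      then show ?thesis using i by (auto simp only: imul_add imul_mult)
    qed
    show "\<exists>j. power_bounded ?z (mgen {e}) (imul N x + imul j ?z)" if x: "x \<in> ?X" for x
    proof -
      obtain i where i: "x = imul i e" using x by blast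
      obtain r where r: "N = int m * r" using dvd by blast
      have "imul N x = imul (r * i) ?z" using i r by (simp add: ac_simps flip: imul_mult)
      then have "imul N x + imul (- (r * i)) ?z = 0" by (simp add: imul_minus)
      moreover have "power_bounded ?z (mgen {e}) 0" unfolding power_bounded_def
        by (intro exI[of _ 0]) (simp add: mgen_zero)
      ultimately show ?thesis by metis
    qed
  qed
qed

text \<open>\<open>f\<close> may have a kernel: an image can lose antisymmetry but no cone axiom.
  The intended use is the first coordinate on the even part of a wreath product.\<close>

lemma cone_image:
  fixes f :: "'a::group_add \<Rightarrow> 'b::group_add"
  assumes C: "cone z X Q c N" and f: "\<And>x y. x \<in> X \<Longrightarrow> y \<in> X \<Longrightarrow> f (x + y) = f x + f y"
  shows "cone (f z) (f ` X) (f ` Q) (f c) N"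
proof -
  interpret cone z X Q c N by fact
  have f_imul: "f (imul i x) = imul i (f x)" if "x \<in> X" for i x
    using imul_hom[of X f x i] f add_X neg_X zero_X that by blast
  have f_0: "f 0 = 0" using f_imul[OF zero_X, of 0] by simp
  have f_neg: "f (- x) = - f x" if "x \<in> X" for x
    using f_imul[OF that, of "- 1"] by (simp add: imul_minus)
  have QX: "q \<in> Q \<Longrightarrow> q \<in> X" for q using Q_X by blast
  note homs = f f_imul f_0 f_neg add_X neg_X imul_X z_X c_X QX
  show ?thesis
  proof
    show "0 \<in> f ` X" using f_0 zero_X by force
    show "x \<in> f ` X \<Longrightarrow> y \<in> f ` X \<Longrightarrow> x + y \<in> f ` X" for x y by (auto simp: add_X simp flip: f)
    show "x \<in> f ` X \<Longrightarrow> - x \<in> f ` X" for x by (auto simp: neg_X simp flip: f_neg)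
    show "x \<in> f ` X \<Longrightarrow> x + f z = f z + x" for x using central by (auto simp: z_X simp flip: f)
    show "\<exists>S. finite S \<and> f ` Q = mgen S"
    proof -
      obtain S where S: "finite S" "Q = mgen S" using fin_gen by blast
      have "f ` mgen S = mgen (f ` S)" by (rule mgen_image[OF f f_0]) (use S Q_X in auto)
      then show ?thesis using S by blast
    qed
    show "f ` Q \<subseteq> f ` X" using Q_X by blast
    show "f z \<in> f ` Q" "f c \<in> f ` Q" using z_Q c_Q by auto
    show "x \<in> f ` Q \<or> - x \<in> f ` Q" if x: "x \<in> f ` X" for x
    proof -
      obtain y where "y \<in> X" "x = f y" using x by blast
      then show ?thesis using total[of y] f_neg[of y] by (metis imageI)
    qed
    show "- f c + q \<in> f ` Q" "q + - f c \<in> f ` Q" if q: "q \<in> f ` Q" "q \<noteq> 0" for q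
    proof -
      obtain r where r: "r \<in> Q" "q = f r" using q by blast
      then have "r \<noteq> 0" using q f_0 by auto
      then have "- c + r \<in> Q" "r + - c \<in> Q" using r least_left least_right by auto
      then have "f (- c + r) \<in> f ` Q" "f (r + - c) \<in> f ` Q" by auto
      then show "- f c + q \<in> f ` Q" "q + - f c \<in> f ` Q" using r by (auto simp: homs)
    qed
    show "- f c + (- f c + f z) \<in> f ` Q"
      using imageI[OF two_c, of f] by (simp add: homs)
    show "\<exists>i::nat. x + imul i (f z) \<in> f ` Q" if x: "x \<in> f ` X" for x
    proof -
      obtain y where y: "y \<in> X" "x = f y" using x by blast
      then obtain i :: nat where "y + imul i z \<in> Q" using cofinal by blast
      then have "f (y + imul i z) \<in> f ` Q" by blast
      then show ?thesis using y by (auto simp: homs)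
    qed
    show "\<exists>j. power_bounded (f z) (f ` Q) (imul N x + imul j (f z))" if x: "x \<in> f ` X" for x
    proof -
      obtain y where y: "y \<in> X" "x = f y" using x by blast
      obtain j where j: "power_bounded z Q (imul N y + imul j z)" using translation[OF y(1)] by blast
      define w where "w = imul N y + imul j z"
      have wX: "w \<in> X" using y by (simp add: w_def homs)
      have fw: "f w = imul N x + imul j (f z)" using y by (simp add: w_def homs)
      obtain C where C: "\<And>n::nat. imul n w + imul (int C) z \<in> Q" "\<And>n::nat. - imul n w + imul (int C) z \<in> Q"
        using j unfolding power_bounded_def w_def by blast
      have "imul n (f w) + imul (int C) (f z) \<in> f ` Q \<and> - imul n (f w) + imul (int C) (f z) \<in> f ` Q" for n :: nat
        using imageI[OF C(1)[of n], of f] imageI[OF C(2)[of n], of f] wX by (simp add: homs)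
      then have "power_bounded (f z) (f ` Q) (f w)" unfolding power_bounded_def by blast
      then show ?thesis using fw by metis
    qed
  qed
qed

context precone
begin

text \<open>Subtracting \<open>c\<close> preserves positivity until \<open>0\<close> is reached, and
  an element that is not a multiple of \<open>c\<close> never reaches \<open>0\<close>.\<close>

lemma multiple_or_above:
  assumes q: "q \<in> Q" and nm: "\<And>n::nat. q \<noteq> imul n c"
  shows "- imul (int j) c + q \<in> Q"
proof (induction j)
  case (Suc j)
  have "- imul (int j) c + q \<noteq> 0"
  proof
    assume "- imul (int j) c + q = 0"
    then have "imul (int j) c = q" by (metis add_0_right add_minus_cancel)
    then show False using nm by blast
  qed
  then have "- c + (- imul (int j) c + q) \<in> Q" using Suc least_left by blast
  moreover have "- c + (- imul (int j) c + q) = - imul (int (Suc j)) c + q"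
    using imul_succ'[of "int j" c] by (simp add: minus_add add.assoc add.commute[of 1])
  ultimately show ?case by simp
qed (simp add: q)

lemma multiple_or_above_right:
  assumes q: "q \<in> Q" and nm: "\<And>n::nat. q \<noteq> imul n c"
  shows "q + - imul (int j) c \<in> Q"
proof (induction j)
  case (Suc j)
  have "q + - imul (int j) c \<noteq> 0"
  proof
    assume "q + - imul (int j) c = 0"
    then have "q = imul (int j) c" by (simp add: eq_neg_iff_add_eq_0[symmetric])
    then show False using nm by blast
  qed
  then have "(q + - imul (int j) c) + - c \<in> Q" using Suc least_right by blast
  moreover have "(q + - imul (int j) c) + - c = q + - imul (int (Suc j)) c"
    using imul_succ[of "int j" c] by (simp add: minus_add add.assoc add.commute[of 1])
  ultimately show ?case by simp
qed (simp add: q)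

end

section \<open>The kernel of a finite cyclic quotient\<close>

text \<open>Additivity is only required modulo \<open>p\<close>, so that both the parity in the
  wreath product and the integral homomorphism \<open>D\<close> are instances.\<close>

locale cyclic_quotient = precone +
  fixes \<chi> :: "'a \<Rightarrow> int" and p :: nat
  assumes chi_add: "x \<in> X \<Longrightarrow> y \<in> X \<Longrightarrow> [\<chi> (x + y) = \<chi> x + \<chi> y] (mod int p)"
    and chi_c: "coprime (\<chi> c) (int p)" and p_pos: "p > 0"
begin

definition K where "K = {x \<in> X. int p dvd \<chi> x}"

lemma chi_imul: "x \<in> X \<Longrightarrow> [\<chi> (imul i x) = i * \<chi> x] (mod int p)"
proof (induction i rule: int_induct[where k = 0])
  case base
  have "[\<chi> 0 + 0 = \<chi> 0 + \<chi> 0] (mod int p)" using chi_add[OF zero_X zero_X] by simp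
  then have "[0 = \<chi> 0] (mod int p)" by (simp only: cong_add_lcancel)
  then show ?case by (simp add: cong_sym)
next
  case (step1 i)
  have "[\<chi> (imul (i + 1) x) = \<chi> (imul i x) + \<chi> x] (mod int p)"
    using chi_add[OF imul_X[OF step1.prems, of i] step1.prems] by (simp add: imul_succ')
  also have "[\<chi> (imul i x) + \<chi> x = i * \<chi> x + \<chi> x] (mod int p)"
    using step1 by (intro cong_add) auto
  finally show ?case by (simp add: algebra_simps)
next
  case (step2 i)
  have "[\<chi> (imul i x) = \<chi> (imul (i - 1) x) + \<chi> x] (mod int p)"
    using chi_add[OF imul_X[OF step2.prems, of "i - 1"] step2.prems] imul_succ'[of "i - 1" x] by simp
  then have "[\<chi> (imul (i - 1) x) + \<chi> x = (i - 1) * \<chi> x + \<chi> x] (mod int p)"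
    using step2 by (metis add.commute cong_sym cong_trans diff_add_cancel mult.commute distrib_left mult.right_neutral)
  then show ?case by (simp only: cong_add_rcancel)
qed

lemma K_X: "K \<subseteq> X" by (auto simp: K_def)

lemma K_iff: "x \<in> X \<Longrightarrow> x \<in> K \<longleftrightarrow> [\<chi> x = 0] (mod int p)"
  by (simp add: K_def cong_0_iff)

lemma K_add: "x \<in> K \<Longrightarrow> y \<in> K \<Longrightarrow> x + y \<in> K"
  using chi_add[of x y] add_X[of x y] K_X cong_trans cong_add[of "\<chi> x" 0 "int p" "\<chi> y" 0]
  by (metis K_iff add_0 subsetD)

lemma K_imul: "x \<in> K \<Longrightarrow> imul i x \<in> K"
proof -
  assume x: "x \<in> K"
  then have xX: "x \<in> X" using K_X by blast
  have "[\<chi> (imul i x) = 0] (mod int p)"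
    using chi_imul[OF xX, of i] cong_trans cong_mult[of i i "int p" "\<chi> x" 0] x K_iff[OF xX] by fastforce
  then show ?thesis using K_iff imul_X xX by blast
qed

lemma K_neg: "x \<in> K \<Longrightarrow> - x \<in> K"
  using K_imul[of x "- 1"] by (simp add: imul_minus)

lemma K_0: "0 \<in> K"
  using chi_imul[OF zero_X, of 0] K_iff[OF zero_X] by simp

lemma imul_c_K: "imul i c \<in> K \<longleftrightarrow> int p dvd i"
proof -
  have "imul i c \<in> K \<longleftrightarrow> [i * \<chi> c = 0] (mod int p)"
    using chi_imul[OF c_X, of i] K_iff[OF imul_X[OF c_X]] cong_trans cong_sym by blast
  also have "\<dots> \<longleftrightarrow> int p dvd i" 
    using chi_c by (simp add: cong_0_iff coprime_commute coprime_dvd_mult_left_iff)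
  finally show ?thesis .
qed

text \<open>Here \<open>j\<close> is \<open>\<chi> x\<close> divided by \<open>\<chi> c\<close>
  modulo \<open>p\<close>, so the multiples of \<open>c\<close> form a transversal of the
  kernel.\<close>

lemma shift_to_K:
  assumes "x \<in> X"
  shows "\<exists>j::nat. - imul (int j) c + x \<in> K"
proof -
  obtain u where u: "[\<chi> c * u = 1] (mod int p)" using cong_solve_coprime_int[OF chi_c] by blast
  define j where "j = nat ((u * \<chi> x) mod int p)"
  have j: "[int j = u * \<chi> x] (mod int p)" using p_pos by (simp add: j_def cong_def)
  have nX: "- imul (int j) c \<in> X" using c_X imul_X neg_X by blast
  have "- imul (int j) c = imul (- int j) c" by (simp add: imul_minus)
  then have "[\<chi> (- imul (int j) c) = - int j * \<chi> c] (mod int p)" using chi_imul[OF c_X] by metis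
  then have "[\<chi> (- imul (int j) c + x) = - int j * \<chi> c + \<chi> x] (mod int p)"
    using chi_add[OF nX assms] cong_trans cong_add[OF _ cong_refl] by blast
  also have "[- int j * \<chi> c + \<chi> x = - (u * \<chi> x) * \<chi> c + \<chi> x] (mod int p)"
    using j by (intro cong_add cong_mult) (auto simp: cong_minus_minus_iff)
  also have "- (u * \<chi> x) * \<chi> c + \<chi> x = - (\<chi> c * u) * \<chi> x + \<chi> x" by (simp add: algebra_simps)
  also have "[- (\<chi> c * u) * \<chi> x + \<chi> x = - 1 * \<chi> x + \<chi> x] (mod int p)"
    using u by (intro cong_add cong_mult) (auto simp: cong_minus_minus_iff)
  finally show ?thesis using K_iff[OF add_X[OF nX assms]] by auto
qed

lemma least_K:
  assumes q: "q \<in> Q" "q \<in> K" "q \<noteq> 0"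
  shows "- imul (int p) c + q \<in> Q" "q + - imul (int p) c \<in> Q"
proof -
  have Qi: "imul i c \<in> Q" if "i \<ge> 0" for i using imul_Q' c_Q that by blast
  have "- imul (int p) c + q \<in> Q \<and> q + - imul (int p) c \<in> Q"
  proof (cases "\<exists>n::nat. q = imul n c")
    case True
    then obtain n :: nat where n: "q = imul n c" by blast
    then have "n \<noteq> 0" using q(3) by (intro notI) simp
    moreover have "p dvd n" using q(2) n imul_c_K by simp
    ultimately have "p \<le> n" by (simp add: dvd_imp_le)
    then have "imul (int n - int p) c \<in> Q" by (intro Qi) simp
    moreover have "- imul (int p) c + q = imul (int n - int p) c" "q + - imul (int p) c = imul (int n - int p) c"
      using imul_add[of "- int p" "int n" c] imul_add[of "int n" "- int p" c] n
      by (auto simp: imul_minus diff_conv_add_uminus[of "int n"] add.commute[of "- int p"] simp del: imul_0)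
    ultimately show ?thesis by simp
  next
    case False
    then show ?thesis using multiple_or_above multiple_or_above_right q(1) by blast
  qed
  then show "- imul (int p) c + q \<in> Q" "q + - imul (int p) c \<in> Q" by auto
qed

text \<open>Rewriting as for Schreier generators, with transversal
  \<open>0, c, \<dots>, (p - 1) c\<close>. The rewritten generators are positive because a generator
  that is not a multiple of \<open>c\<close> exceeds every multiple of \<open>c\<close>; the
  generators that are multiples contribute only \<open>p c\<close>.\<close>

lemma Q_K_fin_gen: "\<exists>S. finite S \<and> Q \<inter> K = mgen S"
proof -
  obtain S where S: "finite S" "Q = mgen S" using fin_gen by blast
  have SX: "s \<in> X" "s \<in> Q" if "s \<in> S" for s using that S Q_X mgen_incl by blast+
  define sh where "sh s = (SOME j::nat. - imul (int j) c + s \<in> K)" for s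
  have sh: "- imul (int (sh s)) c + s \<in> K" if "s \<in> S" for s
    unfolding sh_def using someI_ex[OF shift_to_K[OF SX(1)[OF that]]] .
  define S1 where "S1 = {s \<in> S. \<forall>n::nat. s \<noteq> imul n c}"
  define g where "g r s = - imul (int r) c + (- imul (int (sh s)) c + s) + imul (int r) c" for r s
  define T where "T = insert (imul (int p) c) ((\<lambda>(r, s). g r s) ` ({..<p} \<times> S1))"
  have finT: "finite T" using S(1) by (simp add: T_def S1_def)
  have g: "g r s \<in> Q \<inter> K" if "s \<in> S1" for r s
  proof -
    have s: "s \<in> S" "\<And>n::nat. s \<noteq> imul n c" using that by (auto simp: S1_def)
    have "- imul (int (sh s + r)) c = - imul (int r) c + - imul (int (sh s)) c"
      using imul_add[of "int (sh s)" "int r" c] by (simp add: minus_add)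
    then have "g r s = (- imul (int (sh s + r)) c + s) + imul (int r) c"
      by (simp add: g_def add.assoc)
    then have "g r s \<in> Q" using multiple_or_above[OF SX(2)[OF s(1)] s(2)] imul_Q[OF c_Q] add_Q by metis
    moreover have "g r s \<in> K"
    proof -
      let ?k = "- imul (int (sh s)) c + s"
      have kK: "?k \<in> K" "?k \<in> X" using sh s K_X by auto
      have rX: "imul (int r) c \<in> X" "- imul (int r) c \<in> X" using c_X imul_X neg_X by auto
      have "[\<chi> (g r s) = \<chi> (- imul (int r) c + ?k) + \<chi> (imul (int r) c)] (mod int p)"
        unfolding g_def by (intro chi_add add_X rX kK)
      also have "[\<chi> (- imul (int r) c + ?k) + \<chi> (imul (int r) c) = \<chi> (- imul (int r) c) + \<chi> ?k + \<chi> (imul (int r) c)] (mod int p)"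
        by (intro cong_add chi_add rX kK cong_refl)
      also have "[\<chi> (- imul (int r) c) + \<chi> ?k + \<chi> (imul (int r) c) = - int r * \<chi> c + 0 + int r * \<chi> c] (mod int p)"
        using chi_imul[OF c_X, of "- int r"] chi_imul[OF c_X, of "int r"] kK K_iff[OF kK(2)]
        by (intro cong_add) (simp_all add: imul_minus)
      finally have "[\<chi> (g r s) = 0] (mod int p)" by simp
      moreover have "g r s \<in> X" unfolding g_def by (intro add_X rX kK)
      ultimately show ?thesis using K_iff by blast
    qed
    ultimately show ?thesis by blast
  qed
  have "mgen T \<subseteq> Q \<inter> K"
  proof (rule mgen_least)
    have "imul (int p) c \<in> Q \<inter> K" using imul_Q[OF c_Q] imul_c_K by simp
    then show "s \<in> Q \<inter> K" if "s \<in> T" for s using that g by (auto simp: T_def)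
  qed (use zero_Q K_0 add_Q K_add in auto)
  moreover have "Q \<inter> K \<subseteq> mgen T"
  proof
    fix w assume w: "w \<in> Q \<inter> K"
    \<comment> \<open>Multiples of \<open>p c\<close> move from the representative into the kernel
      part, keeping the representative below \<open>p\<close>.\<close>
    have reduce: "\<exists>r' q'. r' < p \<and> q' \<in> mgen T \<and> imul (int r) c + q = imul (int r') c + q'"
      if "q \<in> mgen T" for r q
    proof -
      have "int r = int (r mod p) + int (r div p) * int p" by (metis mod_div_mult_eq of_nat_add of_nat_mult)
      then have "imul (int r) c + q = imul (int (r mod p)) c + (imul (int (r div p)) (imul (int p) c) + q)"
        by (metis add.assoc imul_add imul_mult)
      moreover have "imul (int (r div p)) (imul (int p) c) + q \<in> mgen T"
        by (rule mgen_add[OF mgen_imul[OF mgen_incl] that]) (simp add: T_def)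
      ultimately show ?thesis using p_pos mod_less_divisor by blast
    qed
    have "\<exists>r q. r < p \<and> q \<in> mgen T \<and> w = imul (int r) c + q" if "w \<in> mgen S" for w
      using that
    proof (induction rule: mgen.induct)
      case mgen_zero
      show ?case using p_pos mgen.mgen_zero by (intro exI[of _ 0] exI[of _ "0::'a"]) simp
    next
      case (mgen_step s x)
      then obtain r q where rq: "r < p" "q \<in> mgen T" "x = imul (int r) c + q" by blast
      show ?case
      proof (cases "s \<in> S1")
        case True
        \<comment> \<open>The definition of \<open>g\<close> amounts to
          \<open>s + r c = (sh s + r) c + g r s\<close>: the new letter passes the
          representative.\<close>
        have "imul (int (sh s + r)) c = imul (int (sh s)) c + imul (int r) c"
          by (simp add: imul_add)
        then have "s + x = imul (int (sh s + r)) c + (g r s + q)"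
          using rq(3) by (simp add: g_def add.assoc)
        moreover have "g r s + q \<in> mgen T"
          using rq True by (intro mgen.mgen_step) (auto simp: T_def)
        ultimately show ?thesis using reduce by metis
      next
        case False
        then obtain n :: nat where "s = imul n c" using mgen_step by (auto simp: S1_def)
        then have "s + x = imul (int (n + r)) c + q" using rq by (simp add: imul_add add.assoc)
        then show ?thesis using reduce rq by metis
      qed
    qed
    then obtain r q where rq: "r < p" "q \<in> mgen T" "w = imul (int r) c + q" using w S by blast
    have qK: "q \<in> K" using rq(2) \<open>mgen T \<subseteq> Q \<inter> K\<close> by blast
    have "imul (int r) c = w + - q" using rq(3) by (simp add: add.assoc)
    then have "imul (int r) c \<in> K" using w qK K_add K_neg by auto
    then have "r = 0" using imul_c_K rq(1) by (auto dest: dvd_imp_le)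
    then show "w \<in> mgen T" using rq by simp
  qed
  ultimately show ?thesis using finT by blast
qed

end

text \<open>The new least element is \<open>p c\<close>, and its \<open>two_c\<close> requires
  \<open>2 p c\<close> to be below \<open>z\<close>; hence the hypothesis on all multiples of
  \<open>c\<close>.\<close>

lemma cone_cyclic_quotient:
  assumes C: "cone z X Q c N" and cq: "cyclic_quotient z X Q c \<chi> p"
    and z: "int p dvd \<chi> z" and below: "\<And>j::nat. - imul (int j) c + z \<in> Q"
  shows "cone z {x \<in> X. int p dvd \<chi> x} (Q \<inter> {x \<in> X. int p dvd \<chi> x}) (imul (int p) c) N"
proof -
  interpret cone z X Q c N by fact
  interpret cyclic_quotient z X Q c \<chi> p by fact
  have zK: "z \<in> K" using z z_X by (simp add: K_def)
  have "cone z K (Q \<inter> K) (imul (int p) c) N"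
  proof
    show "x \<in> K \<Longrightarrow> x + z = z + x" for x using central K_X by blast
    show "Q \<inter> K \<subseteq> K" by blast
    have pc: "imul (int p) c \<in> K" using imul_c_K by simp
    show "imul (int p) c \<in> Q \<inter> K" using pc imul_Q c_Q by blast
    show "x \<in> K \<Longrightarrow> x \<in> Q \<inter> K \<or> - x \<in> Q \<inter> K" for x using total K_X K_neg by blast
    show "- imul (int p) c + q \<in> Q \<inter> K" "q + - imul (int p) c \<in> Q \<inter> K" if "q \<in> Q \<inter> K" "q \<noteq> 0" for q
      using that least_K[of q] K_add K_neg[OF pc] by auto
    have "- imul (int p) c + (- imul (int p) c + z) = - imul (int (2 * p)) c + z"
      using imul_add[of "int p" "int p" c] by (simp add: minus_add add.assoc)
    then have "- imul (int p) c + (- imul (int p) c + z) \<in> Q" using below[of "2 * p"] by simp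
    then show "- imul (int p) c + (- imul (int p) c + z) \<in> Q \<inter> K" using K_add K_neg[OF pc] zK by blast
    show "\<exists>i::nat. x + imul i z \<in> Q \<inter> K" if x: "x \<in> K" for x
    proof -
      obtain i :: nat where "x + imul i z \<in> Q" using x cofinal K_X by blast
      then show ?thesis using x K_add K_imul[OF zK] by blast
    qed
    show "\<exists>j. power_bounded z (Q \<inter> K) (imul N x + imul j z)" if x: "x \<in> K" for x
    proof -
      obtain j where "power_bounded z Q (imul N x + imul j z)" using x translation K_X by blast
      moreover have "imul N x + imul j z \<in> K" using x zK K_add K_imul by blast
      ultimately have "power_bounded z (Q \<inter> K) (imul N x + imul j z)"
        unfolding power_bounded_def using K_add K_imul K_neg zK by auto
      then show ?thesis by blast
    qed
    show "\<exists>S. finite S \<and> Q \<inter> K = mgen S" by (rule Q_K_fin_gen)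
    show "z \<in> Q \<inter> K" using z_Q zK by blast
  qed (rule K_0 K_add K_neg; assumption)+
  then show ?thesis by (simp add: K_def)
qed

section \<open>Twisted orders\<close>

text \<open>What distinguishing the twisted orders requires: \<open>c_below_z\<close> gives
  \<open>c\<close> translation number 0, and \<open>center\<close> makes an automorphism send
  \<open>z\<close> to a multiple of \<open>z\<close>.\<close>

locale rigid_cone = cone +
  fixes D :: "'a \<Rightarrow> int"
  assumes antisym: "q \<in> Q \<Longrightarrow> - q \<in> Q \<Longrightarrow> q = 0"
    and c_below_z: "- imul (int j) c + z \<in> Q"
    and center: "x \<in> X \<Longrightarrow> (\<And>y. y \<in> X \<Longrightarrow> x + y = y + x) \<Longrightarrow> \<exists>i. x = imul i z"
    and D_add: "x \<in> X \<Longrightarrow> y \<in> X \<Longrightarrow> D (x + y) = D x + D y"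
    and D_z: "D z = N" and N_pos: "N > 0" and D_c: "D c \<noteq> 0"
begin

lemma D_imul: "x \<in> X \<Longrightarrow> D (imul i x) = i * D x"
proof -
  assume x: "x \<in> X"
  have "D (imul i x) = imul i (D x)"
    using imul_hom[of X D x i] D_add add_X neg_X zero_X x by blast
  then show ?thesis by (simp add: imul_int)
qed

lemma D_0: "D 0 = 0"
  using D_imul[OF zero_X, of 0] by simp

lemma imul_z_Q_iff: "imul i z \<in> Q \<longleftrightarrow> i \<ge> 0"
proof
  assume i: "imul i z \<in> Q"
  show "i \<ge> 0"
  proof (rule ccontr)
    assume "\<not> i \<ge> 0"
    then have "- imul i z \<in> Q" using imul_Q'[OF z_Q, of "- i"] by (simp add: imul_minus)
    then have "imul i z = 0" using antisym i by blast
    then have "i * N = 0" using D_imul[OF z_X, of i] D_0 D_z by simp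
    then show False using N_pos \<open>\<not> i \<ge> 0\<close> by simp
  qed
qed (rule imul_Q'[OF z_Q])

definition twist :: "nat \<Rightarrow> 'a \<Rightarrow> 'a" where
  "twist t x = x + imul (int t * D x) z"

definition deg :: "nat \<Rightarrow> nat" where
  "deg t = 1 + t * nat N"

definition Qt :: "nat \<Rightarrow> 'a set" where
  "Qt t = {x \<in> X. twist t x \<in> Q}"

text \<open>The element that \<open>twist t\<close> sends to \<open>deg t\<close> times
  \<open>c\<close>. Because \<open>deg t - t N = 1\<close>, its value under \<open>D\<close> is
  again \<open>D c\<close>.\<close>

definition ct :: "nat \<Rightarrow> 'a" where
  "ct t = imul (int (deg t)) c + imul (- (int t * D c)) z"

lemma deg_int: "int (deg t) = 1 + int t * N"
  using N_pos by (simp add: deg_def)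

lemma twist_X: "x \<in> X \<Longrightarrow> twist t x \<in> X"
  unfolding twist_def by (intro add_X imul_X z_X)

lemma twist_add: "x \<in> X \<Longrightarrow> y \<in> X \<Longrightarrow> twist t (x + y) = twist t x + twist t y"
proof -
  assume x: "x \<in> X" and y: "y \<in> X"
  have "twist t x + twist t y = x + (imul (int t * D x) z + y) + imul (int t * D y) z"
    by (simp add: twist_def add.assoc)
  also have "imul (int t * D x) z + y = y + imul (int t * D x) z"
    using imul_z_commute[OF y] by simp
  finally show ?thesis using x y by (simp add: twist_def D_add distrib_left imul_add add.assoc)
qed

lemma twist_0: "twist t 0 = 0" by (simp add: twist_def D_0)

lemma twist_neg: "x \<in> X \<Longrightarrow> twist t (- x) = - twist t x"
  using twist_add[of x "- x" t] neg_X[of x] minus_unique[of "twist t x" "twist t (- x)"] by (simp add: twist_0)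

lemma D_twist: "x \<in> X \<Longrightarrow> D (twist t x) = int (deg t) * D x"
  by (simp add: twist_def D_add imul_X z_X D_imul D_z deg_int algebra_simps)

lemma twist_eq_0: "x \<in> X \<Longrightarrow> twist t x = 0 \<Longrightarrow> x = 0"
proof -
  assume x: "x \<in> X" "twist t x = 0"
  then have "int (deg t) * D x = 0" using D_twist[OF x(1), of t] D_0 by simp
  moreover have "int (deg t) \<noteq> 0" by (simp add: deg_def del: of_nat_add of_nat_mult)
  ultimately have "D x = 0" by simp
  then show ?thesis using x by (simp add: twist_def)
qed

lemma ct_X: "ct t \<in> X" unfolding ct_def by (intro add_X imul_X c_X z_X)

lemma twist_ct: "twist t (ct t) = imul (int (deg t)) c"
proof -
  have "D (ct t) = D c"
    by (simp add: ct_def D_add imul_X c_X z_X D_imul D_z deg_int algebra_simps)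
  then show ?thesis by (simp add: twist_def) (simp add: ct_def add.assoc flip: imul_add)
qed

section \<open>The twisted cone for an admissible parameter\<close>

context
  fixes t :: nat
  assumes t: "D c dvd int t"
begin

lemma coprime_deg: "coprime (D c) (int (deg t))"
proof (rule coprimeI)
  fix d assume d: "d dvd D c" "d dvd int (deg t)"
  then have "d dvd int t * N" using t dvd_trans by (metis dvd_mult2)
  then have "d dvd 1" using d(2) unfolding deg_int by (metis dvd_add_left_iff)
  then show "is_unit d" .
qed

interpretation cyclic_quotient z X Q c D "deg t"
  by unfold_locales (simp_all add: D_add coprime_deg, simp add: deg_def)

lemma ct_Qt: "ct t \<in> Qt t"
  using imul_Q[OF c_Q, of "deg t"] by (simp add: Qt_def ct_X twist_ct)

lemma ct_nonzero: "ct t \<noteq> 0"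
proof
  assume "ct t = 0"
  moreover have "D (ct t) = D c"
    by (simp add: ct_def D_add imul_X c_X z_X D_imul D_z deg_int algebra_simps)
  ultimately show False using D_c D_0 by simp
qed

lemma twist_K: "x \<in> X \<Longrightarrow> twist t x \<in> K"
  by (simp add: K_def twist_X D_twist)

lemma ct_least: "x \<in> Qt t \<Longrightarrow> x \<noteq> 0 \<Longrightarrow> - ct t + x \<in> Qt t"
  using least_K(1)[of "twist t x"] twist_K[of x] twist_eq_0[of x t] ct_X neg_X add_X
  by (auto simp: Qt_def twist_add twist_neg twist_ct)

lemma Qt_total: "x \<in> X \<Longrightarrow> x \<in> Qt t \<or> - x \<in> Qt t"
  using total[OF twist_X[of x t]] neg_X by (auto simp: Qt_def twist_neg)

lemma Qt_add: "x \<in> Qt t \<Longrightarrow> y \<in> Qt t \<Longrightarrow> x + y \<in> Qt t"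
  using add_X add_Q by (auto simp: Qt_def twist_add)

lemma Qt_antisym: "x \<in> Qt t \<Longrightarrow> - x \<in> Qt t \<Longrightarrow> x = 0"
  using antisym twist_eq_0 by (auto simp: Qt_def twist_neg)

lemma Qt_fin_gen: "\<exists>S. finite S \<and> Qt t = mgen S"
proof -
  obtain S where S: "finite S" "Q \<inter> K = mgen S" using Q_K_fin_gen by blast
  \<comment> \<open>The inverse of \<open>twist t\<close> on \<open>K\<close>: since
    \<open>twist t\<close> multiplies \<open>D\<close> by \<open>deg t\<close>, an exact division
    recovers the original value of \<open>D\<close> and with it the multiple of \<open>z\<close> to
    remove.\<close>
  define unt where "unt y = y + imul (- (int t * (D y div int (deg t)))) z" for y
  have dpos: "int (deg t) \<noteq> 0" by (simp add: deg_def del: of_nat_add of_nat_mult)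
  have unt_twist: "unt (twist t x) = x" if "x \<in> X" for x
  proof -
    have "D (twist t x) div int (deg t) = D x" using dpos by (simp add: D_twist[OF that])
    then show ?thesis by (simp add: unt_def) (simp add: twist_def add.assoc flip: imul_add)
  qed
  have twist_unt: "twist t (unt y) = y \<and> unt y \<in> X" if y: "y \<in> K" for y
  proof -
    obtain u where u: "D y = int (deg t) * u" and yX: "y \<in> X" using y by (auto simp: K_def)
    have "D y div int (deg t) = u" using dpos u by simp
    then have un: "unt y = y + imul (- (int t * u)) z" by (simp add: unt_def)
    then have "D (unt y) = u"
      using yX u by (simp add: D_add imul_X z_X D_imul D_z deg_int algebra_simps)
    then show ?thesis using un yX add_X imul_X z_X
      by (simp add: twist_def add.assoc flip: imul_add)
  qed
  have unt_add: "unt (x + y) = unt x + unt y" if "x \<in> K" "y \<in> K" for x y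
  proof -
    have "unt (twist t (unt x) + twist t (unt y)) = unt x + unt y"
      using twist_unt that unt_twist add_X by (metis twist_add)
    then show ?thesis using twist_unt that by simp
  qed
  have unt_0: "unt 0 = 0" using unt_twist[OF zero_X] by (simp add: twist_0)
  have "Qt t = unt ` (Q \<inter> K)"
  proof (intro equalityI subsetI)
    fix x assume "x \<in> Qt t"
    then show "x \<in> unt ` (Q \<inter> K)" using twist_K unt_twist by (force simp: Qt_def)
  next
    fix x assume "x \<in> unt ` (Q \<inter> K)"
    then show "x \<in> Qt t" using twist_unt by (auto simp: Qt_def)
  qed
  also have "\<dots> = mgen (unt ` S)"
    unfolding S(2) by (rule mgen_image[where X = K]) (use unt_add unt_0 S in auto)
  finally show ?thesis using S by blast
qed

end

text \<open>The invariant separating the twisted orders: since translation numbers lie in \<open>(1/N) \<int>\<close> and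
  \<open>c\<close> has translation number \<open>0\<close>, comparing them with \<open>D\<close> on
  \<open>deg t2 * f c = deg t1 * c + u z\<close> forces \<open>deg t2\<close> to divide \<open>deg t1 * D c\<close>.\<close>

lemma deg_dvd:
  assumes t2: "D c dvd int t2"
    and f: "\<And>x y. x \<in> X \<Longrightarrow> y \<in> X \<Longrightarrow> f (x + y) = f x + f y" and fX: "f ` X = X"
    and eq: "f (ct t2) = ct t1"
  shows "deg t2 dvd deg t1"
proof -
  have f_imul: "f (imul i x) = imul i (f x)" if "x \<in> X" for i x
    using imul_hom[of X f x i] f add_X neg_X zero_X that by blast
  have fzX: "f z \<in> X" "f c \<in> X" using fX z_X c_X by auto
  \<comment> \<open>Surjectivity of \<open>f\<close> makes \<open>f z\<close> commute with all of
    \<open>X\<close>.\<close>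
  have "f z + y = y + f z" if y: "y \<in> X" for y
  proof -
    obtain x where x: "x \<in> X" "y = f x" using y fX by blast
    then show ?thesis using central[OF x(1)] f[OF x(1) z_X] f[OF z_X x(1)] by simp
  qed
  then obtain k where k: "f z = imul k z" using center[OF fzX(1)] by blast
  define d where "d = f c"
  define p1 p2 where "p1 = int (deg t1)" and "p2 = int (deg t2)"
  define u where "u = int t2 * D c * k - int t1 * D c"
  have dX: "d \<in> X" by (simp add: d_def fzX)
  have "f (ct t2) = imul p2 d + imul (- (int t2 * D c) * k) z"
    by (simp add: ct_def f imul_X c_X z_X f_imul k d_def p2_def flip: imul_mult)
  then have "imul p2 d = ct t1 + imul (int t2 * D c * k) z"
    using eq by (simp add: add.assoc flip: imul_add)
  then have rel: "imul p2 d = imul p1 c + imul u z"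
    by (simp add: ct_def p1_def u_def add.assoc flip: imul_add)
  obtain j where "power_bounded z Q (imul N d + imul j z)" using translation[OF dX] by blast
  then obtain C where C: "\<And>n::nat. imul n (imul N d + imul j z) + imul (int C) z \<in> Q"
    "\<And>n::nat. - imul n (imul N d + imul j z) + imul (int C) z \<in> Q"
    unfolding power_bounded_def by blast
  \<comment> \<open>By \<open>rel\<close> the translation number of \<open>d\<close> is
    \<open>u / p2\<close>, as \<open>c\<close> contributes 0; by \<open>translation\<close> it is
    \<open>- j / N\<close>. The two agree exactly when \<open>w = 0\<close>.\<close>
  define w where "w = N * u + p2 * j"
  have key: "imul (int n * p2) (imul N d + imul j z) = imul (int n * N * p1) c + imul (int n * w) z" for n
  proof -
    have dz: "imul N d + imul j z = imul j z + imul N d" using imul_z_commute[OF imul_X[OF dX]] .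
    have cz: "imul p1 c + imul u z = imul u z + imul p1 c" using imul_z_commute[OF imul_X[OF c_X]] .
    have "imul (int n * p2) (imul N d + imul j z) = imul (int n * N) (imul p2 d) + imul (int n * p2 * j) z"
      by (simp add: imul_plus[OF dz] ac_simps flip: imul_mult)
    also have "\<dots> = imul (int n * N * p1) c + (imul (int n * N * u) z + imul (int n * p2 * j) z)"
      by (simp add: rel imul_plus[OF cz] add.assoc flip: imul_mult)
    also have "imul (int n * N * u) z + imul (int n * p2 * j) z = imul (int n * w) z"
      by (simp add: w_def algebra_simps flip: imul_add)
    finally show ?thesis .
  qed
  have "w = 0"
  proof (rule ccontr)
    assume w: "w \<noteq> 0"
    \<comment> \<open>Multiples of \<open>c\<close> lie between \<open>0\<close> and
      \<open>z\<close>, so the bounds force \<open>n w\<close> into the range from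
      \<open>- C - 1\<close> to \<open>C\<close>, which is impossible for \<open>n = C + 2\<close>
      and \<open>w\<close> nonzero.\<close>
    define n where "n = C + 2"
    have n: "int n = int C + 2" by (simp add: n_def)
    define M where "M = nat (int n * N * p1)"
    have M: "int M = int n * N * p1" using N_pos by (simp add: M_def p1_def)
    have np: "int n * p2 = int (n * deg t2)" by (simp add: p2_def)
    have "imul (int M) c + imul (int n * w) z + imul (int C) z \<in> Q"
      using C(1)[of "n * deg t2"] key[of n] np M by simp
    then have 1: "imul (int M) c + imul (int n * w + int C) z \<in> Q" by (simp add: imul_add add.assoc)
    have "- (imul (int M) c + imul (int n * w) z) + imul (int C) z \<in> Q"
      using C(2)[of "n * deg t2"] key[of n] np M by simp
    moreover have "- (imul (int M) c + imul (int n * w) z) = - imul (int M) c + imul (- (int n * w)) z"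
    proof -
      have "- (imul (int M) c + imul (int n * w) z) = imul (- (int n * w)) z + - imul (int M) c"
        by (simp add: minus_add imul_minus)
      then show ?thesis using imul_z_commute[OF neg_X[OF imul_X[OF c_X]]] by simp
    qed
    ultimately have 2: "- imul (int M) c + imul (int C - int n * w) z \<in> Q"
      by (simp add: add.assoc flip: imul_add)
    have "(- imul (int M) c + z) + (imul (int M) c + imul (int n * w + int C) z) = imul (int n * w + int C + 1) z"
    proof -
      have "z + imul (int M) c = imul (int M) c + z" using central imul_X[OF c_X] by simp
      moreover have "(- imul (int M) c + z) + (imul (int M) c + imul (int n * w + int C) z)
          = - imul (int M) c + ((z + imul (int M) c) + imul (int n * w + int C) z)"
        by (simp only: add.assoc)
      ultimately have "(- imul (int M) c + z) + (imul (int M) c + imul (int n * w + int C) z)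
          = z + imul (int n * w + int C) z"
        by (simp only: add.assoc minus_add_cancel)
      then show ?thesis using imul_succ[of "int n * w + int C" z] by simp
    qed
    then have a: "int n * w + int C + 1 \<ge> 0" using add_Q[OF c_below_z 1] imul_z_Q_iff by metis
    have "imul (int M) c + (- imul (int M) c + imul (int C - int n * w) z) = imul (int C - int n * w) z"
      by simp
    then have b: "int C - int n * w \<ge> 0" using add_Q[OF imul_Q[OF c_Q, of M] 2] imul_z_Q_iff by metis
    show False
    proof (cases "w > 0")
      case True
      then have "int n * 1 \<le> int n * w" by (intro mult_left_mono) auto
      then show False using b n by linarith
    next
      case False
      then have "int n * w \<le> int n * (- 1)" using w by (intro mult_left_mono) auto
      then show False using a n by linarith
    qed
  qed
  then have Nu: "N * u = - (p2 * j)" by (simp add: w_def)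
  have "p2 * D d = p1 * D c + u * N"
    using arg_cong[OF rel, of D] by (simp add: D_add imul_X dX c_X z_X D_imul D_z)
  then have "p1 * D c = p2 * (D d + j)" using Nu by (simp add: algebra_simps)
  then have "p2 dvd p1 * D c" by simp
  then have "p2 dvd p1"
    using coprime_deg[OF t2] by (simp add: p2_def coprime_commute coprime_dvd_mult_left_iff)
  then show ?thesis by (simp add: p1_def p2_def)
qed

section \<open>From cones to isolated left orders\<close>

theorem infinitely_many_isolated:
  fixes G (structure)
  assumes G: "group G" and bij: "bij_betw emb (carrier G) X"
    and hom: "\<And>x y. x \<in> carrier G \<Longrightarrow> y \<in> carrier G \<Longrightarrow> emb (x \<otimes> y) = emb x + emb y"
  shows "\<exists>Ords. Ords \<subseteq> {lt. isolated_left_order G lt} \<and> infinite Ords \<and> countable Ords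
             \<and> (\<forall>l1\<in>Ords. \<forall>l2\<in>Ords. l1 \<noteq> l2 \<longrightarrow> \<not> (\<exists>\<phi>\<in>iso G G. l2 = aut_image G l1 \<phi>))"
proof -
  interpret G: group G by fact
  have lX: "x \<in> carrier G \<Longrightarrow> emb x \<in> X" for x using bij by (auto simp: bij_betw_def)
  have inj: "emb x = emb y \<Longrightarrow> x \<in> carrier G \<Longrightarrow> y \<in> carrier G \<Longrightarrow> x = y" for x y
    using bij by (auto simp: bij_betw_def inj_on_def)
  have surj: "\<exists>x\<in>carrier G. emb x = y" if "y \<in> X" for y using bij that by (auto simp: bij_betw_def)
  have l1: "emb \<one> = 0"
  proof -
    have "emb \<one> + emb \<one> = emb \<one> + 0" using hom[of \<one> \<one>] by simp
    then show ?thesis by (simp only: add_left_cancel)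
  qed
  define lt where "lt t x y \<longleftrightarrow> x \<in> carrier G \<and> y \<in> carrier G \<and> x \<noteq> y \<and> - emb x + emb y \<in> Qt t" for t x y
  define good where "good t \<longleftrightarrow> D c dvd int t" for t
  have lt_1: "lt t \<one> y \<longleftrightarrow> y \<in> carrier G \<and> y \<noteq> \<one> \<and> emb y \<in> Qt t" for t y
    by (auto simp: lt_def l1)
  have lo: "left_order G (lt t)" if t: "good t" for t
  proof -
    have t': "D c dvd int t" using t by (simp add: good_def)
    have tr: "lt t x w" if "lt t x y" "lt t y w" for x y w
    proof -
      have "(- emb x + emb y) + (- emb y + emb w) \<in> Qt t" using that Qt_add[OF t'] by (simp add: lt_def)
      then have "- emb x + emb w \<in> Qt t" by (simp add: add.assoc)
      moreover have "x \<noteq> w"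
      proof
        assume "x = w"
        then have "- (- emb x + emb y) \<in> Qt t" using that by (simp add: lt_def minus_add)
        then have "- emb x + emb y = 0" using Qt_antisym[OF t'] that by (simp add: lt_def)
        then have "emb x = emb y" by (metis add_0_right add_minus_cancel)
        then show False using that inj by (auto simp: lt_def)
      qed
      ultimately show ?thesis using that by (simp add: lt_def)
    qed
    have tot: "lt t x y \<or> lt t y x" if "x \<in> carrier G" "y \<in> carrier G" "x \<noteq> y" for x y
      using Qt_total[OF t' add_X[OF neg_X[OF lX[OF that(1)]] lX[OF that(2)]]] that
      by (auto simp: lt_def minus_add)
    have inv: "lt t (g \<otimes> x) (g \<otimes> y)" if "g \<in> carrier G" "lt t x y" for g x y
      using that by (auto simp: lt_def hom minus_add add.assoc)
    have car: "lt t x y \<Longrightarrow> x \<in> carrier G \<and> y \<in> carrier G" and irr: "\<not> lt t x x" for x y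
      by (simp_all add: lt_def)
    show ?thesis unfolding left_order_def
      by (intro conjI; use car irr tr tot inv in blast)
  qed
  have isol: "isolated_left_order G (lt t)" if t: "good t" for t
  proof -
    have t': "D c dvd int t" using t by (simp add: good_def)
    obtain S where S: "finite S" "Qt t = mgen S" using Qt_fin_gen[OF t'] by blast
    \<comment> \<open>The generators of the cone; \<open>0\<close> is dropped because the identity
      has no sign.\<close>
    define F where "F = {x \<in> carrier G. emb x \<in> S - {0}}"
    have "finite F"
    proof -
      have "inj_on emb F" using inj by (auto simp: inj_on_def F_def)
      moreover have "emb ` F \<subseteq> S" by (auto simp: F_def)
      ultimately show ?thesis using S(1) finite_subset finite_imageD by metis
    qed
    moreover have "F \<subseteq> carrier G - {\<one>}" by (auto simp: F_def l1)
    moreover have "lt' = lt t" if lo': "left_order G lt'" and agree: "\<forall>g\<in>F. lt t \<one> g \<longleftrightarrow> lt' \<one> g" for lt'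
    proof -
      have car: "lt' x y \<Longrightarrow> x \<in> carrier G \<and> y \<in> carrier G" for x y
        using lo' unfolding left_order_def by blast
      have irr: "\<not> lt' x x" for x using lo' unfolding left_order_def by blast
      have tr: "lt' x y \<Longrightarrow> lt' y w \<Longrightarrow> lt' x w" for x y w
        using lo' unfolding left_order_def by blast
      have inv: "g \<in> carrier G \<Longrightarrow> lt' x y \<Longrightarrow> lt' (g \<otimes> x) (g \<otimes> y)" for g x y
        using lo' unfolding left_order_def by blast
      \<comment> \<open>An order that agrees on the generators is positive on the whole cone. By
        totality it then has no room to differ elsewhere.\<close>
      have pos: "emb x = y \<Longrightarrow> x \<in> carrier G \<Longrightarrow> x = \<one> \<or> lt' \<one> x" if "y \<in> mgen S" for x y
        using that
      proof (induction arbitrary: x rule: mgen.induct)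
        case mgen_zero
        then show ?case using inj l1 by (metis G.one_closed)
      next
        case (mgen_step s y)
        have sX: "s \<in> X" "s \<in> Qt t" "y \<in> X"
          using mgen_incl[OF mgen_step(1)] mgen_step(2) S(2) by (auto simp: Qt_def)
        obtain a b where ab: "a \<in> carrier G" "emb a = s" "b \<in> carrier G" "emb b = y" using surj sX by metis
        have x: "x = a \<otimes> b" using mgen_step ab hom inj by (metis G.m_closed)
        have b: "b = \<one> \<or> lt' \<one> b" using mgen_step.IH ab by blast
        have a: "a = \<one> \<or> lt' \<one> a"
        proof (cases "s = 0")
          case True
          then show ?thesis using ab l1 inj by (metis G.one_closed)
        next
          case False
          then have "a \<in> F" using ab mgen_step by (simp add: F_def)
          moreover have "lt t \<one> a" using False ab l1 sX by (auto simp: lt_1)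
          ultimately show ?thesis using agree by blast
        qed
        show ?case
        proof (cases "b = \<one>")
          case True
          then show ?thesis using a x ab by simp
        next
          case False
          then have "lt' a x" using b inv[OF ab(1), of \<one> b] x ab by simp
          then show ?thesis using a tr by blast
        qed
      qed
      have sub: "lt' x y" if "lt t x y" for x y
      proof -
        have xy: "x \<in> carrier G" "y \<in> carrier G" "x \<noteq> y" "- emb x + emb y \<in> Qt t" using that by (auto simp: lt_def)
        have "emb x + emb (inv x \<otimes> y) = emb (x \<otimes> (inv x \<otimes> y))" using hom[of x "inv x \<otimes> y"] xy by simp
        also have "x \<otimes> (inv x \<otimes> y) = y" using xy by (simp flip: G.m_assoc)
        finally have "emb (inv x \<otimes> y) = - emb x + emb y" by (metis minus_add_cancel)
        then have "inv x \<otimes> y = \<one> \<or> lt' \<one> (inv x \<otimes> y)" using pos xy S(2) by auto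
        moreover have "inv x \<otimes> y \<noteq> \<one>"
        proof
          assume "inv x \<otimes> y = \<one>"
          then have "x \<otimes> (inv x \<otimes> y) = x" using xy by simp
          then show False using xy \<open>x \<otimes> (inv x \<otimes> y) = y\<close> by simp
        qed
        ultimately have "lt' (x \<otimes> \<one>) (x \<otimes> (inv x \<otimes> y))" using inv xy by blast
        then show ?thesis using xy \<open>x \<otimes> (inv x \<otimes> y) = y\<close> by simp
      qed
      have "lt' x y \<longleftrightarrow> lt t x y" for x y
      proof
        assume l: "lt' x y"
        then have "x \<in> carrier G" "y \<in> carrier G" "x \<noteq> y" using car irr by auto
        then have "lt t x y \<or> lt t y x" using lo[OF t] unfolding left_order_def by blast
        then show "lt t x y" using sub l tr irr by blast
      qed (rule sub)
      then show ?thesis by blast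
    qed
    ultimately show ?thesis unfolding isolated_left_order_def using lo[OF t] by blast
  qed
  \<comment> \<open>An automorphism carrying one order to another carries least positive elements to
    each other; this lemma identifies the image with \<open>ct t\<close>.\<close>
  have least_unique: "x = y" if t: "good t" and x: "x \<in> carrier G" "emb x = ct t"
    and y: "lt t \<one> y" "\<And>w. lt t \<one> w \<Longrightarrow> \<not> lt t w y" for t x y
  proof (rule ccontr)
    assume ne: "x \<noteq> y"
    have t': "D c dvd int t" using t by (simp add: good_def)
    have yc: "y \<in> carrier G" "y \<noteq> \<one>" "emb y \<in> Qt t" using y(1) by (auto simp: lt_1)
    have "emb y \<noteq> 0" using yc l1 inj by (metis G.one_closed)
    then have "lt t x y" using ct_least[OF t' yc(3)] x yc ne by (simp add: lt_def)
    moreover have "lt t \<one> x" using ct_Qt[OF t'] ct_nonzero[OF t'] x l1 by (auto simp: lt_1)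
    ultimately show False using y(2) by blast
  qed
  have deg_dvd': "deg t2 dvd deg t1"
    if t: "good t1" "good t2" and \<phi>: "\<phi> \<in> iso G G" and im: "lt t2 = aut_image G (lt t1) \<phi>" for t1 t2 \<phi>
  proof -
    have \<phi>b: "bij_betw \<phi> (carrier G) (carrier G)" and \<phi>h: "\<phi> \<in> hom G G"
      using \<phi> by (auto simp: iso_def)
    have \<phi>c: "x \<in> carrier G \<Longrightarrow> \<phi> x \<in> carrier G" for x using \<phi>b by (auto simp: bij_betw_def)
    have \<phi>s: "\<exists>x\<in>carrier G. \<phi> x = y" if "y \<in> carrier G" for y
      using bij_betw_imp_surj_on[OF \<phi>b] that by (metis imageE)
    have \<phi>m: "\<phi> (x \<otimes> y) = \<phi> x \<otimes> \<phi> y" if "x \<in> carrier G" "y \<in> carrier G" for x y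
      using \<phi>h that by (simp add: hom_mult)
    have \<phi>1: "\<phi> \<one> = \<one>" using \<phi>h by (metis G.is_group hom_one G)
    have t': "D c dvd int t2" "D c dvd int t1" using t by (auto simp: good_def)
    define li where "li = the_inv_into (carrier G) emb"
    have li: "li y \<in> carrier G" "emb (li y) = y" if "y \<in> X" for y
      using bij that unfolding li_def bij_betw_def
      by (auto intro: the_inv_into_into f_the_inv_into_f)
    have il: "li (emb x) = x" if "x \<in> carrier G" for x using li lX that inj by metis
    define f where "f y = emb (\<phi> (li y))" for y
    have f_add: "f (x + y) = f x + f y" if "x \<in> X" "y \<in> X" for x y
    proof -
      have "li (x + y) = li x \<otimes> li y"
        by (rule inj) (simp_all add: li that hom add_X)
      then show ?thesis using li that \<phi>m \<phi>c hom by (simp add: f_def)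
    qed
    have fX: "f ` X = X"
    proof (intro equalityI subsetI)
      fix y assume "y \<in> f ` X"
      then show "y \<in> X" using lX \<phi>c li by (auto simp: f_def)
    next
      fix y assume "y \<in> X"
      then obtain x where x: "x \<in> carrier G" "\<phi> x = li y" using \<phi>s li by metis
      then have "f (emb x) = y" using il li \<open>y \<in> X\<close> by (simp add: f_def)
      then show "y \<in> f ` X" using lX x by blast
    qed
    define x1 x2 where "x1 = li (ct t1)" and "x2 = li (ct t2)"
    have x1: "x1 \<in> carrier G" "emb x1 = ct t1" and x2: "x2 \<in> carrier G" "emb x2 = ct t2"
      using li ct_X by (auto simp: x1_def x2_def)
    have im': "lt t2 x y \<longleftrightarrow> lt t1 (\<phi> x) (\<phi> y)" if "x \<in> carrier G" "y \<in> carrier G" for x y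
      using im that by (simp add: aut_image_def)
    have "x1 = \<phi> x2"
    proof (rule least_unique[OF t(1) x1])
      have "lt t2 \<one> x2" using ct_Qt[OF t'(1)] ct_nonzero[OF t'(1)] x2 l1 by (auto simp: lt_1)
      then show "lt t1 \<one> (\<phi> x2)" using im'[of \<one> x2] x2 \<phi>1 by simp
    next
      fix w assume w: "lt t1 \<one> w"
      then have "w \<in> carrier G" by (simp add: lt_def)
      then obtain v where v: "v \<in> carrier G" "\<phi> v = w" using \<phi>s by blast
      then have 1: "lt t2 \<one> v" using w im'[of \<one> v] \<phi>1 by simp
      show "\<not> lt t1 w (\<phi> x2)"
      proof
        assume "lt t1 w (\<phi> x2)"
        then have vx: "lt t2 v x2" using im'[of v x2] v x2 by simp
        have "emb v \<in> Qt t2" "emb v \<noteq> 0" using 1 inj l1 by (auto simp: lt_1)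
        then have "- ct t2 + emb v \<in> Qt t2" using ct_least[OF t'(1)] by blast
        then have "- (- emb v + emb x2) \<in> Qt t2" using x2 by (simp add: minus_add)
        moreover have "- emb v + emb x2 \<in> Qt t2" "v \<noteq> x2" using vx by (auto simp: lt_def)
        ultimately have "- emb v + emb x2 = 0" using Qt_antisym[OF t'(1)] by blast
        then have "emb x2 = emb v" by (metis add_0_right add_minus_cancel)
        then show False using inj v x2 \<open>v \<noteq> x2\<close> by metis
      qed
    qed
    then have "f (ct t2) = ct t1" using x1 by (simp add: f_def x2_def)
    then show ?thesis using deg_dvd[OF t'(1) f_add fX] by blast
  qed
  have deg_eq: "t1 = t2"
    if t: "good t1" "good t2" and \<phi>: "\<phi> \<in> iso G G" and im: "lt t2 = aut_image G (lt t1) \<phi>" for t1 t2 \<phi>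
  proof -
    define \<psi> where "\<psi> = inv_into (carrier G) \<phi>"
    have \<psi>: "\<psi> \<in> iso G G" unfolding \<psi>_def using G.iso_set_sym[OF \<phi>] .
    have \<phi>b: "bij_betw \<phi> (carrier G) (carrier G)" using \<phi> by (auto simp: iso_def)
    have \<psi>c: "\<psi> x \<in> carrier G" "\<phi> (\<psi> x) = x" if "x \<in> carrier G" for x
      using \<phi>b that unfolding \<psi>_def bij_betw_def by (auto intro: inv_into_into f_inv_into_f)
    have "lt t1 = aut_image G (lt t2) \<psi>"
    proof (intro ext)
      fix x y
      show "lt t1 x y = aut_image G (lt t2) \<psi> x y"
      proof (cases "x \<in> carrier G \<and> y \<in> carrier G")
        case True
        then show ?thesis using \<psi>c[of x] \<psi>c[of y] by (simp add: im aut_image_def)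
      next
        case False
        then have "\<not> lt t1 x y" by (auto simp: lt_def)
        then show ?thesis using False by (auto simp: aut_image_def)
      qed
    qed
    then have "deg t1 dvd deg t2" using deg_dvd'[OF t(2,1) \<psi>] by blast
    moreover have "deg t2 dvd deg t1" using deg_dvd'[OF t \<phi> im] .
    ultimately have "deg t1 = deg t2" by (rule dvd_antisym)
    then show ?thesis using N_pos by (simp add: deg_def)
  qed
  \<comment> \<open>Multiples of \<open>D c\<close> are the admissible parameters, and distinct ones
    have distinct degrees.\<close>
  define s where "s i = nat \<bar>D c\<bar> * i" for i :: nat
  have good_s: "good (s i)" for i by (simp add: good_def s_def)
  have inj_s: "s i = s j \<Longrightarrow> i = j" for i j using D_c by (simp add: s_def)
  have idG: "(\<lambda>x. x) \<in> iso G G" by (auto simp: iso_def hom_def bij_betw_def)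
  have "inj (\<lambda>i. lt (s i))"
  proof (rule injI)
    fix i j assume "lt (s i) = lt (s j)"
    then have "lt (s j) = aut_image G (lt (s i)) (\<lambda>x. x)" by (auto simp: aut_image_def fun_eq_iff lt_def)
    then show "i = j" using deg_eq[OF good_s good_s idG] inj_s by blast
  qed
  then have "infinite (range (\<lambda>i. lt (s i)))" by (rule range_inj_infinite)
  moreover have "range (\<lambda>i. lt (s i)) \<subseteq> {lt. isolated_left_order G lt}" using isol good_s by auto
  moreover have "countable (range (\<lambda>i. lt (s i)))" by simp
  moreover have "\<forall>l1\<in>range (\<lambda>i. lt (s i)). \<forall>l2\<in>range (\<lambda>i. lt (s i)). l1 \<noteq> l2 \<longrightarrow>
      \<not> (\<exists>\<phi>\<in>iso G G. l2 = aut_image G l1 \<phi>)"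
  proof (intro ballI impI notI)
    fix l1 l2 assume "l1 \<in> range (\<lambda>i. lt (s i))" "l2 \<in> range (\<lambda>i. lt (s i))" and ne: "l1 \<noteq> l2"
      and ex: "\<exists>\<phi>\<in>iso G G. l2 = aut_image G l1 \<phi>"
    then obtain i j where ij: "l1 = lt (s i)" "l2 = lt (s j)" by blast
    obtain \<phi> where \<phi>: "\<phi> \<in> iso G G" "l2 = aut_image G l1 \<phi>" using ex by blast
    then have "lt (s j) = aut_image G (lt (s i)) \<phi>" using ij by simp
    then have "s i = s j" by (rule deg_eq[OF good_s good_s \<phi>(1)])
    then show False using ne ij by simp
  qed
  ultimately show ?thesis by blast
qed

end

section \<open>Cones acting on the line\<close>

text \<open>Bijections under composition as a \<open>group_add\<close> type. It serves twice: for
  homeomorphisms of the line, and as the ambient group that receives the presented group by left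
  multiplication.\<close>

typedef 'a bperm = "{f :: 'a \<Rightarrow> 'a. bij f}" morphisms papp Bperm
  by (rule exI[of _ id]) simp

lemma bij_papp: "bij (papp f)" using papp by blast

lemma papp_Bperm: "bij f \<Longrightarrow> papp (Bperm f) = f" by (simp add: Bperm_inverse)

lemma bperm_eqI: "(\<And>x. papp f x = papp g x) \<Longrightarrow> f = g"
  by (metis ext papp_inject)

instantiation bperm :: (type) group_add
begin

definition "0 = Bperm id"
definition "f + g = Bperm (papp f \<circ> papp g)"
definition "- f = Bperm (inv_into UNIV (papp f))"
definition "f - g = f + - (g :: 'a bperm)"

lemma papp_simps [simp]:
  "papp 0 x = x" "papp (f + g) x = papp f (papp g x)" "papp (- f) x = inv_into UNIV (papp f) x"
  by (simp_all add: zero_bperm_def plus_bperm_def uminus_bperm_def papp_Bperm bij_comp bij_papp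
    bij_imp_bij_inv)

instance
proof
  fix f g h :: "'a bperm"
  show "f + g + h = f + (g + h)" "0 + f = f" "f + 0 = f" by (rule bperm_eqI, simp)+
  show "- f + f = 0" by (rule bperm_eqI) (simp add: bij_is_inj[OF bij_papp])
  show "f + - g = f - g" by (simp add: minus_bperm_def)
qed

end

lemma papp_neg_cancel: "papp f (papp (- f) x) = x" "papp (- f) (papp f x) = x"
  by (simp_all add: bij_is_inj[OF bij_papp] bij_is_surj[OF bij_papp] surj_f_inv_f)

definition translation :: "real \<Rightarrow> real bperm" where
  "translation a = Bperm (\<lambda>x. x + a)"

lemma papp_translation [simp]: "papp (translation a) x = x + a"
proof -
  have "bij (\<lambda>x::real. x + a)" by (rule bij_betw_byWitness[where f' = "\<lambda>x. x - a"]) auto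
  then show ?thesis by (simp add: translation_def papp_Bperm)
qed

lemma translation_add: "translation a + translation b = translation (a + b)"
  by (rule bperm_eqI) simp

lemma translation_0: "translation 0 = 0"
  by (rule bperm_eqI) simp

lemma imul_translation: "imul (int n) (translation a) = translation (real n * a)"
proof (induction n)
  case (Suc n)
  have "imul (int (Suc n)) (translation a) = imul (int n) (translation a) + translation a"
    using imul_succ'[of "int n" "translation a"] by (simp add: add.commute)
  with Suc show ?case by (simp add: translation_add distrib_right add.commute)
qed (simp add: translation_0)

lemma neg_translation: "- translation a = translation (- a)"
  using minus_unique[of "translation a" "translation (- a)"] by (simp add: translation_add translation_0)

lemma strict_mono_neg:
  fixes f :: "real bperm"
  assumes "strict_mono (papp f)"
  shows "strict_mono (papp (- f))"
proof (rule strict_monoI)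
  fix x y :: real assume "x < y"
  then have "papp f (papp (- f) x) < papp f (papp (- f) y)" by (simp only: papp_neg_cancel)
  then show "papp (- f) x < papp (- f) y" using strict_mono_less[OF assms] by blast
qed

lemma strict_mono_add:
  fixes f g :: "real bperm"
  shows "strict_mono (papp f) \<Longrightarrow> strict_mono (papp g) \<Longrightarrow> strict_mono (papp (f + g))"
  by (simp add: strict_mono_def)

lemma strict_mono_translation: "strict_mono (papp (translation a))"
  by (simp add: strict_mono_def)

text \<open>On each unit interval the fractional part is raised to the power
  \<open>b = ln s / ln r\<close>, the exponent for which \<open>r powr b = s\<close>; the exponent
  \<open>1 / b\<close> gives the inverse.\<close>

lemma periodic_homeo:
  fixes r s :: real
  assumes r: "0 < r" "r < 1" and s: "0 < s" "s < 1"
  shows "\<exists>P :: real bperm. strict_mono (papp P) \<and> (\<forall>x. papp P (x + 1) = papp P x + 1)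
    \<and> papp P 0 = 0 \<and> papp P r = s"
proof -
  define g where "g b x = of_int \<lfloor>x\<rfloor> + frac x powr b" for b x :: real
  have fl: "\<lfloor>g b x\<rfloor> = \<lfloor>x\<rfloor> \<and> frac (g b x) = frac x powr b" if "b > 0" for b x
  proof -
    have "0 \<le> frac x powr b" by simp
    moreover have "frac x powr b < 1"
    proof (cases "frac x = 0")
      case False
      then have "0 < frac x" "frac x < 1" using frac_ge_0[of x] frac_lt_1[of x] by linarith+
      then have "frac x powr b < 1 powr b" using that by (intro powr_less_mono2) auto
      then show ?thesis by simp
    qed (simp only: powr_0 zero_less_one)
    ultimately have "\<lfloor>g b x\<rfloor> = \<lfloor>x\<rfloor>" unfolding g_def by (simp add: floor_unique)
    then show ?thesis by (simp add: frac_def g_def)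
  qed
  have inv: "g a (g b x) = x" if "a > 0" "b > 0" "a * b = 1" for a b x
  proof -
    have "(frac x powr b) powr a = frac x" using that frac_ge_0[of x]
      by (cases "frac x = 0") (simp_all add: powr_powr mult.commute)
    then have "g a (g b x) = of_int \<lfloor>x\<rfloor> + frac x" using fl[OF that(2), of x] by (simp add: g_def)
    then show ?thesis by (simp add: frac_def)
  qed
  define b where "b = ln s / ln r"
  have b: "b > 0" using r s by (simp add: b_def divide_neg_neg)
  have bij: "bij (g b)"
    by (rule bij_betw_byWitness[where f' = "g (1 / b)"]) (use b inv[of "1 / b" b] inv[of b "1 / b"] in auto)
  have mono: "g b x < g b y" if "x < y" for x y
  proof (cases "\<lfloor>x\<rfloor> = \<lfloor>y\<rfloor>")
    case True
    then have "frac x < frac y" using that by (simp add: frac_def)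
    then have "frac x powr b < frac y powr b" using b by (intro powr_less_mono2) auto
    then show ?thesis using True by (simp add: g_def)
  next
    case False
    then have "\<lfloor>x\<rfloor> < \<lfloor>y\<rfloor>" using that floor_mono[of x y] by simp
    then have "\<lfloor>g b x\<rfloor> < \<lfloor>g b y\<rfloor>" using fl[OF b] by simp
    then show ?thesis by (metis floor_less_cancel)
  qed
  have per: "g b (x + 1) = g b x + 1" for x
    by (simp add: g_def frac_1_eq)
  have "frac r = r" "\<lfloor>r\<rfloor> = 0" using r by (simp_all add: frac_eq floor_eq_iff)
  then have "g b r = r powr b" by (simp add: g_def)
  also have "\<dots> = s" using r s by (simp add: b_def powr_def)
  finally have "g b r = s" .
  then show ?thesis using bij mono per b
    by (intro exI[of _ "Bperm (g b)"]) (auto simp: papp_Bperm strict_mono_def g_def)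
qed

text \<open>Conjugating translation by \<open>1 / m\<close> with a map that commutes with
  translation by \<open>1\<close> gives an \<open>m\<close>-th root of the latter. The conjugator
  \<open>W\<close> sends \<open>0\<close> to \<open>v\<close> and \<open>1 / m\<close> to
  \<open>u\<close>.\<close>

lemma root_of_translation:
  fixes u v :: real
  assumes "m \<ge> 2" and uv: "v < u" "u < v + 1"
  shows "\<exists>F :: real bperm. strict_mono (papp F) \<and> imul (int m) F = translation 1 \<and> papp F v = u"
proof -
  have "0 < 1 / real m" "1 / real m < 1" using assms by auto
  then obtain P :: "real bperm" where P: "strict_mono (papp P)" "\<And>x. papp P (x + 1) = papp P x + 1"
    "papp P 0 = 0" "papp P (1 / real m) = u - v"
    using periodic_homeo[of "1 / real m" "u - v"] uv by auto
  define W where "W = translation v + P"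
  define F where "F = W + translation (1 / real m) + - W"
  have com: "W + translation 1 = translation 1 + W" by (rule bperm_eqI) (simp add: W_def P)
  have "imul (int m) F = W + translation 1 + - W"
    using assms by (simp add: F_def imul_conj imul_translation)
  also have "\<dots> = translation 1" by (simp add: com add.assoc)
  finally have 1: "imul (int m) F = translation 1" .
  have W: "strict_mono (papp W)" unfolding W_def by (intro strict_mono_add strict_mono_translation P)
  have 2: "strict_mono (papp F)"
    unfolding F_def by (intro strict_mono_add strict_mono_translation strict_mono_neg W)
  have "papp W 0 = v" by (simp add: W_def P)
  then have "papp (- W) v = 0" using papp_neg_cancel(2)[of W 0] by simp
  then have "papp F v = papp W (1 / real m)" by (simp add: F_def del: papp_simps(3))
  also have "\<dots> = u" by (simp add: W_def P)
  finally show ?thesis using 1 2 by blast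
qed

text \<open>Wreath product with the group of order two, \<open>wflip\<close> marking the nontrivial
  coset. The square of \<open>Wr a b True\<close> is \<open>Wr (a + b) (b + a) False\<close>, which
  makes room for square roots of \<open>z\<close>.\<close>

datatype 'a wreath = Wr (wfst: 'a) (wsnd: 'a) (wflip: bool)

instantiation wreath :: (group_add) group_add
begin

definition "0 = Wr 0 0 False"
fun plus_wreath where
  "Wr a b s + Wr a' b' s' = (if s then Wr (a + b') (b + a') (\<not> s') else Wr (a + a') (b + b') s')"
fun uminus_wreath where
  "- Wr a b s = (if s then Wr (- b) (- a) True else Wr (- a) (- b) False)"
definition "x - y = x + - (y :: 'a wreath)"

instance
proof
  fix x y w :: "'a wreath"
  show "x + y + w = x + (y + w)" by (cases x; cases y; cases w) (auto simp: add.assoc)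
  show "0 + x = x" "x + 0 = x" by (cases x; auto simp: zero_wreath_def)+
  show "- x + x = 0" by (cases x) (auto simp: zero_wreath_def)
  show "x + - y = x - y" by (simp add: minus_wreath_def)
qed

end

text \<open>The \<open>j\<close>-th factor will act by a map sending \<open>base_pt (j + 1)\<close> to \<open>base_pt j + 1\<close>.  Then
  \<open>e\<^sub>1 z\<^sup>-\<^sup>1 e\<^sub>2 z\<^sup>-\<^sup>1 \<dots> e\<^sub>r\<close> sends \<open>base_pt (r + 1) < 0\<close> to \<open>base_pt 1 + 1 = 0\<close>.\<close>

definition base_pt :: "nat \<Rightarrow> real" where
  "base_pt j = - (1 / real j)"

locale line_action =
  fixes z :: "'a::group_add" and Y :: "'a set" and \<rho> :: "'a \<Rightarrow> real bperm \<times> int" and N :: int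
  assumes zero_Y: "0 \<in> Y" and add_Y: "x \<in> Y \<Longrightarrow> y \<in> Y \<Longrightarrow> x + y \<in> Y"
    and neg_Y: "x \<in> Y \<Longrightarrow> - x \<in> Y"
    and rho_add: "x \<in> Y \<Longrightarrow> y \<in> Y \<Longrightarrow> \<rho> (x + y) = \<rho> x + \<rho> y"
    and rho_mono: "x \<in> Y \<Longrightarrow> strict_mono (papp (fst (\<rho> x)))"
    and z_Y: "z \<in> Y" and rho_z: "\<rho> z = (translation 1, N)"
    and central_Y: "x \<in> Y \<Longrightarrow> x + z = z + x"
begin

abbreviation act :: "'a \<Rightarrow> real \<Rightarrow> real" where
  "act x \<equiv> papp (fst (\<rho> x))"

lemma rho_imul: "x \<in> Y \<Longrightarrow> imul i x \<in> Y \<and> \<rho> (imul i x) = imul i (\<rho> x)"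
  by (rule imul_hom) (auto simp: rho_add add_Y neg_Y zero_Y)

lemma rho_0: "\<rho> 0 = 0" using rho_imul[OF zero_Y, of 0] by simp

lemma rho_neg: "x \<in> Y \<Longrightarrow> \<rho> (- x) = - \<rho> x"
  using rho_imul[of x "- 1"] by (simp add: imul_minus)

lemma act_add: "x \<in> Y \<Longrightarrow> y \<in> Y \<Longrightarrow> act (x + y) t = act x (act y t)"
  by (simp add: rho_add)

lemma act_le: "x \<in> Y \<Longrightarrow> s \<le> t \<Longrightarrow> act x s \<le> act x t"
  using rho_mono strict_mono_less_eq by blast

lemma mgen_nonneg:
  assumes S: "S \<subseteq> Y" "\<And>s. s \<in> S \<Longrightarrow> 0 \<le> act s 0" and x: "x \<in> mgen S"
  shows "x \<in> Y \<and> 0 \<le> act x 0"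
  using x
proof (induction rule: mgen.induct)
  case mgen_zero
  show ?case by (simp add: rho_0 zero_Y)
next
  case (mgen_step s x)
  then have "s \<in> Y" "0 \<le> act s 0" using S by auto
  then show ?case using mgen_step act_le[of s 0 "act x 0"] by (auto simp: act_add add_Y)
qed

text \<open>\<open>r\<close> is the position on the list of base points. That \<open>c\<close> sends
  the negative point \<open>base_pt (Suc r)\<close> to a nonnegative one gives
  \<open>0 < act c 0\<close> with enough margin for the next factor.\<close>

definition good :: "nat \<Rightarrow> 'a set \<Rightarrow> 'a set \<Rightarrow> 'a \<Rightarrow> bool" where
  "good r A Q c \<longleftrightarrow> cone z A Q c N \<and> A \<subseteq> Y \<and> (\<forall>q\<in>Q. 0 \<le> act q 0) \<and> 0 \<le> act c (base_pt (Suc r))"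

lemma good_act_c: "good r A Q c \<Longrightarrow> 0 < act c 0"
proof -
  assume g: "good r A Q c"
  then interpret cone z A Q c N by (simp add: good_def)
  have "c \<in> Y" using g c_X by (auto simp: good_def)
  then have "act c (base_pt (Suc r)) < act c 0" using rho_mono by (simp add: strict_mono_def base_pt_def)
  then show ?thesis using g by (simp add: good_def)
qed

text \<open>A nonzero \<open>q\<close> positive together with \<open>- q\<close> would make
  \<open>- c\<close> positive. Then \<open>- c\<close> would not move \<open>0\<close> to the left,
  while \<open>c\<close> moves \<open>0\<close> strictly to the right.\<close>

lemma good_antisym:
  assumes g: "good r A Q c" and q: "q \<in> Q" "- q \<in> Q"
  shows "q = 0"
proof (rule ccontr)
  interpret cone z A Q c N using g by (simp add: good_def)
  assume "q \<noteq> 0"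
  then have "(- c + q) + - q \<in> Q" using least_left add_Q q by blast
  then have "- c \<in> Q" by (simp add: add.assoc)
  then have *: "0 \<le> act (- c) 0" using g by (simp add: good_def)
  have cY: "c \<in> Y" using g c_X by (auto simp: good_def)
  have "act c 0 \<le> act c (act (- c) 0)" using act_le[OF cY *] .
  also have "\<dots> = act (c + - c) 0" using act_add[OF cY neg_Y[OF cY]] by simp
  also have "\<dots> = 0" by (simp add: rho_0)
  finally show False using good_act_c[OF g] by simp
qed

lemma good_start:
  assumes e: "e \<in> Y" "imul (int m) e = z" "m \<ge> 2" "int m dvd N" "r \<ge> 1"
    and node: "act e (base_pt (Suc r)) = base_pt r + 1"
  shows "good r (range (\<lambda>i. imul i e)) (mgen {e}) e"
proof -
  have ge: "0 \<le> act e (base_pt (Suc r))" using e(5) unfolding node by (simp add: base_pt_def)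
  also have "\<dots> \<le> act e 0" by (rule act_le[OF e(1)]) (simp add: base_pt_def)
  finally have "0 \<le> act e 0" .
  then have "0 \<le> act q 0" if "q \<in> mgen {e}" for q using mgen_nonneg[of "{e}" q] e(1) that by auto
  then show ?thesis using cyclic_cone[OF e(3,4), of e] e(1,2) ge rho_imul by (auto simp: good_def)
qed

lemma good_step:
  assumes g: "good r A QA cA"
    and e: "e \<in> Y" "imul (int m) e = z" "m \<ge> 2" "int m dvd N"
    and node: "act e (base_pt (Suc (Suc r))) = base_pt (Suc r) + 1"
  shows "\<exists>X Q. good (Suc r) X Q (cA + (- z + e)) \<and> A \<subseteq> X \<and> e \<in> X
    \<and> (\<forall>j::nat. - imul (int j) (cA + (- z + e)) + z \<in> Q)
    \<and> (\<forall>x\<in>X. (\<forall>y\<in>X. x + y = y + x) \<longrightarrow> (\<exists>i. x = imul i z))"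
proof -
  have ge: "good (Suc r) (range (\<lambda>i. imul i e)) (mgen {e}) e"
    using good_start[OF e _ node] by simp
  interpret am: amalgam z A QA cA "range (\<lambda>i. imul i e)" "mgen {e}" e N
    using g ge by (auto simp: amalgam_def good_def)
  have AY: "A \<subseteq> Y" "range (\<lambda>i. imul i e) \<subseteq> Y" using g ge by (auto simp: good_def)
  have cAY: "cA \<in> Y" using AY am.A.c_X by blast
  have zn: "act (- z) t = t - 1" for t
    by (simp add: rho_neg z_Y rho_z neg_translation del: papp_simps(3))
  have cY: "am.c \<in> Y" unfolding am.c_def using cAY e(1) z_Y by (intro add_Y neg_Y)
  have actc: "act am.c t = act cA (act e t - 1)" for t
    unfolding am.c_def using cAY e(1) z_Y
    by (simp add: act_add add_Y neg_Y zn del: papp_simps(3))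
  \<comment> \<open>\<open>e\<close> sends \<open>base_pt (r + 2)\<close> to
    \<open>base_pt (r + 1) + 1\<close>, \<open>- z\<close> removes the \<open>1\<close>, and
    \<open>cA\<close> sends the result to a nonnegative point.\<close>
  have node': "0 \<le> act am.c (base_pt (Suc (Suc r)))"
    unfolding actc node using g by (simp add: good_def)
  have "act am.c (base_pt (Suc (Suc r))) \<le> act am.c 0"
    by (rule act_le[OF cY]) (simp add: base_pt_def)
  then have c0: "0 \<le> act am.c 0" using node' by simp
  have gens: "QA \<union> mgen {e} \<union> {am.c} \<subseteq> Y" using AY am.A.Q_X am.B.Q_X cY by blast
  have "0 \<le> act q 0" if "q \<in> am.Q" for q
  proof -
    have "0 \<le> act s 0" if "s \<in> QA \<union> mgen {e} \<union> {am.c}" for s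
      using that g ge c0 by (auto simp: good_def)
    then show ?thesis using mgen_nonneg[OF gens] that unfolding am.Q_def by blast
  qed
  moreover have "am.X \<subseteq> Y" unfolding am.X_def using AY by (intro mgen_least) (auto intro: add_Y zero_Y)
  ultimately have good: "good (Suc r) am.X am.Q am.c" using am.cone node' by (simp add: good_def)
  have "e \<in> range (\<lambda>i. imul i e)" by (rule range_eqI[of _ _ 1]) simp
  then have eX: "e \<in> am.X" by (rule am.B_X)
  have cne: "am.c \<noteq> 0" using good_act_c[OF good] rho_0 by (intro notI) simp
  have "\<exists>i. x = imul i z" if "x \<in> am.X" "\<forall>y\<in>am.X. x + y = y + x" for x
    using am.center_multiple[OF good_antisym[OF good] cne that(1)] that(2) by blast
  then show ?thesis using good am.A_X eX am.imul_c_below_z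
    by (intro exI[of _ am.X] exI[of _ am.Q]) (auto simp: am.c_def)
qed

fun iter_c :: "'a \<Rightarrow> (nat \<Rightarrow> 'a) \<Rightarrow> nat \<Rightarrow> 'a" where
  "iter_c c e 0 = c"
| "iter_c c e (Suc k) = iter_c c e k + (- z + e k)"

lemma good_chain:
  assumes g: "good r A QA cA"
    and e: "\<And>i. i < k \<Longrightarrow> e i \<in> Y \<and> imul (int (m i)) (e i) = z \<and> m i \<ge> 2 \<and> int (m i) dvd N \<and>
      act (e i) (base_pt (Suc (Suc (r + i)))) = base_pt (Suc (r + i)) + 1"
  shows "\<exists>X Q. good (r + k) X Q (iter_c cA e k) \<and> A \<subseteq> X \<and> (\<forall>i<k. e i \<in> X) \<and>
    (k > 0 \<longrightarrow> (\<forall>j::nat. - imul (int j) (iter_c cA e k) + z \<in> Q)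
    \<and> (\<forall>x\<in>X. (\<forall>y\<in>X. x + y = y + x) \<longrightarrow> (\<exists>i. x = imul i z)))"
  using e
proof (induction k)
  case 0
  then show ?case using g by auto
next
  case (Suc k)
  then obtain X Q where X: "good (r + k) X Q (iter_c cA e k)" "A \<subseteq> X" "\<forall>i<k. e i \<in> X" by fastforce
  have ek: "e k \<in> Y" "imul (int (m k)) (e k) = z" "m k \<ge> 2" "int (m k) dvd N"
    "act (e k) (base_pt (Suc (Suc (r + k)))) = base_pt (Suc (r + k)) + 1"
    using Suc.prems[of k] by auto
  obtain X' Q' where X': "good (Suc (r + k)) X' Q' (iter_c cA e (Suc k))" "X \<subseteq> X'" "e k \<in> X'"
    "\<forall>j::nat. - imul (int j) (iter_c cA e (Suc k)) + z \<in> Q'"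
    "\<forall>x\<in>X'. (\<forall>y\<in>X'. x + y = y + x) \<longrightarrow> (\<exists>i. x = imul i z)"
    using good_step[OF X(1) ek] by auto
  then have "\<forall>i<Suc k. e i \<in> X'" using X(3) less_Suc_eq by auto
  then show ?case using X' X(2) by (intro exI[of _ X'] exI[of _ Q']) auto
qed

end

section \<open>The free factor\<close>

lemma wfst_add: "\<not> wflip x \<Longrightarrow> wfst (x + y) = wfst x + wfst y"
  by (cases x; cases y) auto

lemma wflip_add: "wflip (x + y) \<longleftrightarrow> wflip x \<noteq> wflip y"
  by (cases x; cases y) auto

lemma wflip_neg: "wflip (- x) = wflip x"
  by (cases x) auto

context line_action
begin

text \<open>The free factor. Inside the wreath product with \<open>\<int>/2\<close>, the elements \<open>e i\<close> below are square
  roots of \<open>z\<close> with \<open>e 0 + e i = h i\<close>, so that \<open>\<langle>h, z\<rangle>\<close> is the even subgroup of an amalgam of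
  infinite cyclic groups: an orbifold with cone points of order 2, doubly covered by a surface.\<close>

lemma good_genus:
  fixes h :: "nat \<Rightarrow> 'a" and E :: "nat \<Rightarrow> real bperm \<times> int"
  assumes n: "n \<ge> 1" and h0: "h 0 = z"
    and h: "\<And>i. i \<le> 2 * n \<Longrightarrow> h i \<in> Y \<and> \<rho> (h i) = E 0 + E i"
    and E: "\<And>i. i \<le> 2 * n \<Longrightarrow> imul 2 (E i) = \<rho> z \<and> strict_mono (papp (fst (E i))) \<and>
      papp (fst (E i)) (base_pt (Suc (Suc i))) = base_pt (Suc i) + 1"
  shows "\<exists>A Q c. good (2 * n + 1) A Q c \<and> (\<forall>i\<le>2 * n. h i \<in> A) \<and> snd (\<rho> c) = N * (1 - 2 * int n)"
proof -
  have two: "imul 2 x = x + x" for x :: "'b::group_add"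
    using imul_add[of 1 1 x] by simp
  have EE: "E i + E i = \<rho> z" if "i \<le> 2 * n" for i using E[OF that] two[of "E i"] by simp
  \<comment> \<open>An element \<open>x\<close> of the intended overgroup is coded by its action on
    the cosets of \<open>0\<close> and \<open>e 0\<close>: with \<open>s\<close> its parity,
    \<open>x = a + s e 0\<close> and \<open>e 0 + x = b + (1 - s) e 0\<close>. The map
    \<open>\<rho>2\<close> reads the first equation; the condition in \<open>Y2\<close> expresses
    the second.\<close>
  define \<rho>2 :: "'a wreath \<Rightarrow> real bperm \<times> int" where
    "\<rho>2 x = \<rho> (wfst x) + (if wflip x then E 0 else 0)" for x
  define Y2 where "Y2 = {x. wfst x \<in> Y \<and> wsnd x \<in> Y \<and>
    E 0 + \<rho>2 x = \<rho> (wsnd x) + (if wflip x then 0 else E 0)}"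
  define z2 where "z2 = Wr z z False"
  have Y2_add: "x + y \<in> Y2 \<and> \<rho>2 (x + y) = \<rho>2 x + \<rho>2 y" if x: "x \<in> Y2" and y: "y \<in> Y2" for x y
  proof -
    obtain a b s where xe: "x = Wr a b s" by (cases x)
    obtain a' b' s' where ye: "y = Wr a' b' s'" by (cases y)
    have Ys: "a \<in> Y" "b \<in> Y" "a' \<in> Y" "b' \<in> Y" using x y by (auto simp: Y2_def xe ye)
    have ex: "E 0 + \<rho>2 x = \<rho> b + (if s then 0 else E 0)" using x by (simp add: Y2_def xe)
    have ey: "E 0 + \<rho>2 y = \<rho> b' + (if s' then 0 else E 0)" using y by (simp add: Y2_def ye)
    have add: "\<rho>2 (x + y) = \<rho>2 x + \<rho>2 y"
    proof (cases s)
      case False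
      then show ?thesis using Ys by (auto simp: \<rho>2_def xe ye rho_add add.assoc)
    next
      case True
      have "\<rho>2 x + \<rho>2 y = \<rho> a + (E 0 + \<rho>2 y)" using True by (simp add: \<rho>2_def xe add.assoc)
      also have "\<dots> = \<rho> a + (\<rho> b' + (if s' then 0 else E 0))" by (simp only: ey)
      also have "\<dots> = \<rho>2 (x + y)" using True Ys by (simp add: \<rho>2_def xe ye rho_add add.assoc)
      finally show ?thesis by simp
    qed
    have "E 0 + \<rho>2 (x + y) = \<rho> b + ((if s then 0 else E 0) + \<rho>2 y)"
      unfolding add using ex by (metis add.assoc)
    also have "\<dots> = \<rho> (wsnd (x + y)) + (if wflip (x + y) then 0 else E 0)"
    proof (cases s)
      case True
      then show ?thesis using Ys by (simp add: \<rho>2_def xe ye rho_add add.assoc)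
    next
      case False
      then show ?thesis using Ys ey by (simp add: xe ye rho_add add.assoc)
    qed
    finally show ?thesis using add Ys by (auto simp: Y2_def xe ye add_Y)
  qed
  have Y2_0: "0 \<in> Y2" by (simp add: Y2_def \<rho>2_def zero_wreath_def zero_Y rho_0)
  have Y2_neg: "- x \<in> Y2" if x: "x \<in> Y2" for x
  proof -
    obtain a b s where xe: "x = Wr a b s" by (cases x)
    have Ys: "a \<in> Y" "b \<in> Y" using x by (auto simp: Y2_def xe)
    have ex: "E 0 + (\<rho> a + (if s then E 0 else 0)) = \<rho> b + (if s then 0 else E 0)"
      using x by (simp add: Y2_def xe \<rho>2_def)
    show ?thesis
    proof (cases s)
      case True
      then have "\<rho> b = E 0 + (\<rho> a + E 0)" using ex by simp
      then show ?thesis using True Ys by (simp add: Y2_def xe \<rho>2_def neg_Y rho_neg minus_add add.assoc)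
    next
      case False
      then have "E 0 + \<rho> a = \<rho> b + E 0" using ex by simp
      then have "- \<rho> b + (E 0 + \<rho> a) + - \<rho> a = - \<rho> b + (\<rho> b + E 0) + - \<rho> a" by simp
      then have "- \<rho> b + E 0 = E 0 + - \<rho> a" by (simp add: add.assoc)
      then show ?thesis using False Ys by (simp add: Y2_def xe \<rho>2_def neg_Y rho_neg)
    qed
  qed
  have Ez: "E 0 + \<rho> z = \<rho> z + E 0" using EE[of 0] by (metis add.assoc le0)
  interpret W: line_action z2 Y2 \<rho>2 N
  proof
    show "z2 \<in> Y2" using Ez by (simp add: z2_def Y2_def \<rho>2_def z_Y)
    show "\<rho>2 z2 = (translation 1, N)" by (simp add: z2_def \<rho>2_def rho_z)
    show "x + z2 = z2 + x" if "x \<in> Y2" for x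
      using that by (cases x) (auto simp: z2_def Y2_def central_Y)
    show "strict_mono (papp (fst (\<rho>2 x)))" if "x \<in> Y2" for x
      using that rho_mono E[of 0] by (auto simp: \<rho>2_def Y2_def intro!: strict_mono_add)
  qed (use Y2_0 Y2_neg Y2_add in auto)
  \<comment> \<open>In the overgroup \<open>e i - e 0\<close> is \<open>z - h i\<close> and
    \<open>e 0 + e i\<close> is \<open>h i\<close>, which gives the two coordinates.\<close>
  define e where "e i = Wr (z + - h i) (h i) True" for i
  have e: "e i \<in> Y2" "\<rho>2 (e i) = E i" "imul (int 2) (e i) = z2" if i: "i \<le> 2 * n" for i
  proof -
    have hi: "h i \<in> Y" "\<rho> (h i) = E 0 + E i" using h i by auto
    have "\<rho>2 (e i) = \<rho> z + (- E i + (- E 0 + E 0))"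
      using hi by (simp add: e_def \<rho>2_def rho_add rho_neg z_Y neg_Y minus_add add.assoc)
    also have "\<dots> = E i" by (simp add: EE[OF i, symmetric] add.assoc)
    finally show r: "\<rho>2 (e i) = E i" .
    show "e i \<in> Y2" using hi r by (simp add: Y2_def) (simp add: e_def add_Y neg_Y z_Y)
    have "h i + (z + - h i) = h i + (- h i + z)"
      using central_left(3)[OF central_Y[OF hi(1)]] by simp
    then show "imul (int 2) (e i) = z2"
      using two[of "e i"] by (simp add: e_def z2_def add.assoc)
  qed
  have Neven: "2 dvd N"
  proof -
    have "snd (E 0 + E 0) = N" using EE[of 0] by (simp add: rho_z)
    then have "N = 2 * snd (E 0)" by simp
    then show ?thesis by (rule dvdI)
  qed
  have start: "W.good 1 (range (\<lambda>i. imul i (e 0))) (mgen {e 0}) (e 0)"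
    using e[of 0] E[of 0] Neven by (intro W.good_start[where m = 2]) auto
  obtain X Q where X: "W.good (1 + 2 * n) X Q (W.iter_c (e 0) (\<lambda>i. e (Suc i)) (2 * n))"
    "range (\<lambda>i. imul i (e 0)) \<subseteq> X" "\<forall>i<2 * n. e (Suc i) \<in> X"
    "\<forall>j::nat. - imul (int j) (W.iter_c (e 0) (\<lambda>i. e (Suc i)) (2 * n)) + z2 \<in> Q"
    using W.good_chain[OF start, of "2 * n" "\<lambda>i. e (Suc i)" "\<lambda>_. 2"] e E Neven n by auto
  define c where "c = W.iter_c (e 0) (\<lambda>i. e (Suc i)) (2 * n)"
  \<comment> \<open>Every letter flips and \<open>z2\<close> does not, so the sum of the
    \<open>2 n + 1\<close> letters is odd and generates the quotient of order two. The integer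
    coordinate is doubled to avoid halving \<open>N\<close>.\<close>
  have c_inv: "W.iter_c (e 0) (\<lambda>i. e (Suc i)) k \<in> Y2
      \<and> wflip (W.iter_c (e 0) (\<lambda>i. e (Suc i)) k) = even k
      \<and> 2 * snd (\<rho>2 (W.iter_c (e 0) (\<lambda>i. e (Suc i)) k)) = N - int k * N"
    if "k \<le> 2 * n" for k
    using that
  proof (induction k)
    case 0
    have "snd (E 0) + snd (E 0) = N" using EE[of 0] by (metis le0 rho_z snd_add snd_conv)
    then show ?case using e[of 0] by (simp add: e_def[of 0, symmetric]) (simp add: e_def)
  next
    case (Suc k)
    let ?c = "W.iter_c (e 0) (\<lambda>i. e (Suc i)) k"
    have IH: "?c \<in> Y2" "wflip ?c = even k" "2 * snd (\<rho>2 ?c) = N - int k * N" using Suc by auto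
    have ek: "e (Suc k) \<in> Y2" "\<rho>2 (e (Suc k)) = E (Suc k)" using e Suc.prems by auto
    have "snd (E (Suc k)) + snd (E (Suc k)) = N" using EE[OF Suc.prems] by (metis rho_z snd_add snd_conv)
    moreover have "wflip (e (Suc k))" "\<not> wflip z2" by (simp_all add: e_def z2_def)
    ultimately show ?case
      using IH ek W.add_Y W.neg_Y W.z_Y
      by (simp add: W.rho_add W.rho_neg W.rho_z wflip_add wflip_neg algebra_simps)
  qed
  have cY: "c \<in> Y2" "wflip c" "2 * snd (\<rho>2 c) = N - 2 * int n * N" using c_inv[of "2 * n"] by (auto simp: c_def)
  have g: "W.good (1 + 2 * n) X Q c" using X(1) by (simp add: c_def)
  have C: "cone z2 X Q c N" and XY: "X \<subseteq> Y2" using g by (auto simp: W.good_def)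
  interpret C: cone z2 X Q c N by fact
  define \<chi> :: "'a wreath \<Rightarrow> int" where "\<chi> x = (if wflip x then 1 else 0)" for x
  have cq: "cyclic_quotient z2 X Q c \<chi> 2"
    by unfold_locales (auto simp: \<chi>_def wflip_add cY cong_def)
  define K where "K = {x \<in> X. int 2 dvd \<chi> x}"
  have K_flip: "x \<in> K \<longleftrightarrow> x \<in> X \<and> \<not> wflip x" for x by (auto simp: K_def \<chi>_def)
  have "cone z2 K (Q \<inter> K) (imul (int 2) c) N"
    unfolding K_def by (rule cone_cyclic_quotient[OF C cq]) (use X(4) in \<open>auto simp: \<chi>_def z2_def c_def\<close>)
  then have "cone (wfst z2) (wfst ` K) (wfst ` (Q \<inter> K)) (wfst (imul (int 2) c)) N"
    by (rule cone_image) (simp add: wfst_add K_flip)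
  then have cone: "cone z (wfst ` K) (wfst ` (Q \<inter> K)) (wfst (imul (int 2) c)) N"
    by (simp add: z2_def)
  have rK: "\<rho> (wfst x) = \<rho>2 x" if "\<not> wflip x" for x using that by (simp add: \<rho>2_def)
  have c2: "imul (int 2) c = c + c" using two[of c] by simp
  have c2f: "\<not> wflip (c + c)" using cY by (simp add: wflip_add)
  have act_c2: "papp (fst (\<rho> (wfst (c + c)))) t = W.act c (W.act c t)" for t
    using rK[OF c2f] W.act_add[OF cY(1) cY(1)] by simp
  have pos: "0 \<le> act q 0" if "q \<in> wfst ` (Q \<inter> K)" for q
    using that g rK by (auto simp: K_flip W.good_def)
  have "0 \<le> W.act c (base_pt (Suc (1 + 2 * n)))" using g by (simp add: W.good_def)
  then have "W.act c 0 \<le> W.act c (W.act c (base_pt (Suc (1 + 2 * n))))" by (rule W.act_le[OF cY(1)])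
  then have node: "0 \<le> act (wfst (imul (int 2) c)) (base_pt (Suc (2 * n + 1)))"
    using W.good_act_c[OF g] unfolding c2 act_c2 by simp
  have KY: "wfst ` K \<subseteq> Y" using XY by (auto simp: K_flip Y2_def)
  have "good (2 * n + 1) (wfst ` K) (wfst ` (Q \<inter> K)) (wfst (imul (int 2) c))"
    unfolding good_def using cone KY pos node by blast
  moreover have "h i \<in> wfst ` K" if i: "i \<le> 2 * n" for i
  proof -
    \<comment> \<open>The sum \<open>e 0 + e i\<close> is even and has first coordinate
      \<open>h i\<close>; for \<open>i = 0\<close> this is \<open>z\<close>.\<close>
    have e0: "e 0 \<in> X" using X(2) by (metis imul_1 rangeI subsetD)
    have "e i \<in> X" using e0 X(3) i by (cases i) auto
    then have "e 0 + e i \<in> K" using e0 C.add_X by (auto simp: K_flip wflip_add) (simp_all add: e_def)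
    moreover have "wfst (e 0 + e i) = h i" by (simp add: e_def h0)
    ultimately show ?thesis by force
  qed
  moreover have "snd (\<rho> (wfst (imul (int 2) c))) = N * (1 - 2 * int n)"
    using rK[OF c2f] W.rho_add[OF cY(1) cY(1)] cY(3) unfolding c2 by (simp add: algebra_simps)
  ultimately show ?thesis by blast
qed

end

section \<open>Presented groups\<close>

definition ev :: "('g \<Rightarrow> 'a::group_add) \<Rightarrow> 'g word \<Rightarrow> 'a" where
  "ev f w = sum_list (map (\<lambda>(g, b). if b then - f g else f g) w)"

lemma ev_simps [simp]: "ev f [] = 0" "ev f ((g, b) # w) = (if b then - f g else f g) + ev f w"
  "ev f (u @ v) = ev f u + ev f v"
  by (simp_all add: ev_def)

lemma ev_replicate: "ev f (replicate n (g, False)) = imul (int n) (f g)"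
  by (induction n) (simp_all add: imul_succ add.commute[of 1])

lemma ev_pres_eq: "pres_eq R u v \<Longrightarrow> (\<And>r. r \<in> R \<Longrightarrow> ev f r = 0) \<Longrightarrow> ev f u = ev f v"
  by (induction rule: pres_eq.induct) (auto simp: add.assoc)

lemma pres_eq_context: "pres_eq R u v \<Longrightarrow> pres_eq R (x @ u @ y) (x @ v @ y)"
proof (induction rule: pres_eq.induct)
  case (pe_cancel u g b v)
  show ?case using pres_eq.pe_cancel[of R "x @ u" g b "v @ y"] by simp
next
  case (pe_rel r u v)
  show ?case using pres_eq.pe_rel[OF pe_rel, of "x @ u" "v @ y"] by simp
qed (auto intro: pres_eq.intros)

lemma pres_eq_append: "pres_eq R u u' \<Longrightarrow> pres_eq R v v' \<Longrightarrow> pres_eq R (u @ v) (u' @ v')"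
  using pres_eq_context[of R u u' "[]" v] pres_eq_context[of R v v' u' "[]"] pe_trans by fastforce

locale presentation =
  fixes S :: "'g set" and R :: "'g word set"
begin

definition cls :: "'g word \<Rightarrow> 'g word set" where
  "cls w = pres_rel S R `` {w}"

abbreviation words :: "'g word set" where
  "words \<equiv> lists (S \<times> UNIV)"

lemma equiv_pres_rel: "equiv words (pres_rel S R)"
  by (rule equivI) (auto simp: pres_rel_def refl_on_def sym_def trans_def
      intro: pres_eq.intros dest: pe_sym pe_trans)

lemma cls_eq_iff: "u \<in> words \<Longrightarrow> v \<in> words \<Longrightarrow> cls u = cls v \<longleftrightarrow> pres_eq R u v"
  using eq_equiv_class_iff[OF equiv_pres_rel, of u v] by (simp add: cls_def pres_rel_def)

lemma in_cls: "w \<in> words \<Longrightarrow> v \<in> cls w \<longleftrightarrow> v \<in> words \<and> pres_eq R w v"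
  by (auto simp: cls_def pres_rel_def)

lemma carrier_presented: "carrier (presented_group S R) = cls ` words"
  by (auto simp: presented_group_def quotient_def cls_def)

lemma one_presented: "\<one>\<^bsub>presented_group S R\<^esub> = cls []"
  by (simp add: presented_group_def cls_def)

lemma mult_cls:
  assumes "u \<in> words" "v \<in> words"
  shows "cls u \<otimes>\<^bsub>presented_group S R\<^esub> cls v = cls (u @ v)"
proof -
  have "cls (a @ b) = cls (u @ v)" if "a \<in> cls u" "b \<in> cls v" for a b
    using that assms pres_eq_append[of R u a v b] by (subst cls_eq_iff) (auto simp: in_cls intro: pe_sym)
  moreover have "u \<in> cls u" "v \<in> cls v" using assms by (auto simp: in_cls intro: pe_refl)
  ultimately have "(\<Union>a\<in>cls u. \<Union>b\<in>cls v. cls (a @ b)) = cls (u @ v)" by blast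
  then show ?thesis by (simp add: presented_group_def cls_def)
qed

definition word_inv :: "'g word \<Rightarrow> 'g word" where
  "word_inv w = rev (map (\<lambda>(g, b). (g, \<not> b)) w)"

lemma word_inv_words: "w \<in> words \<Longrightarrow> word_inv w \<in> words"
  by (auto simp: word_inv_def)

lemma word_inv_cancel: "pres_eq R (word_inv w @ w) []"
proof (induction w)
  case (Cons l w)
  obtain g b where l: "l = (g, b)" by (cases l)
  have "pres_eq R (word_inv w @ [(g, \<not> b), (g, \<not> \<not> b)] @ w) (word_inv w @ w)" by (rule pe_cancel)
  then show ?case using Cons pe_trans by (fastforce simp: word_inv_def l)
qed (simp add: word_inv_def pe_refl)

lemma group_presented: "group (presented_group S R)"
proof (rule groupI)
  let ?G = "presented_group S R"
  show "\<one>\<^bsub>?G\<^esub> \<in> carrier ?G" by (auto simp: one_presented carrier_presented)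
  show "x \<otimes>\<^bsub>?G\<^esub> y \<in> carrier ?G" if xy: "x \<in> carrier ?G" "y \<in> carrier ?G" for x y
  proof -
    obtain u v where uv: "u \<in> words" "v \<in> words" "x = cls u" "y = cls v"
      using xy unfolding carrier_presented by blast
    then have "u @ v \<in> words" by simp
    then show ?thesis using mult_cls[OF uv(1,2)] uv(3,4) unfolding carrier_presented by blast
  qed
  show "x \<otimes>\<^bsub>?G\<^esub> y \<otimes>\<^bsub>?G\<^esub> w = x \<otimes>\<^bsub>?G\<^esub> (y \<otimes>\<^bsub>?G\<^esub> w)"
    if xyw: "x \<in> carrier ?G" "y \<in> carrier ?G" "w \<in> carrier ?G" for x y w
  proof -
    obtain a b c where "a \<in> words" "b \<in> words" "c \<in> words" "x = cls a" "y = cls b" "w = cls c"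
      using xyw unfolding carrier_presented by blast
    then show ?thesis by (simp add: mult_cls)
  qed
  show "\<one>\<^bsub>?G\<^esub> \<otimes>\<^bsub>?G\<^esub> x = x" if x: "x \<in> carrier ?G" for x
  proof -
    obtain a where "a \<in> words" "x = cls a" using x unfolding carrier_presented by blast
    then show ?thesis by (simp add: one_presented mult_cls)
  qed
  show "\<exists>y\<in>carrier ?G. y \<otimes>\<^bsub>?G\<^esub> x = \<one>\<^bsub>?G\<^esub>" if x: "x \<in> carrier ?G" for x
  proof -
    obtain w where w: "w \<in> words" "x = cls w" using x by (auto simp: carrier_presented)
    have wi: "word_inv w \<in> words" using word_inv_words w by blast
    have "word_inv w @ w \<in> words" using w wi by simp
    then have "cls (word_inv w) \<otimes>\<^bsub>?G\<^esub> x = cls []"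
      using w wi word_inv_cancel cls_eq_iff[of "word_inv w @ w" "[]"] by (simp add: mult_cls)
    then show ?thesis using wi by (auto simp: carrier_presented one_presented)
  qed
qed

definition lift :: "('g \<Rightarrow> 'a::group_add) \<Rightarrow> 'g word set \<Rightarrow> 'a" where
  "lift f A = ev f (SOME w. w \<in> A)"

lemma lift_cls:
  assumes "\<And>r. r \<in> R \<Longrightarrow> ev f r = 0" "w \<in> words"
  shows "lift f (cls w) = ev f w"
proof -
  have "w \<in> cls w" using assms by (simp add: in_cls pe_refl)
  then have "(SOME v. v \<in> cls w) \<in> cls w" by (rule someI)
  then have "pres_eq R w (SOME v. v \<in> cls w)" using in_cls assms by blast
  then show ?thesis using ev_pres_eq[of R w _ f] assms by (simp add: lift_def)
qed

end

text \<open>Left multiplication, extended by the identity outside the carrier to give a bijection of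
  the whole type.\<close>

definition cayley :: "('a, 'b) monoid_scheme \<Rightarrow> 'a \<Rightarrow> 'a bperm" where
  "cayley G g = Bperm (\<lambda>x. if x \<in> carrier G then g \<otimes>\<^bsub>G\<^esub> x else x)"

context group
begin

lemma papp_cayley:
  assumes "g \<in> carrier G"
  shows "papp (cayley G g) x = (if x \<in> carrier G then g \<otimes> x else x)"
proof -
  have "bij (\<lambda>x. if x \<in> carrier G then g \<otimes> x else x)"
    by (rule bij_betw_byWitness[where f' = "\<lambda>x. if x \<in> carrier G then inv g \<otimes> x else x"])
      (use assms in \<open>auto simp flip: m_assoc\<close>)
  then show ?thesis by (simp add: cayley_def papp_Bperm)
qed

lemma cayley_mult: "g \<in> carrier G \<Longrightarrow> h \<in> carrier G \<Longrightarrow> cayley G (g \<otimes> h) = cayley G g + cayley G h"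
  by (rule bperm_eqI) (auto simp: papp_cayley m_assoc)

lemma papp_cayley_one: "g \<in> carrier G \<Longrightarrow> papp (cayley G g) \<one> = g"
  by (simp add: papp_cayley)

lemma inj_on_cayley: "inj_on (cayley G) (carrier G)"
  by (rule inj_onI) (metis papp_cayley_one)

end

section \<open>The group Ghat\<close>

text \<open>Each summand is at most \<open>- N / 2\<close> because \<open>m i\<close> is at least
  \<open>2\<close>. This suffices when \<open>n\<close> is positive or \<open>k\<close> is at least
  \<open>3\<close>; for \<open>n = 0\<close> and \<open>k = 2\<close>, one \<open>m i\<close> is at
  least \<open>3\<close>, and its summand is at most \<open>- 2 N / 3\<close>.\<close>

lemma euler_characteristic_negative:
  fixes n k :: nat and m :: "nat \<Rightarrow> nat" and N :: int
  assumes k: "k \<ge> 1" and m: "\<forall>i<k. m i \<ge> 2" and N: "N > 0"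
    and ex: "\<not> (n = 0 \<and> k = 1)" "\<not> (n = 0 \<and> k = 2 \<and> m 0 = 2 \<and> m 1 = 2)"
  shows "N * (1 - 2 * int n) + (\<Sum>i<k. N div int (m i) - N) < 0"
proof -
  have half: "a * (N div int (m i)) \<le> N" if "i < k" "int (m i) \<ge> a" for i a
  proof -
    have mi: "int (m i) > 0" using m that by fastforce
    then have "0 \<le> N div int (m i)" using N by (simp add: pos_imp_zdiv_nonneg_iff)
    then have "a * (N div int (m i)) \<le> int (m i) * (N div int (m i))"
      using that by (intro mult_right_mono) auto
    also have "\<dots> \<le> N" 
      using pos_mod_sign[OF mi, of N] minus_mod_eq_mult_div[of N "int (m i)"] by linarith
    finally show ?thesis .
  qed
  have "(\<Sum>i<k. 2 * (N div int (m i) - N)) \<le> (\<Sum>i<k. - N)"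
    using half[of _ 2] m by (intro sum_mono) force
  then have S: "2 * (\<Sum>i<k. N div int (m i) - N) \<le> - (int k * N)" by (simp add: sum_distrib_left)
  show ?thesis
  proof (cases "n = 0")
    case False
    then have "N * (1 - 2 * int n) \<le> N * (- 1)" using N by (intro mult_left_mono) auto
    moreover have "0 \<le> int k * N" using N by simp
    ultimately show ?thesis using S N by linarith
  next
    case True
    show ?thesis
    proof (cases "k = 2")
      case False
      then have "k \<ge> 3" using k ex True by linarith
      then have "3 * N \<le> int k * N" using N by (intro mult_right_mono) auto
      moreover have "N * (1 - 2 * int n) = N" using True by simp
      ultimately show ?thesis using S N by linarith
    next
      case k2: True
      have "m 0 \<noteq> 2 \<or> m 1 \<noteq> 2" using ex k2 True by auto
      moreover have "m 0 \<ge> 2" "m 1 \<ge> 2" using m k2 by simp_all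
      ultimately have "m 0 \<ge> 3 \<or> m 1 \<ge> 3" by linarith
      moreover have "2 * (N div int (m 0)) \<le> N" "2 * (N div int (m 1)) \<le> N"
        using half[of _ 2] m k2 by auto
      moreover have "m 0 \<ge> 3 \<Longrightarrow> 3 * (N div int (m 0)) \<le> N" "m 1 \<ge> 3 \<Longrightarrow> 3 * (N div int (m 1)) \<le> N"
        using half[of _ 3] k2 by auto
      moreover have "(\<Sum>i<k. N div int (m i) - N) = N div int (m 0) + N div int (m 1) - 2 * N"
        by (simp add: k2 numeral_2_eq_2)
      ultimately show ?thesis using True N by auto
    qed
  qed
qed

lemma (in line_action) snd_iter_c:
  assumes "c \<in> Y" "\<And>i. i < k \<Longrightarrow> e i \<in> Y"
  shows "iter_c c e k \<in> Y \<and> snd (\<rho> (iter_c c e k)) = snd (\<rho> c) + (\<Sum>i<k. snd (\<rho> (e i)) - N)"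
  using assms(2)
proof (induction k)
  case (Suc k)
  then show ?case using add_Y neg_Y z_Y by (simp add: rho_add rho_neg rho_z)
qed (simp add: assms)

text \<open>The hypotheses of \<open>root_of_translation\<close> for a map sending
  \<open>base_pt (j + 2)\<close> to \<open>base_pt (j + 1) + 1\<close>.\<close>

lemma base_pt_bounds: "base_pt (Suc (Suc j)) < base_pt (Suc j) + 1" "base_pt (Suc j) + 1 < base_pt (Suc (Suc j)) + 1"
proof -
  have "1 / real (Suc j) \<le> 1" "0 < 1 / real (Suc (Suc j))" by simp_all
  then show "base_pt (Suc (Suc j)) < base_pt (Suc j) + 1" unfolding base_pt_def by linarith
  have "1 / real (Suc (Suc j)) < 1 / real (Suc j)" by (intro divide_strict_left_mono) auto
  then show "base_pt (Suc j) + 1 < base_pt (Suc (Suc j)) + 1" by (simp add: base_pt_def)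
qed

theorem theorem1p2:
  fixes n k :: nat and m :: "nat \<Rightarrow> nat"
  assumes "k \<ge> 1"
    and "\<forall>i<k. m i \<ge> 2"
    and "\<not> (n = 0 \<and> k = 1)"
    and "\<not> (n = 0 \<and> k = 2 \<and> m 0 = 2 \<and> m 1 = 2)"
  shows "\<exists>Ords. Ords \<subseteq> {lt. isolated_left_order (Ghat n k m) lt}
             \<and> infinite Ords \<and> countable Ords
             \<and> (\<forall>l1\<in>Ords. \<forall>l2\<in>Ords. l1 \<noteq> l2 \<longrightarrow>
                   \<not> (\<exists>\<phi>\<in>iso (Ghat n k m) (Ghat n k m). l2 = aut_image (Ghat n k m) l1 \<phi>))"
proof -
  define S where "S = Ghat_gens n k"
  define R where "R = Ghat_rels n k m"
  interpret P: presentation S R .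
  define G where "G = Ghat n k m"
  have Gdef: "G = presented_group S R" by (simp add: G_def Ghat_def S_def R_def)
  interpret G: group G unfolding Gdef by (rule P.group_presented)
  define N where "N = 2 * (\<Prod>i<k. int (m i))"
  have mpos: "m i \<ge> 2" if "i < k" for i using assms that by blast
  have N_pos: "N > 0" unfolding N_def using mpos by (auto intro!: prod_pos) (metis gr0I not_numeral_le_zero)
  have m_dvd: "int (m i) dvd N" if "i < k" for i unfolding N_def using that by (intro dvd_mult dvd_prodI) auto

  \<comment> \<open>Positions \<open>0\<close> to \<open>2 n\<close> belong to auxiliary square
    roots of \<open>z\<close>, the following \<open>k\<close> positions to the
    \<open>e\<close>'s.\<close>
  define mm where "mm j = (if j < 2 * n + 1 then 2 else m (j - (2 * n + 1)))" for j
  have mm: "mm j \<ge> 2 \<and> int (mm j) dvd N" if "j < 2 * n + 1 + k" for j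
    using that mpos m_dvd by (auto simp: mm_def) (simp add: N_def)
  have "\<exists>F :: real bperm. j < 2 * n + 1 + k \<longrightarrow> strict_mono (papp F) \<and> imul (int (mm j)) F = translation 1
      \<and> papp F (base_pt (Suc (Suc j))) = base_pt (Suc j) + 1" for j
    using root_of_translation[OF _ base_pt_bounds, of "mm j" j] mm by blast
  then obtain F :: "nat \<Rightarrow> real bperm" where F: "\<And>j. j < 2 * n + 1 + k \<Longrightarrow> strict_mono (papp (F j))
      \<and> imul (int (mm j)) (F j) = translation 1 \<and> papp (F j) (base_pt (Suc (Suc j))) = base_pt (Suc j) + 1"
    by metis
  define T where "T j = (F j, N div int (mm j))" for j
  have T: "imul (int (mm j)) (T j) = (translation 1, N)" if "j < 2 * n + 1 + k" for j
    using F[OF that] mm[OF that] by (subst imul_prod) (simp add: T_def imul_int)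
  have T_com: "T j + (translation 1, N) = (translation 1, N) + T j" if "j < 2 * n + 1 + k" for j
    using imul_commute[of "T j" "T j" "int (mm j)"] T[OF that] by simp
  \<comment> \<open>Each \<open>H j\<close> acts as a product of two square roots of the central
    translation, so it commutes with the image of \<open>Z\<close>.\<close>
  define f :: "gen \<Rightarrow> real bperm \<times> int" where
    "f g = (case g of E i \<Rightarrow> T (2 * n + 1 + i) | H j \<Rightarrow> T 0 + T (Suc j) | Z \<Rightarrow> (translation 1, N))" for g
  have rel: "ev f r = 0" if r: "r \<in> R" for r
  proof -
    consider i where "i < k" "r = replicate (m i) (E i, False) @ [(Z, True)]"
      | j where "j < 2 * n" "r = [(H j, False), (Z, False), (H j, True), (Z, True)]"
      using r by (auto simp: R_def Ghat_rels_def)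
    then show ?thesis
    proof cases
      case 1
      then show ?thesis using T[of "2 * n + 1 + i"] by (simp add: ev_replicate f_def mm_def zero_prod_def)
    next
      case 2
      let ?u = "(translation 1, N)"
      have "T 0 + ?u = ?u + T 0" "T (Suc j) + ?u = ?u + T (Suc j)"
        using T_com[of 0] T_com[of "Suc j"] 2(1) by simp_all
      then have "T 0 + T (Suc j) + ?u = ?u + (T 0 + T (Suc j))" by (metis add.assoc)
      moreover have "x + (u + (- x + - u)) = 0" if "x + u = u + x" for x u :: "real bperm \<times> int"
      proof -
        have "- x + - u = - (x + u)" using that by (simp only: minus_add)
        then show ?thesis by (simp only: right_minus flip: add.assoc)
      qed
      ultimately have "(T 0 + T (Suc j)) + (?u + (- (T 0 + T (Suc j)) + - ?u)) = 0" by blast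
      then show ?thesis using 2 by (simp only: ev_simps f_def gen.case if_False if_True add_0_right simp_thms)
    qed
  qed

  define cw where "cw w = cayley G (P.cls w)" for w
  define gg where "gg g = cw [(g, False)]" for g
  have carr: "carrier G = P.cls ` P.words" by (simp add: Gdef P.carrier_presented)
  have cls_c: "w \<in> P.words \<Longrightarrow> P.cls w \<in> carrier G" for w unfolding carr by (rule imageI)
  have cw_app: "cw (u @ v) = cw u + cw v" if "u \<in> P.words" "v \<in> P.words" for u v
    using that G.cayley_mult[OF cls_c cls_c] P.mult_cls unfolding cw_def Gdef by metis
  have cw_nil: "cw [] = 0" using cw_app[of "[]" "[]"] by (metis append_Nil lists.Nil add_0_right add_left_cancel)
  have cw_eq: "cw u = cw v" if "u \<in> P.words" "v \<in> P.words" "pres_eq R u v" for u v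
    using P.cls_eq_iff[OF that(1,2)] that(3) by (simp add: cw_def)
  have cw_inv: "cw [(g, True)] = - gg g" if "g \<in> S" for g
  proof -
    have w: "[(g, False)] \<in> P.words" "[(g, True)] \<in> P.words" using that by auto
    have "pres_eq R ([] @ [(g, False), (g, \<not> False)] @ []) ([] @ [])" by (rule pe_cancel)
    then have "cw ([(g, False)] @ [(g, True)]) = cw []" using that by (intro cw_eq) auto
    then have "gg g + cw [(g, True)] = 0" using cw_app[OF w] cw_nil by (simp add: gg_def)
    then show ?thesis using minus_unique by metis
  qed
  have cw_ev: "cw w = ev gg w" if "w \<in> P.words" for w
    using that
  proof (induction w rule: list.induct)
    case (Cons l w)
    obtain g b where l: "l = (g, b)" by (cases l)
    have g: "g \<in> S" "w \<in> P.words" "[l] \<in> P.words" using Cons.prems l by auto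
    have "cw (l # w) = cw [l] + cw w" using cw_app[OF g(3,2)] by simp
    moreover have "cw [l] = (if b then - gg g else gg g)" using cw_inv[OF g(1)] by (auto simp: l gg_def)
    ultimately show ?case using Cons.IH g by (simp add: l)
  qed (simp add: cw_nil)
  have gens: "Z \<in> S" "\<And>i. i < k \<Longrightarrow> E i \<in> S" "\<And>j. j < 2 * n \<Longrightarrow> H j \<in> S"
    by (auto simp: S_def Ghat_gens_def)
  have cw_rel: "ev gg r = 0" if r: "r \<in> R" "r \<in> P.words" for r
  proof -
    have "pres_eq R ([] @ r @ []) ([] @ [])" by (rule pe_rel[OF r(1)])
    then have "cw r = cw []" using r by (intro cw_eq) auto
    then show ?thesis using cw_ev[OF r(2)] cw_nil by simp
  qed
  define z where "z = gg Z"
  have e_z: "imul (int (m i)) (gg (E i)) = z" if i: "i < k" for i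
  proof -
    let ?r = "replicate (m i) (E i, False) @ [(Z, True)]"
    have "ev gg ?r = 0" by (rule cw_rel) (use i gens in \<open>auto simp: R_def Ghat_rels_def\<close>)
    then have "imul (int (m i)) (gg (E i)) + - z = 0" by (simp add: ev_replicate z_def)
    then show ?thesis by (simp add: eq_neg_iff_add_eq_0[symmetric])
  qed
  have h_z: "gg (H j) + z = z + gg (H j)" if j: "j < 2 * n" for j
  proof -
    let ?r = "[(H j, False), (Z, False), (H j, True), (Z, True)]"
    have "ev gg ?r = 0" by (rule cw_rel) (use j gens in \<open>auto simp: R_def Ghat_rels_def\<close>)
    then have "(gg (H j) + z) + - (z + gg (H j)) = 0" by (simp add: z_def add.assoc minus_add)
    then show ?thesis by (simp add: eq_neg_iff_add_eq_0[symmetric])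
  qed
  have g_z: "gg g + z = z + gg g" if g: "g \<in> S" for g
    using g e_z imul_commute[of "gg g" "gg g"] h_z by (auto simp: S_def Ghat_gens_def z_def) (metis)

  define Y where "Y = cw ` P.words"
  have Y_cayley: "Y = cayley G ` carrier G" by (simp add: Y_def cw_def carr image_image)
  \<comment> \<open>Evaluating a permutation at the identity recovers the group element, on which
    the lifted homomorphism is defined.\<close>
  define \<rho> where "\<rho> x = P.lift f (papp x \<one>\<^bsub>G\<^esub>)" for x
  have rho: "\<rho> (cw w) = ev f w" if "w \<in> P.words" for w
    using that G.papp_cayley_one[OF cls_c] P.lift_cls[of f w] rel by (simp add: \<rho>_def cw_def)
  have f_mono: "strict_mono (papp (fst (f g)))" if g: "g \<in> S" for g
    using g F by (auto simp: S_def Ghat_gens_def f_def T_def strict_mono_translation intro!: strict_mono_add)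
  have ev_f_mono: "strict_mono (papp (fst (ev f w)))" if "w \<in> P.words" for w
    using that
  proof (induction w rule: list.induct)
    case Nil
    show ?case by (simp add: strict_mono_def)
  next
    case (Cons l w)
    obtain g b where l: "l = (g, b)" by (cases l)
    have g: "g \<in> S" "w \<in> P.words" using Cons.prems l by auto
    have "strict_mono (papp (fst (if b then - f g else f g)))"
      using f_mono[OF g(1)] strict_mono_neg[OF f_mono[OF g(1)]] by simp
    then show ?case using strict_mono_add Cons.IH[OF g(2)] l by (simp add: strict_mono_def)
  qed
  have ev_gg_z: "ev gg w + z = z + ev gg w" if "w \<in> P.words" for w
    using that
  proof (induction w rule: list.induct)
    case (Cons l w)
    obtain g b where l: "l = (g, b)" by (cases l)
    have g: "g \<in> S" "w \<in> P.words" using Cons.prems l by auto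
    show ?case using Cons.IH[OF g(2)] central_left[OF g_z[OF g(1)]] by (simp add: l add.assoc)
  qed simp
  interpret line_action z Y \<rho> N
  proof
    show "0 \<in> Y" using cw_nil by (force simp: Y_def)
    show "x + y \<in> Y" "\<rho> (x + y) = \<rho> x + \<rho> y" if xy: "x \<in> Y" "y \<in> Y" for x y
    proof -
      obtain u v where uv: "u \<in> P.words" "v \<in> P.words" "x = cw u" "y = cw v"
        using xy unfolding Y_def by blast
      have uvw: "u @ v \<in> P.words" using uv by simp
      show "x + y \<in> Y" using cw_app[OF uv(1,2)] uv uvw unfolding Y_def by (metis imageI)
      show "\<rho> (x + y) = \<rho> x + \<rho> y" using cw_app[OF uv(1,2)] uv rho[OF uvw] rho by simp
    qed
    show "- x \<in> Y" if x: "x \<in> Y" for x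
    proof -
      obtain u where u: "u \<in> P.words" "x = cw u" using x unfolding Y_def by blast
      have ui: "P.word_inv u \<in> P.words" using P.word_inv_words u by blast
      have "cw (P.word_inv u @ u) = cw []" using P.word_inv_cancel u ui by (intro cw_eq) simp_all
      then have "cw (P.word_inv u) + x = 0" using cw_app[OF ui u(1)] cw_nil u by simp
      then have "cw (P.word_inv u) = - x" by (simp add: eq_neg_iff_add_eq_0)
      then show ?thesis using ui unfolding Y_def by (metis imageI)
    qed
    show "strict_mono (papp (fst (\<rho> x)))" if x: "x \<in> Y" for x
    proof -
      obtain u where u: "u \<in> P.words" "x = cw u" using x unfolding Y_def by blast
      then show ?thesis using rho ev_f_mono by simp
    qed
    have Zw: "[(Z, False)] \<in> P.words" using gens by simp
    show "z \<in> Y" using Zw unfolding z_def gg_def Y_def by (rule imageI)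
    show "\<rho> z = (translation 1, N)" using rho[OF Zw] by (simp add: z_def gg_def f_def)
    show "x + z = z + x" if x: "x \<in> Y" for x
    proof -
      obtain u where u: "u \<in> P.words" "x = cw u" using x unfolding Y_def by blast
      then show ?thesis using cw_ev ev_gg_z by simp
    qed
  qed
  have gg: "gg g \<in> Y" "\<rho> (gg g) = f g" if "g \<in> S" for g
  proof -
    have w: "[(g, False)] \<in> P.words" using that by simp
    show "gg g \<in> Y" using w unfolding gg_def Y_def by (rule imageI)
    show "\<rho> (gg g) = f g" using rho[OF w] by (simp add: gg_def)
  qed
  define e where "e i = gg (E i)" for i
  have e: "e i \<in> Y" "\<rho> (e i) = T (2 * n + 1 + i)" "imul (int (m i)) (e i) = z" "m i \<ge> 2" "int (m i) dvd N"
    "act (e i) (base_pt (Suc (Suc (2 * n + 1 + i)))) = base_pt (Suc (2 * n + 1 + i)) + 1" if i: "i < k" for i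
  proof -
    show "e i \<in> Y" and r: "\<rho> (e i) = T (2 * n + 1 + i)" using gg[OF gens(2)[OF i]] by (simp_all add: e_def f_def)
    show "imul (int (m i)) (e i) = z" using e_z[OF i] by (simp add: e_def)
    show "m i \<ge> 2" "int (m i) dvd N" using mpos m_dvd i by auto
    show "act (e i) (base_pt (Suc (Suc (2 * n + 1 + i)))) = base_pt (Suc (2 * n + 1 + i)) + 1"
      unfolding r using F[of "2 * n + 1 + i"] i by (simp add: T_def)
  qed
  have snd_e: "snd (\<rho> (e i)) = N div int (m i)" if "i < k" for i
    using e(2)[OF that] by (simp add: T_def mm_def)
  have "\<exists>r X Q c. good r X Q c \<and> (\<forall>i<k. e i \<in> X) \<and> (\<forall>j<2 * n. gg (H j) \<in> X)
    \<and> (\<forall>j::nat. - imul (int j) c + z \<in> Q)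
    \<and> (\<forall>x\<in>X. (\<forall>y\<in>X. x + y = y + x) \<longrightarrow> (\<exists>i. x = imul i z))
    \<and> snd (\<rho> c) = N * (1 - 2 * int n) + (\<Sum>i<k. N div int (m i) - N)"
  proof (cases "n = 0")
    case False
    \<comment> \<open>The index is shifted by one so that \<open>h 0 = z\<close> matches the square
      of the root at position \<open>0\<close>.\<close>
    define h where "h i = (if i = 0 then z else gg (H (i - 1)))" for i
    have "imul 2 (T i) = \<rho> z \<and> strict_mono (papp (fst (T i))) \<and>
      papp (fst (T i)) (base_pt (Suc (Suc i))) = base_pt (Suc i) + 1" if "i \<le> 2 * n" for i
      using T[of i] F[of i] that by (simp add: mm_def rho_z T_def)
    moreover have "h i \<in> Y \<and> \<rho> (h i) = T 0 + T i" if i: "i \<le> 2 * n" for i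
    proof (cases i)
      case 0
      have "imul 2 (T 0) = T 0 + T 0" using imul_add[of 1 1 "T 0"] by simp
      then show ?thesis using T[of 0] 0 by (simp add: h_def z_Y rho_z mm_def)
    next
      case (Suc j)
      then show ?thesis using gg[OF gens(3), of j] i by (simp add: h_def f_def)
    qed
    ultimately obtain A QA cA where A: "good (2 * n + 1) A QA cA" "\<forall>i\<le>2 * n. h i \<in> A"
      "snd (\<rho> cA) = N * (1 - 2 * int n)"
      using good_genus[of n h T] False by (auto simp: h_def)
    obtain X Q where X: "good (2 * n + 1 + k) X Q (iter_c cA e k)" "A \<subseteq> X" "\<forall>i<k. e i \<in> X"
      "\<forall>j::nat. - imul (int j) (iter_c cA e k) + z \<in> Q"
      "\<forall>x\<in>X. (\<forall>y\<in>X. x + y = y + x) \<longrightarrow> (\<exists>i. x = imul i z)"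
      using good_chain[OF A(1), of k e m] e assms(1) by auto
    have "gg (H j) \<in> X" if "j < 2 * n" for j
      using A(2)[rule_format, of "Suc j"] that X(2) by (auto simp: h_def)
    moreover have "cA \<in> Y"
    proof -
      interpret A: cone z A QA cA N using A(1) by (simp add: good_def)
      show ?thesis using A(1) A.c_X by (auto simp: good_def)
    qed
    then have "snd (\<rho> (iter_c cA e k)) = N * (1 - 2 * int n) + (\<Sum>i<k. N div int (m i) - N)"
      using snd_iter_c[of cA k e] e(1) A(3) snd_e by simp
    ultimately show ?thesis using X by blast
  next
    case True
    have k0: "0 < k" using assms(1) by simp
    \<comment> \<open>For \<open>n = 0\<close> the auxiliary position \<open>0\<close> is skipped;
      \<open>e 0\<close> sits at position \<open>1\<close> and sends \<open>base_pt 3\<close> to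
      \<open>base_pt 2 + 1\<close>, so the chain starts at \<open>2\<close>.\<close>
    have start: "good 2 (range (\<lambda>i. imul i (e 0))) (mgen {e 0}) (e 0)"
      using e[OF k0] True by (intro good_start[where m = "m 0"]) (auto simp: numeral_2_eq_2)
    have step: "e (Suc i) \<in> Y \<and> imul (int (m (Suc i))) (e (Suc i)) = z \<and> m (Suc i) \<ge> 2 \<and> int (m (Suc i)) dvd N \<and>
      act (e (Suc i)) (base_pt (Suc (Suc (2 + i)))) = base_pt (Suc (2 + i)) + 1" if "i < k - 1" for i
      using e[of "Suc i"] that True by auto
    obtain X Q where X: "good (2 + (k - 1)) X Q (iter_c (e 0) (\<lambda>i. e (Suc i)) (k - 1))"
      "range (\<lambda>i. imul i (e 0)) \<subseteq> X" "\<forall>i<k - 1. e (Suc i) \<in> X"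
      "\<forall>j::nat. - imul (int j) (iter_c (e 0) (\<lambda>i. e (Suc i)) (k - 1)) + z \<in> Q"
      "\<forall>x\<in>X. (\<forall>y\<in>X. x + y = y + x) \<longrightarrow> (\<exists>i. x = imul i z)"
      using good_chain[OF start, of "k - 1" "\<lambda>i. e (Suc i)" "\<lambda>i. m (Suc i)"] step assms True by auto
    have "e i \<in> X" if "i < k" for i
    proof (cases i)
      case 0
      then show ?thesis using X(2) by (metis imul_1 rangeI subsetD)
    next
      case (Suc j)
      then show ?thesis using X(3) that by auto
    qed
    moreover have "snd (\<rho> (iter_c (e 0) (\<lambda>i. e (Suc i)) (k - 1))) = N * (1 - 2 * int n) + (\<Sum>i<k. N div int (m i) - N)"
    proof -
      have "(\<Sum>i<k. N div int (m i) - N) = N div int (m 0) - N + (\<Sum>i<k - 1. N div int (m (Suc i)) - N)"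
        using k0 by (cases k) (auto simp: sum.lessThan_Suc_shift simp del: sum.lessThan_Suc)
      moreover have "(\<Sum>i<k - 1. snd (\<rho> (e (Suc i))) - N) = (\<Sum>i<k - 1. N div int (m (Suc i)) - N)"
        by (rule sum.cong) (auto simp: snd_e)
      ultimately show ?thesis
        using snd_iter_c[of "e 0" "k - 1" "\<lambda>i. e (Suc i)"] e(1) k0 snd_e[OF k0] True by simp
    qed
    ultimately show ?thesis using X True by auto
  qed
  then obtain r X Q c where X: "good r X Q c" "\<And>i. i < k \<Longrightarrow> e i \<in> X" "\<And>j. j < 2 * n \<Longrightarrow> gg (H j) \<in> X"
    "\<And>j::nat. - imul (int j) c + z \<in> Q"
    "\<And>x. x \<in> X \<Longrightarrow> (\<And>y. y \<in> X \<Longrightarrow> x + y = y + x) \<Longrightarrow> \<exists>i. x = imul i z"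
    "snd (\<rho> c) = N * (1 - 2 * int n) + (\<Sum>i<k. N div int (m i) - N)"
    by blast
  interpret C: cone z X Q c N using X(1) by (simp add: good_def)
  have XY: "X \<subseteq> Y" using X(1) by (simp add: good_def)
  \<comment> \<open>All generators lie in \<open>X\<close>, so the iterated amalgam is the whole
    image of the presented group.\<close>
  have gX: "gg g \<in> X" if "g \<in> S" for g
    using that X(2,3) C.z_X by (auto simp: S_def Ghat_gens_def e_def z_def)
  have "ev gg w \<in> X" if "w \<in> P.words" for w
    using that
  proof (induction w rule: list.induct)
    case (Cons l w)
    then show ?case using gX C.add_X C.neg_X by (cases l) auto
  qed (simp add: C.zero_X)
  then have "Y = X" using XY cw_ev unfolding Y_def by auto
  interpret rigid_cone z X Q c N "\<lambda>x. snd (\<rho> x)"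
  proof
    show "q \<in> Q \<Longrightarrow> - q \<in> Q \<Longrightarrow> q = 0" for q using good_antisym[OF X(1)] by blast
    show "- imul (int j) c + z \<in> Q" for j by (rule X(4))
    show "x \<in> X \<Longrightarrow> (\<And>y. y \<in> X \<Longrightarrow> x + y = y + x) \<Longrightarrow> \<exists>i. x = imul i z" for x by (rule X(5))
    show "snd (\<rho> (x + y)) = snd (\<rho> x) + snd (\<rho> y)" if "x \<in> X" "y \<in> X" for x y
      using that XY rho_add by (metis snd_add subsetD)
    show "snd (\<rho> z) = N" by (simp add: rho_z)
    show "N > 0" by (rule N_pos)
    show "snd (\<rho> c) \<noteq> 0" using euler_characteristic_negative[OF assms(1,2) N_pos assms(3,4)] X(6) by simp
  qed
  have "bij_betw (cayley G) (carrier G) X"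
    using G.inj_on_cayley Y_cayley \<open>Y = X\<close> by (simp add: bij_betw_def)
  then have "\<exists>Ords. Ords \<subseteq> {lt. isolated_left_order G lt} \<and> infinite Ords \<and> countable Ords
             \<and> (\<forall>l1\<in>Ords. \<forall>l2\<in>Ords. l1 \<noteq> l2 \<longrightarrow> \<not> (\<exists>\<phi>\<in>iso G G. l2 = aut_image G l1 \<phi>))"
    by (rule infinitely_many_isolated[OF G.is_group]) (rule G.cayley_mult)
  then show ?thesis by (simp add: G_def)
qed

end
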